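(* Let $\mathcal{B}_{\mathrm{bm}}^+=\int_0^1\max(B(t),0)\,dt$ be the integral of the positive part of a standard Brownian motion on $[0,1]$. For $s>0$, the negative moment $\mathbb{E}(\mathcal{B}_{\mathrm{bm}}^+)^{-s}$ is finite if and only if $s<1/3$, and $s\mapsto\mathbb{E}(\mathcal{B}_{\mathrm{bm}}^+)^s$ is analytic in the half-plane $\operatorname{Re}s>-\frac13$. Moreover, $\mathbb{E}(\mathcal{B}_{\mathrm{bm}}^+)^s$ extends to a meromorphic function of $s$ in the complex plane, all of whose poles are simple and belong to $\{-\frac13,-1,-\frac53,\dots\}=\{-\frac{2k+1}{3}:k=0,1,2,\dots\}$; and its residue at $s=-\frac13$ is $$\operatorname{Res}_{s=-1/3}\mathbb{E}(\mathcal{B}_{\mathrm{bm}}^+)^s=\frac{2^{1/6}}{\Gamma(1/2)\Gamma(1/3)}\cdot\frac{\mathrm{Ai}(0)}{-\mathrm{Ai}'(0)}=\frac{2^{1/6}3^{-1/3}}{\sqrt{\pi}\,\Gamma(2/3)}=2^{-5/6}3^{1/6}\pi^{-3/2}\Gamma(1/3).$$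
   Context: $B$ denotes a standard Brownian motion with $B(0)=0$. $\mathrm{Ai}$ is the Airy function. *)

theory Defs
  imports "HOL-Probability.Probability" "HOL-Complex_Analysis.Complex_Analysis"
begin

(* Standard Brownian motion with time set T (an interval containing 0), in the version whose
   paths are all continuous and start at 0.  Increments over [s, t] have variance t - s;
   normal_density takes the standard deviation as its second argument. *)
definition standard_brownian_motion ::
    "'a measure \<Rightarrow> real set \<Rightarrow> (real \<Rightarrow> 'a \<Rightarrow> real) \<Rightarrow> bool" where
  "standard_brownian_motion M T B \<longleftrightarrow>
     prob_space M \<and>
     (\<forall>t\<in>T. B t \<in> borel_measurable M) \<and>
     (\<forall>\<omega>\<in>space M. B 0 \<omega> = 0) \<and>
     (\<forall>s\<in>T. \<forall>t\<in>T. s < t \<longrightarrow>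
        distributed M lborel (\<lambda>\<omega>. B t \<omega> - B s \<omega>) (normal_density 0 (sqrt (t - s)))) \<and>
     (\<forall>n t. (\<forall>i\<le>n. t i \<in> T) \<and> strict_mono_on {..n} t \<longrightarrow>
        prob_space.indep_vars M (\<lambda>_. borel) (\<lambda>i \<omega>. B (t (Suc i)) \<omega> - B (t i) \<omega>) {..<n}) \<and>
     (\<forall>\<omega>\<in>space M. continuous_on T (\<lambda>t. B t \<omega>))"

definition positive_part_area :: "(real \<Rightarrow> 'a \<Rightarrow> real) \<Rightarrow> 'a \<Rightarrow> real" where
  "positive_part_area B \<omega> = integral {0..1} (\<lambda>t. max (B t \<omega>) 0)"

(* The powr of the library has 0 powr s = 0; negative moments of a variable that may vanish
   are therefore taken in ennreal, where inverse 0 = top. *)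
definition negative_moment :: "'a measure \<Rightarrow> ('a \<Rightarrow> real) \<Rightarrow> real \<Rightarrow> ennreal" where
  "negative_moment M X s = (\<integral>\<^sup>+\<omega>. inverse (ennreal (X \<omega> powr s)) \<partial>M)"

definition complex_moment :: "'a measure \<Rightarrow> ('a \<Rightarrow> real) \<Rightarrow> complex \<Rightarrow> complex" where
  "complex_moment M X s = (\<integral>\<omega>. complex_of_real (X \<omega>) powr s \<partial>M)"

(* The integral over [0, \<infinity>) converges only conditionally, hence the explicit limit. *)
definition airy_Ai :: "real \<Rightarrow> real" where
  "airy_Ai x = (1 / pi) * Lim at_top (\<lambda>R. integral {0..R} (\<lambda>t. cos (t ^ 3 / 3 + x * t)))"

end

theory Submission
  imports Defs "HOL-Real_Asymp.Real_Asymp"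
begin

text \<open>
  Write \<open>X\<close> for the area of the positive part of the Brownian motion on the unit interval and
  \<open>\<psi>\<close> for its Laplace transform.  By Brownian scaling, the area up to time \<open>t\<close> has the law of
  \<open>t powr (3 / 2) * X\<close>, so the Laplace transform in time
    \<open>g(x) = \<integral> exp (- x t) \<psi> (t powr (3 / 2)) dt\<close>
  is the resolvent, started at \<open>0\<close>, of a Brownian motion that is killed at rate \<open>max y 0\<close>.
  Interchanging integrals (\<open>mellin_resolvent\<close>) turns the Mellin transform of \<open>g\<close> into a
  moment of \<open>X\<close>: for \<open>0 < z < 1\<close>,
    \<open>\<integral> x powr (- z) g(x) dx = \<Gamma> (1 - z) * (2 / 3) * \<Gamma> (2 z / 3) * E X powr (- 2 z / 3)\<close>,
  where both sides may be infinite.  Everything asserted about negative moments is therefore a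
  statement about \<open>g\<close> near \<open>0\<close>; near infinity the bound \<open>g(x) \<le> 1 / x\<close> is enough.

  Near \<open>0\<close> the function \<open>g\<close> is explicit.  The resolvent equation
  \<open>w'' / 2 - (x + max y 0) w = - 1\<close> has constant coefficients on the left half line and is an
  inhomogeneous Airy equation on the right one.  Matching the bounded solutions at \<open>0\<close> gives
  (\<open>resolvent_near_0\<close>) \<open>g(x) = h (sqrt x) / sqrt x\<close> with \<open>h\<close> holomorphic near \<open>0\<close> and
  \<open>h 0 = 2 powr (1 / 6) * Ai 0 / (- Ai' 0)\<close>, because the numerator and the denominator are entire
  in \<open>sqrt x\<close>.  In particular \<open>g(x)\<close> is of the exact order \<open>1 / sqrt x\<close>, which gives the
  threshold \<open>z = 1 / 2\<close>, that is \<open>s = 1 / 3\<close>.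

  For the continuation put \<open>z = - 3 s / 2\<close>.  The part of the Mellin integral beyond a small
  \<open>\<delta>\<^sup>2\<close> is holomorphic for \<open>Re s < 0\<close>.  Expanding \<open>h\<close> in powers of \<open>sqrt x\<close>, the part below
  \<open>\<delta>\<^sup>2\<close> becomes a series of simple poles at \<open>s = - (k + 1) / 3\<close> (\<open>head_mellin\<close>).  Division by the
  Gamma factors cancels the poles with odd \<open>k\<close>, since \<open>1 / \<Gamma> (1 + 3 s / 2)\<close> vanishes there, and
  leaves the poles \<open>- (2 k + 1) / 3\<close>.  The residue at \<open>- 1 / 3\<close> is \<open>h 0 / (\<Gamma> (1 / 2) \<Gamma> (1 / 3))\<close>.

  Two ingredients carry most of the work.  The first is the identification of \<open>g(x)\<close> with the
  value at \<open>0\<close> of the solution of the resolvent equation (\<open>feynman_kac_resolvent\<close>).  No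
  stochastic calculus is used: the Brownian motion is sampled on a grid, a bounded solution \<open>w\<close> is
  expanded to second order at each step of the resulting Gaussian walk, and the errors tend to
  \<open>0\<close> with the mesh.  The second is the Airy function (\<open>airy_Ai_eq\<close>).  Rotating the ray of
  integration by the angle \<open>pi / 6\<close> turns the conditionally convergent cosine integral into the
  real part of an absolutely convergent Laplace integral; its imaginary part is \<open>pi\<close> times the
  Scorer function \<open>Gi\<close>, which solves the inhomogeneous equation and is bounded on the right half
  line.  So one entire function serves both for the solution \<open>w\<close> and for the constants
  \<open>Ai 0\<close> and \<open>Ai' 0\<close>.
\<close>

section \<open>Laplace transforms with a real weight, and Gamma integrals\<close>

lemma norm_exp_minus_one_le: "norm (exp z - 1) \<le> norm z * exp (norm z)" for z :: complex
proof -
  have "norm (exp z - exp 0) \<le> exp (norm z) * norm (z - 0)"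
  proof (rule field_differentiable_bound[where S = "cball 0 (norm z)" and f' = exp])
    show "norm (exp u) \<le> exp (norm z)" if "u \<in> cball 0 (norm z)" for u
      using norm_exp[of u] that by (metis dist_0_norm exp_le_cancel_iff mem_cball order_trans)
  qed (auto intro!: derivative_eq_intros)
  then show ?thesis by (simp add: mult.commute)
qed

text \<open>
  Differentiation under the integral brings down a factor \<open>L\<close>; it is paid for by an arbitrarily
  small shift of the exponent to either side.
\<close>
lemma two_sided_exp_bound:
  fixes r L :: real
  assumes "r > 0"
  shows "\<bar>L\<bar> * exp (r * \<bar>L\<bar>) \<le> (exp (2 * r * L) + exp (- 2 * r * L)) / r"
proof -
  have "r * \<bar>L\<bar> \<le> exp (r * \<bar>L\<bar>)"
    using exp_ge_add_one_self[of "r * \<bar>L\<bar>"] by linarith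
  then have "r * \<bar>L\<bar> * exp (r * \<bar>L\<bar>) \<le> exp (r * \<bar>L\<bar>) * exp (r * \<bar>L\<bar>)"
    by (intro mult_right_mono) auto
  also have "\<dots> = exp (2 * r * \<bar>L\<bar>)" by (simp flip: exp_add)
  also have "\<dots> \<le> exp (2 * r * L) + exp (- 2 * r * L)"
    by (cases "L \<ge> 0") (auto simp: add_increasing add_increasing2)
  finally show ?thesis using assms by (simp add: field_simps)
qed

context
  fixes M :: "'a measure" and G L :: "'a \<Rightarrow> real" and a b :: real
  assumes meas [measurable]: "G \<in> borel_measurable M" "L \<in> borel_measurable M"
    and int: "\<And>\<sigma>. a < \<sigma> \<Longrightarrow> \<sigma> < b \<Longrightarrow> integrable M (\<lambda>\<omega>. G \<omega> * exp (\<sigma> * L \<omega>))"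
begin

text \<open>
  A complex power \<open>X powr s\<close> is \<open>exp (s * ln X)\<close>, so moments, Mellin transforms and the Airy
  integral are all of the form \<open>\<integral> G * exp (s * L)\<close> with real \<open>G\<close> and \<open>L\<close>.  Integrability at the real
  exponents of an open strip makes such an integral holomorphic there.
\<close>
lemma integrable_laplace:
  assumes "a < Re s" "Re s < b"
  shows "integrable M (\<lambda>\<omega>. of_real (G \<omega>) * exp (s * of_real (L \<omega>)) :: complex)"
  by (rule Bochner_Integration.integrable_bound[OF int[OF assms]]) (auto simp: norm_mult)

lemma integrable_laplace_deriv:
  assumes "a < \<sigma>" "\<sigma> < b"
  shows "integrable M (\<lambda>\<omega>. (G \<omega> * L \<omega>) * exp (\<sigma> * L \<omega>))"
proof -
  obtain r where r: "r > 0" "a < \<sigma> - 2 * r" "\<sigma> + 2 * r < b"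
    using that[of "min (\<sigma> - a) (b - \<sigma>) / 4"] assms by (auto simp: field_simps min_def)
  have "integrable M (\<lambda>\<omega>. (G \<omega> * exp ((\<sigma> + 2 * r) * L \<omega>) ) / r)"
       "integrable M (\<lambda>\<omega>. (G \<omega> * exp ((\<sigma> - 2 * r) * L \<omega>)) / r)"
    using r by (intro integrable_divide int; simp)+
  then have "integrable M (\<lambda>\<omega>. \<bar>G \<omega> * exp ((\<sigma> + 2 * r) * L \<omega>) / r\<bar> + \<bar>G \<omega> * exp ((\<sigma> - 2 * r) * L \<omega>) / r\<bar>)"
    by (intro Bochner_Integration.integrable_add integrable_abs)
  then show ?thesis
  proof (rule Bochner_Integration.integrable_bound)
    show "AE \<omega> in M. norm (G \<omega> * L \<omega> * exp (\<sigma> * L \<omega>)) \<le> norm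
            (\<bar>G \<omega> * exp ((\<sigma> + 2 * r) * L \<omega>) / r\<bar> + \<bar>G \<omega> * exp ((\<sigma> - 2 * r) * L \<omega>) / r\<bar>)"
    proof (rule AE_I2)
      fix \<omega>
      have "\<bar>L \<omega>\<bar> \<le> \<bar>L \<omega>\<bar> * exp (r * \<bar>L \<omega>\<bar>)"
        using mult_left_mono[of 1 "exp (r * \<bar>L \<omega>\<bar>)" "\<bar>L \<omega>\<bar>"] r by simp
      also have "\<dots> \<le> (exp (2 * r * L \<omega>) + exp (- 2 * r * L \<omega>)) / r"
        by (rule two_sided_exp_bound[OF r(1)])
      finally have "(\<bar>G \<omega>\<bar> * exp (\<sigma> * L \<omega>)) * \<bar>L \<omega>\<bar> \<le>
          (\<bar>G \<omega>\<bar> * exp (\<sigma> * L \<omega>)) * ((exp (2 * r * L \<omega>) + exp (- 2 * r * L \<omega>)) / r)"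
        by (intro mult_left_mono) auto
      then show "norm (G \<omega> * L \<omega> * exp (\<sigma> * L \<omega>)) \<le> norm
            (\<bar>G \<omega> * exp ((\<sigma> + 2 * r) * L \<omega>) / r\<bar> + \<bar>G \<omega> * exp ((\<sigma> - 2 * r) * L \<omega>) / r\<bar>)"
        using r by (simp add: abs_mult field_simps exp_add exp_diff exp_minus)
    qed
  qed auto
qed

lemma laplace_has_field_derivative:
  assumes s: "a < Re s" "Re s < b"
  shows "((\<lambda>s. \<integral>\<omega>. of_real (G \<omega>) * exp (s * of_real (L \<omega>)) \<partial>M) has_field_derivative
           (\<integral>\<omega>. of_real (G \<omega> * L \<omega>) * exp (s * of_real (L \<omega>)) \<partial>M :: complex)) (at s)"
proof -
  define \<sigma> where "\<sigma> = Re s"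
  obtain r where r: "r > 0" "a < \<sigma> - 2 * r" "\<sigma> + 2 * r < b"
    using that[of "min (\<sigma> - a) (b - \<sigma>) / 4"] s by (auto simp: field_simps min_def \<sigma>_def)
  define F where "F s \<omega> = (of_real (G \<omega>) * exp (s * of_real (L \<omega>)) :: complex)" for s \<omega>
  have intF: "integrable M (F z)" if "z \<in> ball s r" for z
  proof -
    have "\<bar>Re (s - z)\<bar> < r" using that abs_Re_le_cmod[of "s - z"] by (auto simp: dist_norm)
    then show ?thesis unfolding F_def using r by (intro integrable_laplace) (auto simp: \<sigma>_def)
  qed
  have [measurable]: "F z \<in> borel_measurable M" for z
    unfolding F_def by measurable
  let ?D = "\<lambda>\<omega>. of_real (G \<omega> * L \<omega>) * exp (s * of_real (L \<omega>)) :: complex"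
  have "((\<lambda>z. \<integral>\<omega>. (F z \<omega> - F s \<omega>) / (z - s) \<partial>M) \<longlongrightarrow> integral\<^sup>L M ?D) (at s within ball s r)"
    unfolding tendsto_at_iff_sequentially comp_def
  proof (intro allI impI)
    fix X :: "nat \<Rightarrow> complex" assume X: "\<forall>i. X i \<in> ball s r - {s}" "X \<longlonglongrightarrow> s"
    show "(\<lambda>n. \<integral>\<omega>. (F (X n) \<omega> - F s \<omega>) / (X n - s) \<partial>M) \<longlonglongrightarrow> integral\<^sup>L M ?D"
    proof (rule integral_dominated_convergence)
      let ?W = "\<lambda>\<omega>. \<bar>G \<omega> * exp ((\<sigma> + 2 * r) * L \<omega>) / r\<bar> + \<bar>G \<omega> * exp ((\<sigma> - 2 * r) * L \<omega>) / r\<bar>"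
      have "integrable M (\<lambda>\<omega>. (G \<omega> * exp ((\<sigma> + 2 * r) * L \<omega>) ) / r)"
           "integrable M (\<lambda>\<omega>. (G \<omega> * exp ((\<sigma> - 2 * r) * L \<omega>)) / r)"
        using r by (intro integrable_divide int; simp)+
      then show "integrable M ?W" by (intro Bochner_Integration.integrable_add integrable_abs)
      show "AE \<omega> in M. (\<lambda>n. (F (X n) \<omega> - F s \<omega>) / (X n - s)) \<longlonglongrightarrow> ?D \<omega>"
      proof (rule AE_I2)
        fix \<omega>
        have "((\<lambda>z. F z \<omega>) has_field_derivative ?D \<omega>) (at s)"
          unfolding F_def by (auto intro!: derivative_eq_intros)
        then have lim: "((\<lambda>z. (F z \<omega> - F s \<omega>) / (z - s)) \<longlongrightarrow> ?D \<omega>) (at s)"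
          by (simp add: has_field_derivative_iff)
        have "filterlim X (at s) sequentially"
          using X by (auto simp: filterlim_at)
        from filterlim_compose[OF lim this]
        show "(\<lambda>n. (F (X n) \<omega> - F s \<omega>) / (X n - s)) \<longlonglongrightarrow> ?D \<omega>" .
      qed
      fix n
      show "AE \<omega> in M. norm ((F (X n) \<omega> - F s \<omega>) / (X n - s)) \<le> ?W \<omega>"
      proof (rule AE_I2)
        fix \<omega>
        define h where "h = X n - s"
        have h: "h \<noteq> 0" "norm h \<le> r" using X(1) by (auto simp: h_def dist_norm norm_minus_commute less_imp_le)
        have "F (X n) \<omega> - F s \<omega> = F s \<omega> * (exp (h * L \<omega>) - 1)"
          by (simp add: F_def h_def algebra_simps flip: exp_add)
        then have "norm ((F (X n) \<omega> - F s \<omega>) / (X n - s))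
            = \<bar>G \<omega>\<bar> * exp (\<sigma> * L \<omega>) * (norm (exp (h * L \<omega>) - 1) / norm h)"
          by (simp add: F_def norm_mult norm_divide \<sigma>_def h_def)
        also have "\<dots> \<le> \<bar>G \<omega>\<bar> * exp (\<sigma> * L \<omega>) * (\<bar>L \<omega>\<bar> * exp (r * \<bar>L \<omega>\<bar>))"
        proof (intro mult_left_mono)
          have "norm (exp (h * L \<omega>) - 1) / norm h \<le> norm (h * L \<omega>) * exp (norm (h * L \<omega>)) / norm h"
            by (intro divide_right_mono norm_exp_minus_one_le) auto
          also have "\<dots> = \<bar>L \<omega>\<bar> * exp (norm h * \<bar>L \<omega>\<bar>)"
            using h by (simp add: norm_mult)
          also have "\<dots> \<le> \<bar>L \<omega>\<bar> * exp (r * \<bar>L \<omega>\<bar>)"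
            using h by (intro mult_left_mono) (auto intro: mult_right_mono)
          finally show "norm (exp (h * L \<omega>) - 1) / norm h \<le> \<bar>L \<omega>\<bar> * exp (r * \<bar>L \<omega>\<bar>)" .
        qed auto
        also have "\<dots> \<le> \<bar>G \<omega>\<bar> * exp (\<sigma> * L \<omega>) * ((exp (2 * r * L \<omega>) + exp (- 2 * r * L \<omega>)) / r)"
          by (intro mult_left_mono two_sided_exp_bound[OF r(1)]) auto
        also have "\<dots> = ?W \<omega>"
          using r by (simp add: abs_mult field_simps exp_add exp_diff exp_minus)
        finally show "norm ((F (X n) \<omega> - F s \<omega>) / (X n - s)) \<le> ?W \<omega>" .
      qed
    qed (simp_all)
  qed
  then have "((\<lambda>z. \<integral>\<omega>. (F z \<omega> - F s \<omega>) / (z - s) \<partial>M) \<longlongrightarrow> integral\<^sup>L M ?D) (at s)"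
    using r(1) by (subst (asm) at_within_open) auto
  moreover have "\<forall>\<^sub>F z in at s. (\<integral>\<omega>. (F z \<omega> - F s \<omega>) / (z - s) \<partial>M) = (integral\<^sup>L M (F z) - integral\<^sup>L M (F s)) / (z - s)"
  proof -
    have "\<forall>\<^sub>F z in at s. z \<in> ball s r"
      using r(1) by (intro eventually_at_in_open') auto
    then show ?thesis
      by eventually_elim (use r intF in \<open>auto simp: Bochner_Integration.integral_diff\<close>)
  qed
  ultimately have "((\<lambda>z. (integral\<^sup>L M (F z) - integral\<^sup>L M (F s)) / (z - s)) \<longlongrightarrow> integral\<^sup>L M ?D) (at s)"
    by (rule Lim_transform_eventually)
  then show ?thesis by (simp add: has_field_derivative_iff F_def[abs_def])
qed

end

text \<open>
  The substitution \<open>u = c * t powr \<alpha>\<close> in Euler's integral.  The exponents \<open>\<alpha> = 1\<close>, \<open>3 / 2\<close> and \<open>3\<close>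
  are those of the time variable, of the scaled area and of the Airy integral.
\<close>
lemma nn_integral_Gamma_power:
  fixes p \<alpha> c :: real
  assumes "p > 0" "\<alpha> > 0" "c > 0"
  shows "(\<integral>\<^sup>+t. ennreal (t powr (p - 1) * exp (- (c * t powr \<alpha>))) * indicator {0<..} t \<partial>lborel)
         = ennreal (Gamma (p / \<alpha>) / \<alpha> * c powr (- (p / \<alpha>)))"
proof -
  let ?g = "\<lambda>t. c * t powr \<alpha>" and ?g' = "\<lambda>t. c * \<alpha> * t powr (\<alpha> - 1)"
  let ?f = "\<lambda>u. u powr (p / \<alpha> - 1) / exp u"
  have pa: "p / \<alpha> > 0" using assms by simp
  have img: "?g ` {0<..} = {0<..}"
  proof safe
    fix u :: real assume "u > 0"
    then have "u = ?g ((u / c) powr (1 / \<alpha>))" "(u / c) powr (1 / \<alpha>) > 0" using assms by (auto simp: powr_powr)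
    then show "u \<in> ?g ` {0<..}" by blast
  qed (use assms in auto)
  have inj: "inj_on ?g {0<..}"
  proof (rule inj_onI)
    fix x y :: real assume "x \<in> {0<..}" "y \<in> {0<..}" "?g x = ?g y"
    then have "(x powr \<alpha>) powr (1 / \<alpha>) = (y powr \<alpha>) powr (1 / \<alpha>)" using assms by simp
    then show "x = y" using \<open>x \<in> _\<close> \<open>y \<in> _\<close> assms by (simp add: powr_powr)
  qed
  have "(?f has_integral Gamma (p / \<alpha>)) {0..}"
    by (rule Gamma_integral_real[OF pa])
  then have f1: "(?f has_integral Gamma (p / \<alpha>)) {0<..}"
    by (subst (asm) has_integral_spike_set_eq[where T = "{0<..}"])
       (auto intro: negligible_subset[of "{0}"])
  then have "?f absolutely_integrable_on {0<..}"
    by (intro nonnegative_absolutely_integrable_1) (auto simp: integrable_on_def)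
  then have A: "?f absolutely_integrable_on ?g ` {0<..} \<and> integral (?g ` {0<..}) ?f = Gamma (p / \<alpha>)"
    using f1 unfolding img by (auto simp: has_integral_iff)
  have "(\<lambda>t. \<bar>?g' t\<bar> * ?f (?g t)) absolutely_integrable_on {0<..} \<and>
        integral {0<..} (\<lambda>t. \<bar>?g' t\<bar> * ?f (?g t)) = Gamma (p / \<alpha>)"
    by (subst has_absolute_integral_change_of_variables_1'[OF _ _ inj])
       (use A assms in \<open>auto intro!: derivative_eq_intros simp: powr_diff\<close>)
  then have "((\<lambda>t. \<bar>?g' t\<bar> * ?f (?g t)) has_integral Gamma (p / \<alpha>)) {0<..}"
    by (auto simp: has_integral_iff absolutely_integrable_on_def)
  then have "((\<lambda>t. (c powr (- (p / \<alpha>)) / \<alpha>) * (\<bar>?g' t\<bar> * ?f (?g t))) has_integral (c powr (- (p / \<alpha>)) / \<alpha>) * Gamma (p / \<alpha>)) {0<..}"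
    by (rule has_integral_mult_right)
  then have "((\<lambda>t. t powr (p - 1) * exp (- (c * t powr \<alpha>))) has_integral (c powr (- (p / \<alpha>)) / \<alpha>) * Gamma (p / \<alpha>)) {0<..}"
  proof (rule has_integral_eq[rotated])
    fix t :: real assume t: "t \<in> {0<..}"
    have e: "\<alpha> * (p / \<alpha> - 1) = p - \<alpha>" using assms by (simp add: field_simps)
    have t1: "t powr (\<alpha> - 1) * t powr (p - \<alpha>) = t powr (p - 1)"
      by (simp flip: powr_add)
    have c1: "c powr (- (p / \<alpha>)) * (c * c powr (p / \<alpha> - 1)) = 1"
      using assms by (subst powr_mult_base) (auto simp flip: powr_add)
    have "\<bar>?g' t\<bar> = c * \<alpha> * t powr (\<alpha> - 1)"
      using assms by simp
    moreover have "?f (?g t) = c powr (p / \<alpha> - 1) * t powr (p - \<alpha>) * exp (- (c * t powr \<alpha>))"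
      using assms by (simp only: exp_minus divide_inverse[of _ "exp _"])
        (simp add: powr_mult powr_powr e)
    ultimately have "c powr (- (p / \<alpha>)) / \<alpha> * (\<bar>?g' t\<bar> * ?f (?g t))
        = (c powr (- (p / \<alpha>)) * (c * c powr (p / \<alpha> - 1))) * (t powr (\<alpha> - 1) * t powr (p - \<alpha>)) * exp (- (c * t powr \<alpha>))"
      using assms by simp
    then show "c powr (- (p / \<alpha>)) / \<alpha> * (\<bar>?g' t\<bar> * ?f (?g t)) = t powr (p - 1) * exp (- (c * t powr \<alpha>))"
      unfolding t1 c1 by simp
  qed
  then show ?thesis
    by (subst nn_integral_has_integral_lebesgue') (auto simp: mult.commute)
qed

lemma has_bochner_integral_Gamma_power:
  fixes p \<alpha> c :: real
  assumes "p > 0" "\<alpha> > 0" "c > 0"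
  shows "has_bochner_integral lborel (\<lambda>t. indicator {0<..} t * (t powr (p - 1) * exp (- (c * t powr \<alpha>))))
           (Gamma (p / \<alpha>) / \<alpha> * c powr (- (p / \<alpha>)))"
proof (rule has_bochner_integral_nn_integral)
  show "(\<integral>\<^sup>+t. ennreal (indicator {0<..} t * (t powr (p - 1) * exp (- (c * t powr \<alpha>)))) \<partial>lborel)
        = ennreal (Gamma (p / \<alpha>) / \<alpha> * c powr (- (p / \<alpha>)))"
    by (subst nn_integral_Gamma_power[OF assms, symmetric])
       (auto intro!: nn_integral_cong simp: indicator_def)
qed (use assms Gamma_real_pos[of "p / \<alpha>"] in auto)

section \<open>The Airy function through a Laplace transform on a rotated ray\<close>

text \<open>
  The transform with \<open>k = 0\<close> is \<open>pi\<close> times the Scorer function \<open>Hi\<close>; the factor \<open>r ^ k\<close> gives its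
  \<open>k\<close>-th derivative.
\<close>
definition airy_weight :: "nat \<Rightarrow> real \<Rightarrow> real" where
  "airy_weight k r = indicator {0<..} r * exp (- (r ^ 3 / 3)) * r ^ k"

definition airy_laplace :: "nat \<Rightarrow> complex \<Rightarrow> complex" where
  "airy_laplace k u = (\<integral>r. of_real (airy_weight k r) * exp (u * of_real r) \<partial>lborel)"

lemma airy_weight_measurable [measurable]: "airy_weight k \<in> borel_measurable borel"
  unfolding airy_weight_def by measurable

lemma cubic_exponent_bound:
  fixes \<sigma> r :: real
  assumes "r \<ge> 0"
  shows "\<sigma> * r - r ^ 3 / 3 \<le> (\<bar>\<sigma>\<bar> + 1) * sqrt (3 * (\<bar>\<sigma>\<bar> + 1)) - r"
proof -
  define \<tau> where "\<tau> = \<bar>\<sigma>\<bar> + 1"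
  have \<tau>: "\<tau> \<ge> 1" "\<sigma> + 1 \<le> \<tau>" by (auto simp: \<tau>_def)
  have "\<tau> * r - r ^ 3 / 3 \<le> \<tau> * sqrt (3 * \<tau>)"
  proof (cases "r \<le> sqrt (3 * \<tau>)")
    case True
    have "\<tau> * r \<le> \<tau> * sqrt (3 * \<tau>)" using True \<tau> by (intro mult_left_mono) auto
    moreover have "r ^ 3 \<ge> 0" using assms by simp
    ultimately show ?thesis by linarith
  next
    case False
    then have "3 * \<tau> \<le> r\<^sup>2" using assms \<tau> by (metis less_imp_le not_le real_le_lsqrt real_sqrt_le_iff real_sqrt_abs abs_of_nonneg)
    then have "3 * \<tau> * r \<le> r\<^sup>2 * r" using assms by (intro mult_right_mono)
    moreover have "0 \<le> \<tau> * sqrt (3 * \<tau>)" using \<tau> by auto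
    ultimately show ?thesis by (simp add: power2_eq_square power3_eq_cube)
  qed
  moreover have "(\<sigma> + 1) * r \<le> \<tau> * r" using \<tau> assms by (intro mult_right_mono)
  ultimately show ?thesis by (simp add: \<tau>_def algebra_simps)
qed

lemma integrable_airy_weight: "integrable lborel (\<lambda>r. airy_weight k r * exp (\<sigma> * r))"
proof (induction k arbitrary: \<sigma>)
  case 0
  define C where "C = exp ((\<bar>\<sigma>\<bar> + 1) * sqrt (3 * (\<bar>\<sigma>\<bar> + 1)))"
  have "integrable lborel (\<lambda>t::real. indicator {0<..} t * (t powr (1 - 1) * exp (- (1 * t powr 1))))"
    using has_bochner_integral_Gamma_power[of 1 1 1] by (rule integrable.intros) auto
  then have "integrable lborel (\<lambda>t::real. C * (indicator {0<..} t * (t powr (1 - 1) * exp (- (1 * t powr 1)))))"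
    by (rule integrable_mult_right)
  then show ?case
  proof (rule Bochner_Integration.integrable_bound)
    show "AE r in lborel. norm (airy_weight 0 r * exp (\<sigma> * r)) \<le> norm (C * (indicator {0<..} r * (r powr (1 - 1) * exp (- (1 * r powr 1)))))"
    proof (rule AE_I2)
      fix r :: real
      show "norm (airy_weight 0 r * exp (\<sigma> * r)) \<le> norm (C * (indicator {0<..} r * (r powr (1 - 1) * exp (- (1 * r powr 1)))))"
      proof (cases "r > 0")
        case True
        have "exp (\<sigma> * r - r ^ 3 / 3) \<le> C * exp (- r)"
          using cubic_exponent_bound[of r \<sigma>] True by (simp add: C_def flip: exp_add)
        moreover have "norm (airy_weight 0 r * exp (\<sigma> * r)) = exp (\<sigma> * r - r ^ 3 / 3)"
        proof -
          have "\<sigma> * r - r ^ 3 / 3 = - (r ^ 3 / 3) + \<sigma> * r" by simp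
          then show ?thesis using True by (simp only: exp_add) (simp add: airy_weight_def)
        qed
        ultimately show ?thesis using True by (simp add: C_def)
      qed (simp add: airy_weight_def)
    qed
  qed simp
next
  case (Suc k)
  have "integrable lborel (\<lambda>r. airy_weight k r * r * exp (\<sigma> * r))"
    by (rule integrable_laplace_deriv[where a = "\<sigma> - 1" and b = "\<sigma> + 1"]) (use Suc in auto)
  then show ?case by (simp add: airy_weight_def mult_ac)
qed

lemma integrable_airy_laplace:
  "integrable lborel (\<lambda>r. of_real (airy_weight k r) * exp (u * of_real r) :: complex)"
  by (rule integrable_laplace[where a = "Re u - 1" and b = "Re u + 1"])
     (auto intro: integrable_airy_weight)

lemma airy_laplace_deriv:
  "(airy_laplace k has_field_derivative airy_laplace (Suc k) u) (at u)"
proof -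
  have "((\<lambda>u. \<integral>r. of_real (airy_weight k r) * exp (u * of_real r) \<partial>lborel) has_field_derivative
        (\<integral>r. of_real (airy_weight k r * r) * exp (u * of_real r) \<partial>lborel :: complex)) (at u)"
    by (rule laplace_has_field_derivative[where a = "Re u - 1" and b = "Re u + 1"])
       (auto intro: integrable_airy_weight)
  then show ?thesis
    by (simp add: airy_laplace_def[abs_def] airy_weight_def mult_ac)
qed

lemma airy_laplace_holomorphic: "airy_laplace k holomorphic_on S"
  by (meson airy_laplace_deriv field_differentiable_at_within field_differentiable_def holomorphic_onI)

lemma exp_cubic_tendsto_0: "((\<lambda>r. exp (\<sigma> * r - r ^ 3 / 3)) \<longlongrightarrow> (0::real)) at_top"
proof (rule tendsto_sandwich[where f = "\<lambda>_. 0"])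
  define C where "C = (\<bar>\<sigma>\<bar> + 1) * sqrt (3 * (\<bar>\<sigma>\<bar> + 1))"
  show "\<forall>\<^sub>F r in at_top. exp (\<sigma> * r - r ^ 3 / 3) \<le> exp (C - r)"
    using eventually_ge_at_top[of 0] by eventually_elim (use cubic_exponent_bound in \<open>auto simp: C_def\<close>)
  show "((\<lambda>r. exp (C - r)) \<longlongrightarrow> 0) at_top"
    by real_asymp
qed auto

text \<open>
  The fundamental theorem of calculus for the integrand without the factor in front: its derivative
  is \<open>(u - r\<^sup>2)\<close> times itself, and it runs from \<open>1\<close> at \<open>0\<close> to \<open>0\<close> at infinity.
\<close>
lemma airy_laplace_ode: "airy_laplace 2 u = u * airy_laplace 0 u + 1"
proof -
  define F where "F r = exp (- (of_real r ^ 3 / 3) + u * of_real r)" for r :: real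
  define f where "f r = (u - of_real r ^ 2) * F r" for r :: real
  let ?f = "\<lambda>r. indicator {0<..} r *\<^sub>R f r"
  have eq: "?f r = u * (of_real (airy_weight 0 r) * exp (u * of_real r)) - of_real (airy_weight 2 r) * exp (u * of_real r)" for r
  proof -
    have "exp (- (of_real r ^ 3 / 3)) = (of_real (exp (- (r ^ 3 / 3))) :: complex)"
      by (simp flip: exp_of_real)
    then have "F r = of_real (exp (- (r ^ 3 / 3))) * exp (u * of_real r)"
      unfolding F_def exp_add by simp
    then show ?thesis by (simp add: f_def airy_weight_def indicator_def algebra_simps)
  qed
  have int: "integrable lborel ?f"
    unfolding eq by (intro Bochner_Integration.integrable_diff integrable_mult_right integrable_airy_laplace)
  have val: "integral\<^sup>L lborel ?f = u * airy_laplace 0 u - airy_laplace 2 u"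
    unfolding eq airy_laplace_def
    by (subst Bochner_Integration.integral_diff) (auto intro!: integrable_mult_right integrable_airy_laplace)
  have "((\<lambda>y. \<integral>r. indicator {..y} r *\<^sub>R ?f r \<partial>lborel) \<longlongrightarrow> integral\<^sup>L lborel ?f) at_top"
    by (rule tendsto_integral_at_top) (use int in auto)
  moreover have "\<forall>\<^sub>F y in at_top. (\<integral>r. indicator {..y} r *\<^sub>R ?f r \<partial>lborel) = F y - 1"
    using eventually_gt_at_top[of 0]
  proof eventually_elim
    case (elim y)
    have "(\<integral>r. indicator {..y} r *\<^sub>R ?f r \<partial>lborel) = (\<integral>r. indicator {0..y} r *\<^sub>R f r \<partial>lborel)"
    proof (rule integral_cong_AE)
      show "AE r in lborel. indicator {..y} r *\<^sub>R ?f r = indicator {0..y} r *\<^sub>R f r"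
        using AE_lborel_singleton[of "0::real"] by eventually_elim (auto simp: indicator_def)
    qed (auto simp: f_def F_def)
    also have "\<dots> = F y - F 0"
    proof (rule integral_FTC_Icc)
      fix r :: real
      have "((\<lambda>z. exp (- (z ^ 3 / 3) + u * z)) has_field_derivative f r) (at (of_real r))"
        unfolding f_def F_def by (auto intro!: derivative_eq_intros simp: algebra_simps)
      then show "(F has_vector_derivative f r) (at r within {0..y})"
        unfolding F_def by (intro has_vector_derivative_real_field) (auto intro: has_field_derivative_at_within)
    qed (use elim in \<open>auto simp: f_def F_def intro!: continuous_intros\<close>)
    finally show ?case by (simp add: F_def)
  qed
  ultimately have "((\<lambda>y. F y - 1) \<longlongrightarrow> integral\<^sup>L lborel ?f) at_top"
    by (rule Lim_transform_eventually)
  moreover have "((\<lambda>y. F y - 1) \<longlongrightarrow> 0 - 1) at_top"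
  proof (intro tendsto_intros)
    have "((\<lambda>y. norm (F y)) \<longlongrightarrow> 0) at_top"
      using exp_cubic_tendsto_0[of "Re u"] by (simp add: F_def algebra_simps flip: of_real_power)
    then show "(F \<longlongrightarrow> 0) at_top" by (rule tendsto_norm_zero_cancel)
  qed
  ultimately have "integral\<^sup>L lborel ?f = 0 - 1" by (rule tendsto_unique[rotated]) auto
  with val show ?thesis by (simp add: algebra_simps)
qed

definition \<omega>3 :: complex where "\<omega>3 = cis (2 * pi / 3)"

lemma omega3_parts: "Re \<omega>3 = - 1 / 2" "Im \<omega>3 = sqrt 3 / 2"
  by (simp_all add: \<omega>3_def cos_120 sin_120)

lemma i_cis_pi6: "\<i> * cis (pi / 6) = \<omega>3"
  by (rule complex_eqI) (simp_all add: omega3_parts cos_30 sin_30)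

lemma cis_pi6_cubed: "cis (pi / 6) ^ 3 = \<i>"
  by (simp add: Complex.DeMoivre)

lemma omega3_cubed: "\<omega>3 ^ 3 = 1"
  by (simp add: \<omega>3_def Complex.DeMoivre)

lemma cis_pi6_omega3_squared: "cis (pi / 6) * \<omega>3 ^ 2 = - \<i>"
proof -
  have "cis (pi / 6) * \<omega>3 ^ 2 = - (cis (pi/6) ^ 3)"
    unfolding i_cis_pi6[symmetric] by (simp add: power_mult_distrib power3_eq_cube power2_eq_square[of "cis _"])
  then show ?thesis by (simp add: cis_pi6_cubed)
qed

text \<open>
  The \<open>k\<close>-th derivative in \<open>x\<close> of \<open>\<integral> exp (\<i> (t ^ 3 / 3 + x t)) dt\<close>, taken along the ray of direction
  \<open>cis (pi / 6)\<close>.  For \<open>k = 0\<close> the real part is \<open>pi\<close> times \<open>Ai\<close> and the imaginary part is \<open>pi\<close> times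
  the Scorer function \<open>Gi\<close>; by \<open>airy_rot_ode\<close> the former solves the Airy equation and the latter the
  equation with right-hand side \<open>- 1\<close>.
\<close>
definition airy_rot :: "nat \<Rightarrow> real \<Rightarrow> complex" where
  "airy_rot k x = cis (pi / 6) * \<omega>3 ^ k * airy_laplace k (\<omega>3 * of_real x)"

lemma airy_rot_deriv: "(airy_rot k has_vector_derivative airy_rot (Suc k) x) (at x)"
proof -
  have "((\<lambda>z. cis (pi / 6) * \<omega>3 ^ k * airy_laplace k (\<omega>3 * z)) has_field_derivative airy_rot (Suc k) x) (at (of_real x))"
    unfolding airy_rot_def
    by (rule derivative_eq_intros airy_laplace_deriv[THEN DERIV_chain2] refl | simp)+
  then show ?thesis
    unfolding airy_rot_def[abs_def] by (intro has_vector_derivative_real_field) auto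
qed

lemma airy_rot_ode: "airy_rot 2 x = of_real x * airy_rot 0 x - \<i>"
proof -
  have "airy_rot 2 x = cis (pi / 6) * \<omega>3 ^ 3 * x * airy_laplace 0 (\<omega>3 * of_real x) + cis (pi / 6) * \<omega>3 ^ 2"
    by (simp add: airy_rot_def airy_laplace_ode algebra_simps power3_eq_cube power2_eq_square)
  then show ?thesis
    by (simp add: omega3_cubed cis_pi6_omega3_squared airy_rot_def)
qed

lemma airy_laplace_at_0:
  "airy_laplace 0 0 = of_real (3 powr (-2/3) * Gamma (1/3))"
  "airy_laplace 1 0 = of_real (3 powr (-1/3) * Gamma (2/3))"
proof -
  have *: "(\<integral>r. airy_weight k r \<partial>lborel) = Gamma (real (Suc k) / 3) / 3 * (1/3) powr (- (real (Suc k) / 3))" for k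
  proof -
    have "airy_weight k r = indicator {0<..} r * (r powr (real (Suc k) - 1) * exp (- (1/3 * r powr 3)))" for r
      by (auto simp: airy_weight_def indicator_def powr_realpow)
    then show ?thesis
      using has_bochner_integral_integral_eq[OF has_bochner_integral_Gamma_power[of "real (Suc k)" 3 "1/3"]]
      by simp
  qed
  have "airy_laplace k 0 = of_real (\<integral>r. airy_weight k r \<partial>lborel)" for k
    unfolding airy_laplace_def by simp
  note ** = this[unfolded *]
  have "1 / 3 * (1 / 3) powr - (1 / 3) = (3::real) powr (-2/3)"
       "1 / 3 * (1 / 3) powr - (2 / 3) = (3::real) powr (-1/3)"
    using powr_diff[of 3 "1/3" "1::real"] powr_diff[of 3 "2/3" "1::real"]
    by (simp_all add: powr_divide powr_minus)
  then show "airy_laplace 0 0 = of_real (3 powr (-2/3) * Gamma (1/3))"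
       "airy_laplace 1 0 = of_real (3 powr (-1/3) * Gamma (2/3))"
    unfolding ** by (simp_all add: mult.commute)
qed

lemma Re_Im_airy_rot_deriv:
  "((\<lambda>x. Re (airy_rot k x)) has_real_derivative Re (airy_rot (Suc k) x)) (at x)"
  "((\<lambda>x. Im (airy_rot k x)) has_real_derivative Im (airy_rot (Suc k) x)) (at x)"
  using bounded_linear.has_vector_derivative[OF bounded_linear_Re airy_rot_deriv]
    bounded_linear.has_vector_derivative[OF bounded_linear_Im airy_rot_deriv]
  by (auto simp: has_real_derivative_iff_has_vector_derivative)

text \<open>
  On the positive half line the exponent \<open>\<omega>3 * z\<close> has real part \<open>- z / 2\<close>, so the integral decays.
  The killing rate in the resolvent equation is \<open>z\<close> up to a constant factor, hence the bounds with
  the factor \<open>z\<close>.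
\<close>
lemma airy_rot_bounded:
  obtains K where "\<And>k z. k \<in> {0, 1} \<Longrightarrow> z \<ge> 0 \<Longrightarrow> norm (airy_rot k z) \<le> K"
    "\<And>k z. k \<in> {0, 1} \<Longrightarrow> z \<ge> 0 \<Longrightarrow> z * norm (airy_rot k z) \<le> K"
proof -
  define J where "J k = (\<integral>r. airy_weight k r \<partial>lborel)" for k
  have intJ: "integrable lborel (airy_weight k)" for k
    using integrable_airy_weight[of k 0] by simp
  have w0: "airy_weight k r \<ge> 0" for k r by (auto simp: airy_weight_def indicator_def)
  have J0: "J k \<ge> 0" for k unfolding J_def by (rule Bochner_Integration.integral_nonneg[OF w0])
  have intz: "integrable lborel (\<lambda>r. airy_weight k r * exp (- (z / 2) * r))" for k z
    by (rule integrable_airy_weight)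
  have le: "norm (airy_rot k z) \<le> (\<integral>r. airy_weight k r * exp (- (z / 2) * r) \<partial>lborel)" for k z
  proof -
    have "norm (airy_rot k z) = norm (airy_laplace k (\<omega>3 * of_real z))"
      by (simp add: airy_rot_def norm_mult norm_power \<omega>3_def)
    also have "\<dots> \<le> (\<integral>r. airy_weight k r * exp (- (z / 2) * r) \<partial>lborel)"
      unfolding airy_laplace_def
      by (rule order_trans[OF integral_norm_bound])
         (use w0 in \<open>auto simp: norm_mult omega3_parts abs_of_nonneg\<close>)
    finally show ?thesis .
  qed
  have b1: "norm (airy_rot k z) \<le> J k" if "z \<ge> 0" for k z
  proof -
    have "(\<integral>r. airy_weight k r * exp (- (z / 2) * r) \<partial>lborel) \<le> J k"
      unfolding J_def
    proof (rule integral_mono[OF intz intJ])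
      fix r :: real
      show "airy_weight k r * exp (- (z / 2) * r) \<le> airy_weight k r"
        using that w0[of k r] by (cases "r > 0") (auto intro!: mult_left_le simp: airy_weight_def)
    qed
    with le[of k z] show ?thesis by linarith
  qed
  have b2: "z * norm (airy_rot 0 z) \<le> 2" if "z \<ge> 0" for z
  proof (cases "z = 0")
    case False
    with that have z: "z > 0" by simp
    note g = has_bochner_integral_Gamma_power[of 1 1 "z/2"]
    have "(\<integral>r. airy_weight 0 r * exp (- (z / 2) * r) \<partial>lborel)
      \<le> (\<integral>t. indicator {0<..} t * (t powr (1 - 1) * exp (- (z / 2 * t powr 1))) \<partial>lborel)"
    proof (rule integral_mono[OF intz])
      show "integrable lborel (\<lambda>t. indicator {0<..} t * (t powr (1 - 1) * exp (- (z / 2 * t powr 1))))"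
        using z by (intro integrable.intros[OF g]) auto
    qed (auto simp: airy_weight_def indicator_def)
    also have "\<dots> = 2 / z"
      using has_bochner_integral_integral_eq[OF g] z by (simp add: powr_divide powr_minus)
    finally have "z * (\<integral>r. airy_weight 0 r * exp (- (z / 2) * r) \<partial>lborel) \<le> 2"
      using z by (simp add: field_simps)
    with mult_left_mono[OF le[of 0 z] that] show ?thesis by linarith
  qed auto
  have b3: "z * norm (airy_rot 1 z) \<le> 2 * J 0" if "z \<ge> 0" for z
  proof -
    have "z * (\<integral>r. airy_weight 1 r * exp (- (z / 2) * r) \<partial>lborel)
        = (\<integral>r. z * (airy_weight 1 r * exp (- (z / 2) * r)) \<partial>lborel)" by simp
    also have "\<dots> \<le> (\<integral>r. 2 * airy_weight 0 r \<partial>lborel)"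
    proof (rule integral_mono)
      fix r :: real
      have "z / 2 * r \<le> exp (z / 2 * r)" using exp_ge_add_one_self[of "z / 2 * r"] by linarith
      then have "z * r * exp (- (z / 2) * r) \<le> 2" by (simp add: exp_minus field_simps)
      then have "airy_weight 0 r * (z * r * exp (- (z / 2) * r)) \<le> airy_weight 0 r * 2"
        by (intro mult_left_mono w0)
      then show "z * (airy_weight 1 r * exp (- (z / 2) * r)) \<le> 2 * airy_weight 0 r"
        by (simp add: airy_weight_def mult_ac)
    qed (use intz intJ in auto)
    also have "\<dots> = 2 * J 0" by (simp add: J_def)
    finally show ?thesis using mult_left_mono[OF le[of 1 z] that] by linarith
  qed
  show ?thesis
    by (rule that[of "J 0 + J 1 + 2 + 2 * J 0"])
       (use b1[of _ 0] b1[of _ 1] b2 b3 J0[of 0] J0[of 1] in fastforce)+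
qed

lemma integral_rotated_ray_tendsto:
  "((\<lambda>\<rho>. integral {0..\<rho>} (\<lambda>r. cis (pi / 6) * exp (\<i> * ((cis (pi / 6) * of_real r) ^ 3 / 3 + of_real x * (cis (pi / 6) * of_real r)))))
     \<longlongrightarrow> airy_rot 0 x) at_top"
proof -
  let ?f = "\<lambda>r. cis (pi / 6) * exp (\<i> * ((cis (pi / 6) * of_real r) ^ 3 / 3 + of_real x * (cis (pi / 6) * of_real r)))"
  let ?g = "\<lambda>r. cis (pi / 6) * (of_real (airy_weight 0 r) * exp (\<omega>3 * of_real x * of_real r))"
  have int: "integrable lborel ?g" by (intro integrable_mult_right integrable_airy_laplace)
  have "((\<lambda>\<rho>. \<integral>r. indicator {..\<rho>} r *\<^sub>R ?g r \<partial>lborel) \<longlongrightarrow> integral\<^sup>L lborel ?g) at_top"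
    by (rule tendsto_integral_at_top) (use int in auto)
  moreover have "\<forall>\<^sub>F \<rho> in at_top. (\<integral>r. indicator {..\<rho>} r *\<^sub>R ?g r \<partial>lborel) = integral {0..\<rho>} ?f"
    using eventually_ge_at_top[of 0]
  proof eventually_elim
    case (elim \<rho>)
    have eq: "?f r = cis (pi / 6) * (of_real (exp (- (r ^ 3 / 3))) * exp (\<omega>3 * of_real x * of_real r))" for r
    proof -
      have "\<i> * ((cis (pi / 6) * of_real r) ^ 3 / 3 + of_real x * (cis (pi / 6) * of_real r))
          = of_real (- (r ^ 3 / 3)) + \<omega>3 * of_real x * of_real r"
        unfolding i_cis_pi6[symmetric]
        by (simp add: power_mult_distrib cis_pi6_cubed algebra_simps)
      then show ?thesis by (simp only: exp_add exp_of_real)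
    qed
    have "(\<integral>r. indicator {..\<rho>} r *\<^sub>R ?g r \<partial>lborel) = (\<integral>r. indicator {0..\<rho>} r *\<^sub>R ?f r \<partial>lborel)"
    proof (rule integral_cong_AE)
      show "AE r in lborel. indicator {..\<rho>} r *\<^sub>R ?g r = indicator {0..\<rho>} r *\<^sub>R ?f r"
        using AE_lborel_singleton[of "0::real"]
        by eventually_elim (auto simp: indicator_def eq airy_weight_def)
    qed auto
    also have "\<dots> = integral {0..\<rho>} ?f"
    proof -
      have "set_integrable lborel {0..\<rho>} ?f"
        by (intro borel_integrable_atLeastAtMost' continuous_intros) auto
      from set_borel_integral_eq_integral(2)[OF this] show ?thesis
        unfolding set_lebesgue_integral_def .
    qed
    finally show ?case .
  qed
  ultimately have "((\<lambda>\<rho>. integral {0..\<rho>} ?f) \<longlongrightarrow> integral\<^sup>L lborel ?g) at_top"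
    by (rule Lim_transform_eventually)
  also have "integral\<^sup>L lborel ?g = airy_rot 0 x"
    by (simp add: airy_rot_def airy_laplace_def)
  finally show ?thesis .
qed

text \<open>
  Cauchy's theorem for the triangle with corners \<open>0\<close>, \<open>R\<close> and \<open>R * (1 + \<i> / sqrt 3)\<close>, expressed
  through a primitive of the entire integrand.  A straight third side is easier than an arc: at height
  \<open>v\<close> above \<open>R\<close> the integrand is at most \<open>exp (- (8 / 9 * R\<^sup>2 - \<bar>x\<bar>) * v)\<close>, which integrates to
  \<open>O (1 / R\<^sup>2)\<close>.
\<close>
lemma airy_Ai_eq: "airy_Ai x = Re (airy_rot 0 x) / pi"
proof -
  define f where "f z = exp (\<i> * (z ^ 3 / 3 + of_real x * z))" for z :: complex
  have holf: "f holomorphic_on UNIV" unfolding f_def by (intro holomorphic_intros) auto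
  obtain P where P: "\<And>z. (P has_field_derivative f z) (at z)"
    using holomorphic_convex_primitive'[of UNIV f] holf by auto
  have FTC: "((\<lambda>r. d * f (a + d * of_real r)) has_integral P (a + d * of_real \<rho>) - P a) {0..\<rho>}"
    if "\<rho> \<ge> 0" for a d \<rho>
  proof -
    have "((\<lambda>r. d * f (a + d * of_real r)) has_integral P (a + d * of_real \<rho>) - P (a + d * of_real 0)) {0..\<rho>}"
    proof (rule fundamental_theorem_of_calculus[OF that])
      fix r :: real
      have "((\<lambda>z. a + d * z) has_field_derivative d) (at (of_real r))"
        by (auto intro!: derivative_eq_intros)
      from DERIV_chain2[OF P this]
      have "((\<lambda>z. P (a + d * z)) has_field_derivative d * f (a + d * of_real r)) (at (of_real r))"
        by (simp add: mult.commute)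
      then show "((\<lambda>r. P (a + d * of_real r)) has_vector_derivative d * f (a + d * of_real r)) (at r within {0..\<rho>})"
        by (intro has_vector_derivative_real_field) (auto intro: has_field_derivative_at_within)
    qed
    then show ?thesis by simp
  qed
  define \<rho> where "\<rho> R = 2 * R / sqrt 3" for R :: real
  have corner: "cis (pi / 6) * of_real (\<rho> R) = of_real R + \<i> * of_real (R / sqrt 3)" for R
    by (rule complex_eqI) (simp_all add: \<rho>_def cos_30 sin_30 field_simps)
  have cosint: "integral {0..R} (\<lambda>t. cos (t ^ 3 / 3 + x * t)) = Re (P (of_real R) - P 0)" if "R \<ge> 0" for R
  proof -
    have "((\<lambda>t. Re (f (of_real t))) has_integral Re (P (of_real R) - P 0)) {0..R}"
      using has_integral_linear[OF FTC[OF that, of 1 0] bounded_linear_Re] by (simp add: o_def)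
    moreover have "Re (f (of_real t)) = cos (t ^ 3 / 3 + x * t)" for t
    proof -
      have "\<i> * (of_real t ^ 3 / 3 + of_real x * of_real t) = \<i> * of_real (t ^ 3 / 3 + x * t)" by simp
      then show ?thesis unfolding f_def by (simp only: cis_conv_exp[symmetric] cis.sel)
    qed
    ultimately show ?thesis by (simp add: integral_unique)
  qed
  have rayint: "integral {0..\<rho> R} (\<lambda>r. cis (pi / 6) * f (cis (pi / 6) * of_real r)) = P (of_real R + \<i> * of_real (R / sqrt 3)) - P 0"
    if "R \<ge> 0" for R
  proof -
    have "\<rho> R \<ge> 0" using that by (simp add: \<rho>_def)
    from integral_unique[OF FTC[OF this, of "cis (pi / 6)" 0]] show ?thesis
      by (simp only: add_0 corner)
  qed
  have "filterlim \<rho> at_top at_top" unfolding \<rho>_def by real_asymp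
  from filterlim_compose[OF integral_rotated_ray_tendsto[of x] this]
  have lim1: "((\<lambda>R. P (of_real R + \<i> * of_real (R / sqrt 3)) - P 0) \<longlongrightarrow> airy_rot 0 x) at_top"
  proof (rule Lim_transform_eventually)
    show "\<forall>\<^sub>F R in at_top. integral {0..\<rho> R} (\<lambda>r. cis (pi / 6) * exp (\<i> * ((cis (pi / 6) * of_real r) ^ 3 / 3 + of_real x * (cis (pi / 6) * of_real r))))
        = P (of_real R + \<i> * of_real (R / sqrt 3)) - P 0"
      using eventually_ge_at_top[of 0] by eventually_elim (use rayint in \<open>auto simp: f_def\<close>)
  qed
  have side: "norm (P (of_real R + \<i> * of_real (R / sqrt 3)) - P (of_real R)) \<le> 1 / (8 / 9 * R\<^sup>2 - \<bar>x\<bar>)"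
    if R: "R \<ge> 0" "8 / 9 * R\<^sup>2 > \<bar>x\<bar>" for R
  proof -
    define \<kappa> where "\<kappa> = 8 / 9 * R\<^sup>2 - \<bar>x\<bar>"
    define V where "V = R / sqrt 3"
    have \<kappa>: "\<kappa> > 0" and V: "V \<ge> 0" "V\<^sup>2 = R\<^sup>2 / 3" using R by (auto simp: \<kappa>_def V_def power_divide)
    have I: "((\<lambda>r. \<i> * f (of_real R + \<i> * of_real r)) has_integral P (of_real R + \<i> * of_real V) - P (of_real R)) {0..V}"
      using FTC[OF V(1), of \<i> "of_real R"] by simp
    have E: "((\<lambda>v. exp (- \<kappa> * v)) has_integral (- exp (- \<kappa> * V) / \<kappa>) - (- exp (- \<kappa> * 0) / \<kappa>)) {0..V}"
      by (rule fundamental_theorem_of_calculus[OF V(1)])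
         (use \<kappa> in \<open>auto intro!: derivative_eq_intros simp flip: has_real_derivative_iff_has_vector_derivative\<close>)
    have "norm (integral {0..V} (\<lambda>r. \<i> * f (of_real R + \<i> * of_real r))) \<le> integral {0..V} (\<lambda>v. exp (- \<kappa> * v))"
    proof (rule integral_norm_bound_integral)
      fix v assume v: "v \<in> {0..V}"
      \<comment> \<open>The cubic term \<open>v ^ 3 / 3\<close> has the wrong sign; since \<open>v\<^sup>2 \<le> R\<^sup>2 / 3\<close> it consumes only a ninth of
        \<open>R\<^sup>2 * v\<close>.\<close>
      have "v\<^sup>2 \<le> R\<^sup>2 / 3" using v V by (metis atLeastAtMost_iff power_mono)
      then have "v * v\<^sup>2 \<le> v * (R\<^sup>2 / 3)" using v by (intro mult_left_mono) auto
      moreover have "\<bar>x\<bar> * v \<ge> - x * v" using v by (intro mult_right_mono) auto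
      ultimately have "- (R\<^sup>2 * v) + v ^ 3 / 3 - x * v \<le> - \<kappa> * v"
        by (simp add: \<kappa>_def algebra_simps power3_eq_cube power2_eq_square)
      moreover have "Re (\<i> * ((of_real R + \<i> * of_real v) ^ 3 / 3 + of_real x * (of_real R + \<i> * of_real v)))
          = - (R\<^sup>2 * v) + v ^ 3 / 3 - x * v"
        by (simp add: power3_eq_cube power2_eq_square field_simps)
      ultimately show "norm (\<i> * f (of_real R + \<i> * of_real v)) \<le> exp (- \<kappa> * v)"
        by (simp add: norm_mult f_def)
    qed (use I E in \<open>auto simp: integrable_on_def\<close>)
    also have "\<dots> = (1 - exp (- \<kappa> * V)) / \<kappa>"
      unfolding integral_unique[OF E] by (simp add: diff_divide_distrib)
    also have "\<dots> \<le> 1 / \<kappa>" using \<kappa> by (intro divide_right_mono) auto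
    finally show ?thesis using integral_unique[OF I] by (simp add: \<kappa>_def V_def)
  qed
  have lim2: "((\<lambda>R. P (of_real R + \<i> * of_real (R / sqrt 3)) - P (of_real R)) \<longlongrightarrow> 0) at_top"
  proof (rule Lim_null_comparison)
    have "\<forall>\<^sub>F R::real in at_top. 8 / 9 * R\<^sup>2 > \<bar>x\<bar>" by real_asymp
    with eventually_ge_at_top[of 0]
    show "\<forall>\<^sub>F R in at_top. norm (P (of_real R + \<i> * of_real (R / sqrt 3)) - P (of_real R)) \<le> 1 / (8 / 9 * R\<^sup>2 - \<bar>x\<bar>)"
      by eventually_elim (rule side)
    show "((\<lambda>R. 1 / (8 / 9 * R\<^sup>2 - \<bar>x\<bar>)) \<longlongrightarrow> 0) at_top" by real_asymp
  qed
  have "((\<lambda>R. Re (P (of_real R) - P 0)) \<longlongrightarrow> Re (airy_rot 0 x)) at_top"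
    using tendsto_Re[OF tendsto_diff[OF lim1 lim2]] by simp
  then have "((\<lambda>R. integral {0..R} (\<lambda>t. cos (t ^ 3 / 3 + x * t))) \<longlongrightarrow> Re (airy_rot 0 x)) at_top"
    by (rule Lim_transform_eventually)
       (use eventually_ge_at_top[of 0] in \<open>eventually_elim, use cosint in auto\<close>)
  then have "Lim at_top (\<lambda>R. integral {0..R} (\<lambda>t. cos (t ^ 3 / 3 + x * t))) = Re (airy_rot 0 x)"
    by (intro tendsto_Lim) auto
  then show ?thesis by (simp add: airy_Ai_def)
qed

lemma deriv_airy_Ai: "deriv airy_Ai x = Re (airy_rot 1 x) / pi"
proof (rule DERIV_imp_deriv)
  have "((\<lambda>x. Re (airy_rot 0 x) / pi) has_real_derivative Re (airy_rot 1 x) / pi) (at x)"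
    using DERIV_cdivide[OF Re_Im_airy_rot_deriv(1)[of 0 x]] by simp
  then show "(airy_Ai has_real_derivative Re (airy_rot 1 x) / pi) (at x)"
    by (simp add: airy_Ai_eq[abs_def])
qed

lemma Re_airy_rot_at_0:
  "Re (airy_rot 0 0) = sqrt 3 / 2 * (3 powr (-2/3) * Gamma (1/3))"
  "Re (airy_rot 1 0) = - (sqrt 3 / 2 * (3 powr (-1/3) * Gamma (2/3)))"
proof -
  have "cis (pi / 6) * \<omega>3 = Complex (- sqrt 3 / 2) (1 / 2)"
    by (rule complex_eqI) (simp_all add: cos_30 sin_30 omega3_parts)
  then show "Re (airy_rot 0 0) = sqrt 3 / 2 * (3 powr (-2/3) * Gamma (1/3))"
    "Re (airy_rot 1 0) = - (sqrt 3 / 2 * (3 powr (-1/3) * Gamma (2/3)))"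
    using airy_laplace_at_0 by (simp_all add: airy_rot_def cos_30)
qed

lemma airy_Ai_ratio: "airy_Ai 0 / (- deriv airy_Ai 0) = 3 powr (-1/3) * Gamma (1/3) / Gamma (2/3)"
proof -
  have "(3::real) powr (-2/3) = 3 powr (-1/3) * 3 powr (-1/3)" by (simp flip: powr_add)
  moreover have "Gamma (2/3 :: real) > 0" by (rule Gamma_real_pos) simp
  ultimately show ?thesis
    unfolding airy_Ai_eq deriv_airy_Ai Re_airy_rot_at_0 by (simp add: field_simps)
qed

section \<open>Gaussian random walks with killing\<close>

definition walk :: "(nat \<Rightarrow> real) \<Rightarrow> nat \<Rightarrow> real" where
  "walk v k = (\<Sum>i<k. v i)"

text \<open>
  The probability of surviving \<open>k\<close> steps of length \<open>h\<close> when the killing rate at \<open>y\<close> is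
  \<open>x + max y 0\<close>.  The rate is read off at the left end of each step, so that \<open>killing x h v (Suc k)\<close>
  depends only on the first \<open>k\<close> increments.
\<close>
definition killing :: "real \<Rightarrow> real \<Rightarrow> (nat \<Rightarrow> real) \<Rightarrow> nat \<Rightarrow> real" where
  "killing x h v k = exp (- (h * (\<Sum>j<k. x + max (walk v j) 0)))"

lemma walk_Suc: "walk v (Suc k) = walk v k + v k" by (simp add: walk_def)

lemma killing_Suc: "killing x h v (Suc k) = killing x h v k * exp (- (h * (x + max (walk v k) 0)))"
  by (simp add: killing_def algebra_simps flip: exp_add)

lemma walk_cong: "(\<And>i. i < k \<Longrightarrow> v i = v' i) \<Longrightarrow> walk v k = walk v' k"
  by (simp add: walk_def)

lemma killing_cong: "(\<And>i. i < k \<Longrightarrow> v i = v' i) \<Longrightarrow> killing x h v k = killing x h v' k"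
  unfolding killing_def by (intro arg_cong[of _ _ exp] arg_cong[of _ _ uminus] arg_cong2[of _ _ _ _ "(*)"] refl
      sum.cong arg_cong2[of _ _ _ _ "(+)"] arg_cong2[of _ _ _ _ max] walk_cong) auto

lemma killing_cong_Suc: "(\<And>i. i < k \<Longrightarrow> v i = v' i) \<Longrightarrow> killing x h v (Suc k) = killing x h v' (Suc k)"
  unfolding killing_Suc using killing_cong[of k v v' x h] walk_cong[of k v v'] by simp

lemma killing_pos: "killing x h v k > 0" by (simp add: killing_def)

lemma killing_le_1: "x \<ge> 0 \<Longrightarrow> h \<ge> 0 \<Longrightarrow> killing x h v k \<le> 1"
  by (auto simp: killing_def intro!: mult_nonneg_nonneg sum_nonneg)

lemma walk_measurable_PiM [measurable]:
  "k \<le> n \<Longrightarrow> (\<lambda>v. walk v k) \<in> borel_measurable (PiM {..<n} (\<lambda>_. borel))"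
  unfolding walk_def by (intro borel_measurable_sum measurable_component_singleton) auto

lemma killing_measurable_PiM [measurable]:
  "k \<le> Suc n \<Longrightarrow> (\<lambda>v. killing x h v k) \<in> borel_measurable (PiM {..<n} (\<lambda>_. borel))"
  unfolding killing_def
  by (intro borel_measurable_exp[THEN measurable_compose_rev] borel_measurable_uminus borel_measurable_times
       borel_measurable_const borel_measurable_sum borel_measurable_add borel_measurable_max walk_measurable_PiM) auto

locale gaussian_steps = prob_space M for M :: "'a measure" +
  fixes \<xi> :: "nat \<Rightarrow> 'a \<Rightarrow> real" and n :: nat and h :: real
  assumes h_pos: "h > 0"
    and indep: "indep_vars (\<lambda>_. borel) \<xi> {..<n}"
    and normal: "\<And>i. i < n \<Longrightarrow> distributed M lborel (\<xi> i) (normal_density 0 (sqrt h))"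
begin

abbreviation "W k \<omega> \<equiv> walk (\<lambda>i. \<xi> i \<omega>) k"
abbreviation "D x k \<omega> \<equiv> killing x h (\<lambda>i. \<xi> i \<omega>) k"

lemma xi_measurable: "i < n \<Longrightarrow> \<xi> i \<in> borel_measurable M"
  using normal[of i] by (auto simp: distributed_def)

lemma W_measurable: "k \<le> n \<Longrightarrow> W k \<in> borel_measurable M"
  unfolding walk_def by (intro borel_measurable_sum xi_measurable) auto

lemma D_measurable: "k \<le> Suc n \<Longrightarrow> D x k \<in> borel_measurable M"
  unfolding killing_def
  by (intro borel_measurable_exp[THEN measurable_compose_rev] borel_measurable_uminus borel_measurable_times
       borel_measurable_const borel_measurable_sum borel_measurable_add borel_measurable_max W_measurable) auto

text \<open>
  The right-hand side mentions only \<open>h\<close> and \<open>k\<close>.  This is how Brownian scaling enters: two walks with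
  the same step variance have the same survival probabilities, whatever the time horizon they were
  sampled from.
\<close>
lemma expectation_killing:
  assumes "0 < k" "k \<le> n"
  shows "expectation (D x k) = (\<integral>v. killing x h v k \<partial>PiM {..<k} (\<lambda>_. density lborel (normal_density 0 (sqrt h))))"
proof -
  have ind: "indep_vars (\<lambda>_. borel) \<xi> {..<k}"
    using indep by (rule indep_vars_subset) (use assms in auto)
  have "distr M (PiM {..<k} (\<lambda>_. borel)) (\<lambda>\<omega>. \<lambda>i\<in>{..<k}. \<xi> i \<omega>) = PiM {..<k} (\<lambda>i. distr M borel (\<xi> i))"
    by (subst indep_vars_iff_distr_eq_PiM'[symmetric]) (use assms ind xi_measurable in auto)
  also have "\<dots> = PiM {..<k} (\<lambda>_. density lborel (normal_density 0 (sqrt h)))"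
  proof (rule PiM_cong)
    fix i assume "i \<in> {..<k}"
    then have "distr M lborel (\<xi> i) = density lborel (normal_density 0 (sqrt h))"
      using normal[of i] assms by (auto simp: distributed_def)
    moreover have "distr M borel (\<xi> i) = distr M lborel (\<xi> i)" by (rule distr_cong) auto
    ultimately show "distr M borel (\<xi> i) = density lborel (normal_density 0 (sqrt h))" by simp
  qed simp
  finally have eq: "distr M (PiM {..<k} (\<lambda>_. borel)) (\<lambda>\<omega>. \<lambda>i\<in>{..<k}. \<xi> i \<omega>) = \<dots>" .
  have "(\<integral>v. killing x h v k \<partial>PiM {..<k} (\<lambda>_. density lborel (normal_density 0 (sqrt h))))
      = (\<integral>\<omega>. killing x h (\<lambda>i\<in>{..<k}. \<xi> i \<omega>) k \<partial>M)"
    unfolding eq[symmetric] using assms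
    by (intro integral_distr measurable_restrict killing_measurable_PiM) (auto intro: xi_measurable)
  also have "\<dots> = expectation (D x k)"
    by (intro Bochner_Integration.integral_cong refl killing_cong) auto
  finally show ?thesis by simp
qed

lemma expectation_past_future:
  assumes k: "k < n"
    and p: "p \<in> borel_measurable (PiM {..<k} (\<lambda>_. borel))"
    and p_past: "\<And>v v'. (\<And>i. i < k \<Longrightarrow> v i = v' i) \<Longrightarrow> p v = p v'"
    and p_bdd: "\<And>v. \<bar>p v\<bar> \<le> c"
    and g: "g \<in> borel_measurable borel" "integrable M (\<lambda>\<omega>. g (\<xi> k \<omega>))"
  shows "expectation (\<lambda>\<omega>. p (\<lambda>i. \<xi> i \<omega>) * g (\<xi> k \<omega>)) = expectation (\<lambda>\<omega>. p (\<lambda>i. \<xi> i \<omega>)) * expectation (\<lambda>\<omega>. g (\<xi> k \<omega>) :: real)"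
    "integrable M (\<lambda>\<omega>. p (\<lambda>i. \<xi> i \<omega>) * g (\<xi> k \<omega>))"
proof -
  have "indep_var (PiM {..<k} (\<lambda>_. borel)) (\<lambda>\<omega>. restrict (\<lambda>i. \<xi> i \<omega>) {..<k})
      (PiM {k} (\<lambda>_. borel)) (\<lambda>\<omega>. restrict (\<lambda>i. \<xi> i \<omega>) {k})"
    by (rule indep_var_restrict[OF indep]) (use k in auto)
  then have "indep_var borel (p \<circ> (\<lambda>\<omega>. restrict (\<lambda>i. \<xi> i \<omega>) {..<k})) borel ((\<lambda>v. g (v k)) \<circ> (\<lambda>\<omega>. restrict (\<lambda>i. \<xi> i \<omega>) {k}))"
    by (rule indep_var_compose) (use p g in \<open>auto intro: measurable_compose[OF measurable_component_singleton]\<close>)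
  moreover have "p \<circ> (\<lambda>\<omega>. restrict (\<lambda>i. \<xi> i \<omega>) {..<k}) = (\<lambda>\<omega>. p (\<lambda>i. \<xi> i \<omega>))"
    by (auto simp: fun_eq_iff intro!: p_past)
  ultimately have ind: "indep_var borel (\<lambda>\<omega>. p (\<lambda>i. \<xi> i \<omega>)) borel (\<lambda>\<omega>. g (\<xi> k \<omega>))"
    by (simp add: comp_def)
  have "integrable M (\<lambda>\<omega>. p (\<lambda>i. \<xi> i \<omega>))"
    by (rule integrable_const_bound[where B = c]) (use p_bdd indep_var_rv1[OF ind] in auto)
  with indep_var_lebesgue_integral[OF ind] indep_var_integrable[OF ind] g(2)
  show "expectation (\<lambda>\<omega>. p (\<lambda>i. \<xi> i \<omega>) * g (\<xi> k \<omega>)) = expectation (\<lambda>\<omega>. p (\<lambda>i. \<xi> i \<omega>)) * expectation (\<lambda>\<omega>. g (\<xi> k \<omega>) :: real)"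
    "integrable M (\<lambda>\<omega>. p (\<lambda>i. \<xi> i \<omega>) * g (\<xi> k \<omega>))" by auto
qed

lemma normal_moments:
  assumes "distributed M lborel X (normal_density 0 \<sigma>)" "\<sigma> > 0"
  shows "expectation X = 0" "integrable M X"
    "expectation (\<lambda>\<omega>. X \<omega> ^ 2) = \<sigma>\<^sup>2" "integrable M (\<lambda>\<omega>. X \<omega> ^ 2)"
    "expectation (\<lambda>\<omega>. \<bar>X \<omega>\<bar>) \<le> \<sigma>"
    "expectation (\<lambda>\<omega>. \<bar>X \<omega>\<bar> ^ 3) \<le> 2 * \<sigma> ^ 3" "integrable M (\<lambda>\<omega>. \<bar>X \<omega>\<bar> ^ 3)"
proof -
  have I: "expectation (\<lambda>\<omega>. g (X \<omega>)) = v \<and> integrable M (\<lambda>\<omega>. g (X \<omega>))"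
    if "has_bochner_integral lborel (\<lambda>x. normal_density 0 \<sigma> x * g x) v" "g \<in> borel_measurable borel" for g v
    using that distributed_integral[OF assms(1), of g] distributed_integrable[OF assms(1), of g]
    by (auto simp: has_bochner_integral_iff)
  have pi2: "sqrt (2 / pi) \<le> 1" using pi_gt3 by simp
  show "expectation X = 0" "integrable M X"
    using I[of "\<lambda>x. x" 0] normal_moment_odd[OF assms(2), of 0 0] by auto
  show "expectation (\<lambda>\<omega>. X \<omega> ^ 2) = \<sigma>\<^sup>2" "integrable M (\<lambda>\<omega>. X \<omega> ^ 2)"
    using I[of "\<lambda>x. x ^ 2" "\<sigma>\<^sup>2"] normal_moment_even[OF assms(2), of 0 1] by auto
  show "expectation (\<lambda>\<omega>. \<bar>X \<omega>\<bar>) \<le> \<sigma>"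
    using I[of "\<lambda>x. \<bar>x\<bar>" "\<sigma> * sqrt (2 / pi)"] normal_moment_abs_odd[OF assms(2), of 0 0] pi2 assms(2)
    by (auto simp: mult_left_le)
  have "2 * \<sigma> ^ 3 * sqrt (2 / pi) \<le> 2 * \<sigma> ^ 3"
    using pi2 assms(2) by (intro mult_left_le) auto
  then show "expectation (\<lambda>\<omega>. \<bar>X \<omega>\<bar> ^ 3) \<le> 2 * \<sigma> ^ 3" "integrable M (\<lambda>\<omega>. \<bar>X \<omega>\<bar> ^ 3)"
    using I[of "\<lambda>x. \<bar>x\<bar> ^ 3" "2 * \<sigma> ^ 3 * sqrt (2 / pi)"] normal_moment_abs_odd[OF assms(2), of 0 1]
    by (auto simp: numeral_3_eq_3)
qed

lemma walk_abs_expectation: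
  assumes "k \<le> n"
  shows "expectation (\<lambda>\<omega>. \<bar>W k \<omega>\<bar>) \<le> sqrt (real n * h)" "integrable M (W k)"
proof -
  have "expectation (\<lambda>\<omega>. \<bar>W k \<omega>\<bar>) \<le> sqrt (real n * h) \<and> integrable M (W k)"
  proof (cases "k = 0")
    case True
    then show ?thesis using h_pos by (simp add: walk_def)
  next
    case False
    have "distributed M lborel (\<lambda>\<omega>. \<Sum>i<k. \<xi> i \<omega>) (normal_density (\<Sum>i<k. 0) (sqrt (\<Sum>i<k. (sqrt h)\<^sup>2)))"
      by (rule sum_indep_normal) (use False assms h_pos normal indep_vars_subset[OF indep, of "{..<k}"] in auto)
    then have "distributed M lborel (\<lambda>\<omega>. \<Sum>i<k. \<xi> i \<omega>) (normal_density 0 (sqrt (real k * h)))"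
      using h_pos by simp
    note m = normal_moments[OF this]
    have "sqrt (real k * h) > 0" "sqrt (real k * h) \<le> sqrt (real n * h)"
      using False assms h_pos by simp_all
    with m(2,5) show ?thesis unfolding walk_def by (meson order_trans)
  qed
  then show "expectation (\<lambda>\<omega>. \<bar>W k \<omega>\<bar>) \<le> sqrt (real n * h)" "integrable M (W k)" by auto
qed

end

text \<open>
  A bounded solution of \<open>w'' / 2 - (x + max y 0) * w = - 1\<close>.  The bounds on \<open>w\<close> and \<open>w1\<close> multiplied by
  the unbounded killing rate are what makes \<open>w''\<close> bounded and Lipschitz, hence what makes the
  second-order Taylor expansion uniform.
\<close>
locale resolvent_solution =
  fixes x K :: real and w w1 :: "real \<Rightarrow> real"
  assumes x_pos: "x > 0"
    and w_deriv: "\<And>y. (w has_real_derivative w1 y) (at y)"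
    and w1_deriv: "\<And>y. (w1 has_real_derivative 2 * ((x + max y 0) * w y - 1)) (at y)"
    and bound_w: "\<And>y. \<bar>w y\<bar> \<le> K" and bound_w1: "\<And>y. \<bar>w1 y\<bar> \<le> K"
    and bound_Vw: "\<And>y. (x + max y 0) * \<bar>w y\<bar> \<le> K" and bound_Vw1: "\<And>y. (x + max y 0) * \<bar>w1 y\<bar> \<le> K"
begin

lemma K_nonneg: "K \<ge> 0" using bound_w[of 0] by linarith

lemma w_measurable [measurable]: "w \<in> borel_measurable borel"
  by (intro borel_measurable_continuous_onI continuous_at_imp_continuous_on ballI DERIV_isCont[OF w_deriv])

lemma w1_measurable [measurable]: "w1 \<in> borel_measurable borel"
  by (intro borel_measurable_continuous_onI continuous_at_imp_continuous_on ballI DERIV_isCont[OF w1_deriv])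

text \<open>
  By the mean value theorem for \<open>w\<close>.  The rate in front of the difference is taken at the smaller
  point, where it is dominated by its value at the intermediate point, so the bound on
  \<open>(x + max z 0) * \<bar>w1 z\<bar>\<close> applies.
\<close>
lemma Vw_lipschitz: "\<bar>(x + max y 0) * w y - (x + max y' 0) * w y'\<bar> \<le> 2 * K * \<bar>y - y'\<bar>"
proof -
  have *: "\<bar>(x + max y 0) * w y - (x + max y' 0) * w y'\<bar> \<le> 2 * K * \<bar>y - y'\<bar>" if lt: "y < y'" for y y'
  proof -
    obtain z where z: "y < z" "z < y'" "w y' - w y = (y' - y) * w1 z"
      using MVT2[OF lt w_deriv] by blast
    have "(x + max y 0) * w y - (x + max y' 0) * w y' = - ((x + max y 0) * ((y' - y) * w1 z)) - (max y' 0 - max y 0) * w y'"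
      unfolding z(3)[symmetric] by (simp add: algebra_simps)
    also have "\<bar>\<dots>\<bar> \<le> \<bar>(x + max y 0) * ((y' - y) * w1 z)\<bar> + \<bar>(max y' 0 - max y 0) * w y'\<bar>" by linarith
    also have "\<bar>(x + max y 0) * ((y' - y) * w1 z)\<bar> = (y' - y) * ((x + max y 0) * \<bar>w1 z\<bar>)"
      using lt x_pos by (simp add: abs_mult)
    also have "\<dots> \<le> (y' - y) * K"
    proof (intro mult_left_mono)
      have "(x + max y 0) * \<bar>w1 z\<bar> \<le> (x + max z 0) * \<bar>w1 z\<bar>" using z by (intro mult_right_mono) auto
      with bound_Vw1[of z] show "(x + max y 0) * \<bar>w1 z\<bar> \<le> K" by linarith
    qed (use lt in auto)
    also have "\<bar>(max y' 0 - max y 0) * w y'\<bar> \<le> (y' - y) * K"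
      unfolding abs_mult using lt bound_w by (intro mult_mono) auto
    finally show ?thesis using lt by (simp add: algebra_simps)
  qed
  show ?thesis
    using *[of y y'] *[of y' y] by (cases y y' rule: linorder_cases) (auto simp: abs_minus_commute)
qed

lemma w_taylor:
  "\<bar>w (y + d) - w y - w1 y * d - ((x + max y 0) * w y - 1) * d\<^sup>2\<bar> \<le> 4 * K * \<bar>d\<bar> ^ 3"
proof (cases "d = 0")
  case False
  define w2 where "w2 y = 2 * ((x + max y 0) * w y - 1)" for y
  have lip: "\<bar>w2 y - w2 y'\<bar> \<le> 4 * K * \<bar>y - y'\<bar>" for y y'
    using Vw_lipschitz[of y y'] by (simp add: w2_def abs_if split: if_splits)
  have d1: "\<bar>w1 (y + e) - w1 y - w2 y * e\<bar> \<le> 4 * K * \<bar>d\<bar>\<^sup>2" if "\<bar>e\<bar> \<le> \<bar>d\<bar>" for e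
  proof (cases "e = 0")
    case e: False
    obtain z where z: "\<bar>z\<bar> < \<bar>e\<bar>" "w1 (y + e) - w1 y = e * w2 (y + z)"
    proof (cases "e > 0")
      case True
      then have "y < y + e" by simp
      then obtain z where "y < z" "z < y + e" "w1 (y + e) - w1 y = (y + e - y) * w2 z"
        using MVT2[OF _ w1_deriv, of y "y + e"] unfolding w2_def by blast
      then show ?thesis by (intro that[of "z - y"]) auto
    next
      case False
      with e have "y + e < y" by simp
      then obtain z where "y + e < z" "z < y" "w1 y - w1 (y + e) = (y - (y + e)) * w2 z"
        using MVT2[OF _ w1_deriv, of "y + e" y] unfolding w2_def by blast
      then show ?thesis by (intro that[of "z - y"]) auto
    qed
    have "\<bar>w1 (y + e) - w1 y - w2 y * e\<bar> = \<bar>e\<bar> * \<bar>w2 (y + z) - w2 y\<bar>"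
      unfolding z(2) abs_mult[symmetric] by (simp add: algebra_simps)
    also have "\<dots> \<le> \<bar>d\<bar> * (4 * K * \<bar>d\<bar>)"
      using lip[of "y + z" y] z that K_nonneg
      by (intro mult_mono) (auto intro: order_trans[OF _ mult_left_mono[of "\<bar>z\<bar>" "\<bar>d\<bar>" "4 * K"]])
    finally show ?thesis by (simp add: power2_eq_square mult_ac)
  qed (use K_nonneg in auto)
  define R where "R e = w (y + e) - w y - w1 y * e - w2 y / 2 * e\<^sup>2" for e
  have R': "(R has_real_derivative w1 (y + e) - w1 y - w2 y * e) (at e)" for e
  proof -
    have "((\<lambda>e. w (y + e)) has_real_derivative w1 (y + e)) (at e)"
      using w_deriv[of "y + e"] by (simp add: DERIV_shift add.commute)
    then show ?thesis unfolding R_def by (auto intro!: derivative_eq_intros)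
  qed
  have "\<exists>e. \<bar>e\<bar> \<le> \<bar>d\<bar> \<and> \<bar>R d - R 0\<bar> = \<bar>d\<bar> * \<bar>w1 (y + e) - w1 y - w2 y * e\<bar>"
  proof (cases "d > 0")
    case True
    then obtain e where "0 < e" "e < d" "R d - R 0 = (d - 0) * (w1 (y + e) - w1 y - w2 y * e)"
      using MVT2[OF _ R', of 0 d] by blast
    then show ?thesis by (intro exI[of _ e]) (auto simp: abs_mult)
  next
    case False
    with \<open>d \<noteq> 0\<close> have "d < 0" by simp
    then obtain e where "d < e" "e < 0" "R 0 - R d = (0 - d) * (w1 (y + e) - w1 y - w2 y * e)"
      using MVT2[OF _ R', of d 0] by blast
    then show ?thesis using \<open>d < 0\<close> by (intro exI[of _ e]) (auto simp: abs_mult abs_minus_commute[of "R d"])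
  qed
  then obtain e where e: "\<bar>e\<bar> \<le> \<bar>d\<bar>" "\<bar>R d - R 0\<bar> = \<bar>d\<bar> * \<bar>w1 (y + e) - w1 y - w2 y * e\<bar>" by blast
  have "\<bar>R d\<bar> \<le> \<bar>d\<bar> * (4 * K * \<bar>d\<bar>\<^sup>2)"
    using e mult_left_mono[OF d1[OF e(1)], of "\<bar>d\<bar>"] by (simp add: R_def)
  moreover have "w2 y / 2 = (x + max y 0) * w y - 1" by (simp add: w2_def)
  ultimately show ?thesis unfolding R_def by (simp add: power3_eq_cube power2_eq_square mult_ac)
qed simp

end

lemma one_plus_exp_minus_bound:
  fixes u :: real
  assumes "u \<ge> 0"
  shows "\<bar>exp (- u) * (1 + u) - 1\<bar> \<le> u\<^sup>2"
proof -
  have "1 + u \<le> exp u" by (rule exp_ge_add_one_self)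
  then have "exp (- u) * (1 + u) \<le> 1" by (simp add: exp_minus field_simps)
  moreover have "(1 - u) * (1 + u) \<le> exp (- u) * (1 + u)"
    using exp_ge_add_one_self[of "- u"] assms by (intro mult_right_mono) auto
  ultimately show ?thesis by (simp add: algebra_simps power2_eq_square)
qed

locale killed_walk = gaussian_steps M \<xi> n h + resolvent_solution x K w w1
  for M :: "'a measure" and \<xi> n h x K w w1
begin

text \<open>
  Conditionally on the past, the Gaussian increment has mean \<open>0\<close> and variance \<open>h\<close>, so the expansion of
  \<open>w\<close> contributes \<open>h * w'' / 2\<close>, which is \<open>h * ((x + max y 0) * w - 1)\<close> by the equation.  The first part
  compensates the killing factor to first order, the second part produces the term
  \<open>h * expectation (D x (Suc k))\<close>.  What remains is the third moment of the increment and the second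
  order error of the killing factor.
\<close>
lemma walk_one_step:
  assumes k: "k < n"
  shows "\<bar>expectation (\<lambda>\<omega>. D x (Suc k) \<omega> * w (W (Suc k) \<omega>)) - expectation (\<lambda>\<omega>. D x k \<omega> * w (W k \<omega>))
           + h * expectation (D x (Suc k))\<bar>
         \<le> 8 * K * sqrt h ^ 3 + K * h\<^sup>2 * (x + sqrt (real n * h))"
proof -
  define V where "V \<omega> = x + max (W k \<omega>) 0" for \<omega>
  have k': "k \<le> n" "Suc k \<le> n" "k \<le> Suc n" "Suc k \<le> Suc n" using k by auto
  note [measurable] = W_measurable[OF k'(1)] W_measurable[OF k'(2)] D_measurable[OF k'(3)] D_measurable[OF k'(4)]
    xi_measurable[OF k]
  have D01: "0 \<le> D x j \<omega>" "D x j \<omega> \<le> 1" for j \<omega>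
    using killing_pos[of x h _ j] killing_le_1[of x h] x_pos h_pos by (auto simp: less_imp_le)
  have V_pos: "V \<omega> \<ge> 0" for \<omega> using x_pos by (auto simp: V_def)
  have [measurable]: "V \<in> borel_measurable M" unfolding V_def by measurable
  have DS: "D x (Suc k) \<omega> = D x k \<omega> * exp (- (h * V \<omega>))" for \<omega> by (simp add: killing_Suc V_def)
  have bdd: "integrable M f" if "f \<in> borel_measurable M" "\<And>\<omega>. \<bar>f \<omega>\<bar> \<le> c" for f :: "'a \<Rightarrow> real" and c
    by (rule integrable_const_bound[where B = c]) (use that in auto)
  have Dw: "\<bar>D x j \<omega> * f\<bar> \<le> c" if "\<bar>f\<bar> \<le> c" for j \<omega> and f c :: real
    using mult_mono[OF D01(2)[of \<omega> j] that] D01[of \<omega> j] by (simp add: abs_mult)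
  have sq: "sqrt h > 0" "(sqrt h)\<^sup>2 = h" using h_pos by auto
  note mom = normal_moments[OF normal[OF k] sq(1), unfolded sq(2)]
  have kVw: "\<bar>(x + max y 0) * w y - 1\<bar> \<le> K + 1" for y
  proof -
    have "\<bar>(x + max y 0) * w y\<bar> \<le> K" using bound_Vw[of y] x_pos by (simp add: abs_mult)
    then show ?thesis by linarith
  qed
  have Vw: "\<bar>V \<omega> * w (W k \<omega>) - 1\<bar> \<le> K + 1" for \<omega>
    unfolding V_def by (rule kVw)
  define A where "A \<omega> = D x (Suc k) \<omega> * w (W k \<omega>)" for \<omega>
  define Q where "Q \<omega> = D x (Suc k) \<omega> * (V \<omega> * w (W k \<omega>) - 1)" for \<omega>
  define R where "R \<omega> = w (W k \<omega> + \<xi> k \<omega>) - w (W k \<omega>) - w1 (W k \<omega>) * \<xi> k \<omega> - (V \<omega> * w (W k \<omega>) - 1) * \<xi> k \<omega> ^ 2" for \<omega>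
  have [measurable]: "A \<in> borel_measurable M" "Q \<in> borel_measurable M" "R \<in> borel_measurable M"
    unfolding A_def Q_def R_def by measurable
  have Qb: "\<bar>Q \<omega>\<bar> \<le> K + 1" for \<omega> unfolding Q_def by (rule Dw[OF Vw])
  have Rb: "\<bar>R \<omega>\<bar> \<le> 4 * K * \<bar>\<xi> k \<omega>\<bar> ^ 3" for \<omega>
    using w_taylor[of "W k \<omega>" "\<xi> k \<omega>"] by (simp add: R_def V_def)
  have intR: "integrable M (\<lambda>\<omega>. D x (Suc k) \<omega> * R \<omega>)"
  proof (rule Bochner_Integration.integrable_bound)
    show "integrable M (\<lambda>\<omega>. 4 * K * \<bar>\<xi> k \<omega>\<bar> ^ 3)" using mom(7) by simp
    show "AE \<omega> in M. norm (D x (Suc k) \<omega> * R \<omega>) \<le> norm (4 * K * \<bar>\<xi> k \<omega>\<bar> ^ 3)"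
      using Dw[OF Rb] K_nonneg by (auto simp: abs_mult)
  qed simp
  have ER: "\<bar>expectation (\<lambda>\<omega>. D x (Suc k) \<omega> * R \<omega>)\<bar> \<le> 8 * K * sqrt h ^ 3"
  proof -
    have "\<bar>expectation (\<lambda>\<omega>. D x (Suc k) \<omega> * R \<omega>)\<bar> \<le> expectation (\<lambda>\<omega>. \<bar>D x (Suc k) \<omega> * R \<omega>\<bar>)"
      using integral_norm_bound[of M "\<lambda>\<omega>. D x (Suc k) \<omega> * R \<omega>"] by simp
    also have "\<dots> \<le> expectation (\<lambda>\<omega>. 4 * K * \<bar>\<xi> k \<omega>\<bar> ^ 3)"
      using intR mom(7) Dw[OF Rb] by (intro integral_mono) auto
    also have "\<dots> \<le> 4 * K * (2 * sqrt h ^ 3)"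
      using mult_left_mono[OF mom(6) K_nonneg] by simp
    finally show ?thesis by simp
  qed
  have kD: "(\<lambda>v. killing x h v (Suc k)) \<in> borel_measurable (PiM {..<k} (\<lambda>_. borel))"
    and kW: "(\<lambda>v. walk v k) \<in> borel_measurable (PiM {..<k} (\<lambda>_. borel))"
    by (rule killing_measurable_PiM walk_measurable_PiM; simp)+
  have kb: "\<bar>killing x h v (Suc k) * f\<bar> \<le> c" if "\<bar>f\<bar> \<le> c" for v and f c :: real
    using mult_mono[OF killing_le_1[of x h v "Suc k"] that] killing_pos[of x h v "Suc k"] x_pos h_pos
    by (simp add: abs_mult)
  let ?p = "\<lambda>v. killing x h v (Suc k) * w1 (walk v k)"
  let ?q = "\<lambda>v. killing x h v (Suc k) * ((x + max (walk v k) 0) * w (walk v k) - 1)"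
  have pm: "?p \<in> borel_measurable (PiM {..<k} (\<lambda>_. borel))" "?q \<in> borel_measurable (PiM {..<k} (\<lambda>_. borel))"
    using kD kW by measurable
  have pp: "?p v = ?p v'" "?q v = ?q v'" if "\<And>i. i < k \<Longrightarrow> v i = v' i" for v v'
    using killing_cong_Suc[of k v v' x h] walk_cong[of k v v'] that by auto
  have P: "expectation (\<lambda>\<omega>. (D x (Suc k) \<omega> * w1 (W k \<omega>)) * \<xi> k \<omega>) = 0"
      "integrable M (\<lambda>\<omega>. (D x (Suc k) \<omega> * w1 (W k \<omega>)) * \<xi> k \<omega>)"
    using expectation_past_future[of k ?p K "\<lambda>u. u", OF k pm(1) pp(1) kb[OF bound_w1]] mom(1,2) by auto
  have eqQ: "?q (\<lambda>i. \<xi> i \<omega>) = Q \<omega>" for \<omega> by (simp add: Q_def V_def)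
  have Qe: "expectation (\<lambda>\<omega>. Q \<omega> * \<xi> k \<omega> ^ 2) = expectation Q * h"
      "integrable M (\<lambda>\<omega>. Q \<omega> * \<xi> k \<omega> ^ 2)"
    using expectation_past_future[of k ?q "K + 1" "\<lambda>u. u ^ 2", OF k pm(2) pp(2) kb[OF kVw] _ mom(4), unfolded eqQ mom(3)]
    by auto
  have intA: "integrable M A" by (rule bdd[of _ K]) (auto simp: A_def intro: Dw bound_w)
  have intQ: "integrable M Q" by (rule bdd[of _ "K + 1"]) (auto intro: Qb)
  have intDS: "integrable M (D x (Suc k))" by (rule bdd[of _ 1]) (use D01 in \<open>auto simp: abs_of_nonneg\<close>)
  have intDw: "integrable M (\<lambda>\<omega>. D x k \<omega> * w (W k \<omega>))" by (rule bdd[of _ K]) (auto intro: Dw bound_w)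
  have "D x (Suc k) \<omega> * w (W (Suc k) \<omega>)
      = A \<omega> + (D x (Suc k) \<omega> * w1 (W k \<omega>)) * \<xi> k \<omega> + Q \<omega> * \<xi> k \<omega> ^ 2 + D x (Suc k) \<omega> * R \<omega>" for \<omega>
    by (simp add: A_def Q_def R_def walk_Suc algebra_simps)
  then have "expectation (\<lambda>\<omega>. D x (Suc k) \<omega> * w (W (Suc k) \<omega>))
      = expectation A + expectation Q * h + expectation (\<lambda>\<omega>. D x (Suc k) \<omega> * R \<omega>)"
    using intA P Qe intR by simp
  moreover have "expectation A + expectation Q * h + h * expectation (D x (Suc k)) - expectation (\<lambda>\<omega>. D x k \<omega> * w (W k \<omega>))
      = expectation (\<lambda>\<omega>. A \<omega> + Q \<omega> * h + h * D x (Suc k) \<omega> - D x k \<omega> * w (W k \<omega>))"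
    using intA intQ intDS intDw by simp
  moreover have "\<bar>expectation (\<lambda>\<omega>. A \<omega> + Q \<omega> * h + h * D x (Suc k) \<omega> - D x k \<omega> * w (W k \<omega>))\<bar> \<le> K * h\<^sup>2 * (x + sqrt (real n * h))"
  proof -
    have pt: "\<bar>A \<omega> + Q \<omega> * h + h * D x (Suc k) \<omega> - D x k \<omega> * w (W k \<omega>)\<bar> \<le> K * h\<^sup>2 * (x + \<bar>W k \<omega>\<bar>)" for \<omega>
    proof -
      have "A \<omega> + Q \<omega> * h + h * D x (Suc k) \<omega> - D x k \<omega> * w (W k \<omega>)
          = D x k \<omega> * (w (W k \<omega>) * (exp (- (h * V \<omega>)) * (1 + h * V \<omega>) - 1))"
        by (simp add: A_def Q_def DS algebra_simps)
      also have "\<bar>\<dots>\<bar> \<le> \<bar>w (W k \<omega>)\<bar> * (h * V \<omega>)\<^sup>2"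
        using one_plus_exp_minus_bound[of "h * V \<omega>"] V_pos[of \<omega>] h_pos
        by (intro Dw) (auto simp: abs_mult intro!: mult_left_mono)
      also have "\<dots> = h\<^sup>2 * V \<omega> * (V \<omega> * \<bar>w (W k \<omega>)\<bar>)"
        by (simp add: power2_eq_square mult_ac)
      also have "\<dots> \<le> h\<^sup>2 * V \<omega> * K"
        using bound_Vw[of "W k \<omega>"] V_pos[of \<omega>] by (intro mult_left_mono) (auto simp: V_def)
      also have "\<dots> \<le> h\<^sup>2 * (x + \<bar>W k \<omega>\<bar>) * K"
        using K_nonneg by (intro mult_right_mono mult_left_mono) (auto simp: V_def)
      finally show ?thesis by (simp add: mult_ac)
    qed
    note wk = walk_abs_expectation[OF k'(1)]
    have "\<bar>expectation (\<lambda>\<omega>. A \<omega> + Q \<omega> * h + h * D x (Suc k) \<omega> - D x k \<omega> * w (W k \<omega>))\<bar>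
        \<le> expectation (\<lambda>\<omega>. \<bar>A \<omega> + Q \<omega> * h + h * D x (Suc k) \<omega> - D x k \<omega> * w (W k \<omega>)\<bar>)"
      using integral_norm_bound[of M "\<lambda>\<omega>. A \<omega> + Q \<omega> * h + h * D x (Suc k) \<omega> - D x k \<omega> * w (W k \<omega>)"] by simp
    also have "\<dots> \<le> expectation (\<lambda>\<omega>. K * h\<^sup>2 * (x + \<bar>W k \<omega>\<bar>))"
      using intA intQ intDS intDw wk(2) pt by (intro integral_mono) auto
    also have "\<dots> = K * h\<^sup>2 * (x + expectation (\<lambda>\<omega>. \<bar>W k \<omega>\<bar>))"
      using wk(2) by (simp add: prob_space)
    also have "\<dots> \<le> K * h\<^sup>2 * (x + sqrt (real n * h))"
      using wk(1) K_nonneg by (intro mult_left_mono) auto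
    finally show ?thesis .
  qed
  ultimately show ?thesis using ER by linarith
qed

lemma walk_telescoped:
  "\<bar>expectation (\<lambda>\<omega>. D x n \<omega> * w (W n \<omega>)) - w 0 + h * (\<Sum>k<n. expectation (D x (Suc k)))\<bar>
   \<le> real n * (8 * K * sqrt h ^ 3 + K * h\<^sup>2 * (x + sqrt (real n * h)))"
proof -
  define a where "a k = expectation (\<lambda>\<omega>. D x k \<omega> * w (W k \<omega>))" for k
  have a0: "a 0 = w 0" by (simp add: a_def killing_def walk_def prob_space)
  have "a n - w 0 + h * (\<Sum>k<n. expectation (D x (Suc k))) = (\<Sum>k<n. a (Suc k) - a k + h * expectation (D x (Suc k)))"
    by (simp add: sum.distrib sum_lessThan_telescope sum_distrib_left a0)
  also have "\<bar>\<dots>\<bar> \<le> (\<Sum>k<n. 8 * K * sqrt h ^ 3 + K * h\<^sup>2 * (x + sqrt (real n * h)))"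
    by (rule order_trans[OF sum_abs sum_mono]) (use walk_one_step in \<open>auto simp: a_def\<close>)
  finally show ?thesis by (simp add: a_def)
qed

text \<open>
  A discrete form of Dynkin's formula, with the boundary term bounded through
  the deterministic killing at rate \<open>x\<close>.
\<close>
lemma walk_resolvent_error:
  "\<bar>w 0 - h * (\<Sum>k<n. expectation (D x (Suc k)))\<bar>
   \<le> real n * (8 * K * sqrt h ^ 3 + K * h\<^sup>2 * (x + sqrt (real n * h))) + K * exp (- (x * (real n * h)))"
proof -
  have "D x n \<omega> \<le> exp (- (x * (real n * h)))" for \<omega>
  proof -
    have "real n * x = (\<Sum>j<n. x)" by simp
    also have "\<dots> \<le> (\<Sum>j<n. x + max (W j \<omega>) 0)" by (intro sum_mono) auto
    finally have "h * (real n * x) \<le> h * (\<Sum>j<n. x + max (W j \<omega>) 0)" using h_pos by (intro mult_left_mono) auto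
    then show ?thesis by (simp add: killing_def mult_ac)
  qed
  then have pt: "\<bar>D x n \<omega> * w (W n \<omega>)\<bar> \<le> exp (- (x * (real n * h))) * K" for \<omega>
    unfolding abs_mult using bound_w by (intro mult_mono) (auto simp: abs_of_pos killing_pos)
  have "(\<lambda>\<omega>. D x n \<omega> * w (W n \<omega>)) \<in> borel_measurable M"
    using D_measurable[of n x] W_measurable[of n] by simp
  then have "integrable M (\<lambda>\<omega>. D x n \<omega> * w (W n \<omega>))"
    by (intro integrable_const_bound[where B = "exp (- (x * (real n * h))) * K"]) (use pt in auto)
  then have "expectation (\<lambda>\<omega>. \<bar>D x n \<omega> * w (W n \<omega>)\<bar>) \<le> expectation (\<lambda>\<omega>. exp (- (x * (real n * h))) * K)"
    using pt by (intro integral_mono) auto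
  then have "\<bar>expectation (\<lambda>\<omega>. D x n \<omega> * w (W n \<omega>))\<bar> \<le> exp (- (x * (real n * h))) * K"
    using integral_norm_bound[of M "\<lambda>\<omega>. D x n \<omega> * w (W n \<omega>)"]
    unfolding real_norm_def by (simp only: lebesgue_integral_const prob_space scaleR_one)
  with walk_telescoped show ?thesis by (simp add: mult.commute abs_le_iff)
qed

end

section \<open>The resolvent of Brownian motion killed at rate proportional to its positive part\<close>

text \<open>
  Dominated convergence for the step functions with value \<open>a m k\<close> on the \<open>k\<close>-th cell of the grid of
  mesh \<open>h m\<close>.  It serves twice: for the Riemann sums of a path, and for the time integral in the
  Feynman-Kac formula, where the horizon \<open>N m * h m\<close> tends to infinity.
\<close>
lemma step_sum_tendsto:
  fixes a :: "nat \<Rightarrow> nat \<Rightarrow> real" and N :: "nat \<Rightarrow> nat" and h :: "nat \<Rightarrow> real"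
  assumes h: "\<And>m. h m > 0"
    and G: "integrable lborel G" "\<And>t. 0 \<le> G t"
    and bound: "\<And>m k t. k < N m \<Longrightarrow> real k * h m \<le> t \<Longrightarrow> t < (real k + 1) * h m \<Longrightarrow> \<bar>a m k\<bar> \<le> G t"
    and \<phi>: "\<phi> \<in> borel_measurable borel"
    and lim: "AE t in lborel. (\<lambda>m. if 0 \<le> t \<and> t < real (N m) * h m then a m (nat \<lfloor>t / h m\<rfloor>) else 0) \<longlonglongrightarrow> \<phi> t"
  shows "(\<lambda>m. h m * (\<Sum>k<N m. a m k)) \<longlonglongrightarrow> integral\<^sup>L lborel \<phi>"
proof -
  define s where "s m t = (\<Sum>k<N m. a m k * indicator {real k * h m ..< (real k + 1) * h m} t)" for m t
  have s_eq: "s m t = (if 0 \<le> t \<and> t < real (N m) * h m then a m (nat \<lfloor>t / h m\<rfloor>) else 0)" for m t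
  proof -
    have iff: "t \<in> {real k * h m ..< (real k + 1) * h m} \<longleftrightarrow> 0 \<le> t \<and> k = nat \<lfloor>t / h m\<rfloor>" for k
    proof
      assume t: "t \<in> {real k * h m ..< (real k + 1) * h m}"
      have "0 \<le> real k * h m" using h[of m] by simp
      then have "0 \<le> t" using t by auto
      moreover have "\<lfloor>t / h m\<rfloor> = int k" using t h[of m] by (intro floor_unique) (auto simp: field_simps)
      ultimately show "0 \<le> t \<and> k = nat \<lfloor>t / h m\<rfloor>" by simp
    next
      assume t: "0 \<le> t \<and> k = nat \<lfloor>t / h m\<rfloor>"
      then have "0 \<le> t / h m" using h[of m] by simp
      then have "real k \<le> t / h m" "t / h m < real k + 1" using t by linarith+
      then show "t \<in> {real k * h m ..< (real k + 1) * h m}" using h[of m] by (auto simp: field_simps)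
    qed
    have lt: "nat \<lfloor>t / h m\<rfloor> < N m \<longleftrightarrow> t < real (N m) * h m" if "0 \<le> t"
    proof -
      have "nat \<lfloor>t / h m\<rfloor> < N m \<longleftrightarrow> t / h m < real (N m)"
        using that h[of m] by (simp add: nat_less_iff floor_less_iff)
      then show ?thesis using h[of m] by (simp add: field_simps)
    qed
    have "s m t = (\<Sum>k<N m. if k = nat \<lfloor>t / h m\<rfloor> then (if 0 \<le> t then a m k else 0) else 0)"
      unfolding s_def indicator_def iff by (intro sum.cong refl) auto
    also have "\<dots> = (if nat \<lfloor>t / h m\<rfloor> < N m then (if 0 \<le> t then a m (nat \<lfloor>t / h m\<rfloor>) else 0) else 0)"
      by (subst sum.delta) auto
    finally show ?thesis using lt by auto
  qed
  have "(\<lambda>m. integral\<^sup>L lborel (s m)) \<longlonglongrightarrow> integral\<^sup>L lborel \<phi>"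
  proof (rule integral_dominated_convergence)
    show "integrable lborel G" by fact
    show "s m \<in> borel_measurable lborel" for m unfolding s_def by measurable
    show "\<phi> \<in> borel_measurable lborel" using \<phi> by simp
    show "AE t in lborel. (\<lambda>m. s m t) \<longlonglongrightarrow> \<phi> t" using lim unfolding s_eq .
    show "AE t in lborel. norm (s m t) \<le> G t" for m
    proof (rule AE_I2)
      fix t
      show "norm (s m t) \<le> G t"
      proof (cases "0 \<le> t \<and> t < real (N m) * h m")
        case True
        define k where "k = nat \<lfloor>t / h m\<rfloor>"
        have "0 \<le> t / h m" using h[of m] True by simp
        then have k: "real k \<le> t / h m" "t / h m < real k + 1" unfolding k_def by linarith+
        then have "real k * h m \<le> t" "t < (real k + 1) * h m" using h[of m] by (auto simp: field_simps)
        moreover have "k < N m"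
        proof -
          have "real k * h m < real (N m) * h m" using \<open>real k * h m \<le> t\<close> True by linarith
          then show ?thesis using h[of m] by simp
        qed
        ultimately show ?thesis using bound[of k m t] True by (simp add: s_eq k_def)
      qed (use G in \<open>auto simp: s_eq\<close>)
    qed
  qed
  moreover have "integral\<^sup>L lborel (s m) = h m * (\<Sum>k<N m. a m k)" for m
  proof -
    have "integral\<^sup>L lborel (s m) = (\<Sum>k<N m. a m k * h m)"
      unfolding s_def
      by (subst Bochner_Integration.integral_sum) (use h[of m] in \<open>auto simp: algebra_simps\<close>)
    then show ?thesis by (simp add: sum_distrib_left mult.commute)
  qed
  ultimately show ?thesis by simp
qed

lemma floor_grid_tendsto:
  fixes h :: "nat \<Rightarrow> real"
  assumes h: "\<And>m. h m > 0" "h \<longlonglongrightarrow> 0" and t: "t \<ge> 0"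
  shows "(\<lambda>m. real (nat \<lfloor>t / h m\<rfloor>) * h m) \<longlonglongrightarrow> t"
proof (rule tendsto_sandwich)
  show "\<forall>\<^sub>F m in sequentially. t - h m \<le> real (nat \<lfloor>t / h m\<rfloor>) * h m"
  proof (rule always_eventually, rule allI)
    fix m
    have "0 \<le> t / h m" using h(1)[of m] t by simp
    then have "t / h m - 1 \<le> real (nat \<lfloor>t / h m\<rfloor>)" by linarith
    then show "t - h m \<le> real (nat \<lfloor>t / h m\<rfloor>) * h m" using h(1)[of m] by (simp add: field_simps)
  qed
  show "\<forall>\<^sub>F m in sequentially. real (nat \<lfloor>t / h m\<rfloor>) * h m \<le> t"
  proof (rule always_eventually, rule allI)
    fix m
    have "0 \<le> t / h m" using h(1)[of m] t by simp
    then have "real (nat \<lfloor>t / h m\<rfloor>) \<le> t / h m" by linarith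
    then show "real (nat \<lfloor>t / h m\<rfloor>) * h m \<le> t" using h(1)[of m] by (simp add: field_simps)
  qed
  show "(\<lambda>m. t - h m) \<longlonglongrightarrow> t" using tendsto_diff[OF tendsto_const h(2), of t] by simp
qed simp

lemma riemann_sum_tendsto:
  fixes f :: "real \<Rightarrow> real"
  assumes f: "continuous_on {0..1} f"
  shows "(\<lambda>m. (\<Sum>k<Suc m. f (real k / real (Suc m))) / real (Suc m)) \<longlonglongrightarrow> integral {0..1} f"
proof -
  define h where "h m = 1 / real (Suc m)" for m
  have h: "h m > 0" for m by (simp add: h_def)
  have h0: "h \<longlonglongrightarrow> 0" unfolding h_def by (rule lim_1_over_n[THEN LIMSEQ_Suc])
  obtain c where "\<forall>y\<in>f ` {0..1}. norm y \<le> c"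
    using compact_imp_bounded[OF compact_continuous_image[OF f compact_Icc]] unfolding bounded_iff by blast
  then have c: "\<bar>f t\<bar> \<le> c" if "t \<in> {0..1}" for t using that by auto
  have c0: "c \<ge> 0" using c[of 0] by auto
  let ?\<phi> = "\<lambda>t. indicator {0..1} t * f t"
  have int: "set_integrable lborel {0..1} f" by (rule borel_integrable_atLeastAtMost'[OF f])
  have m\<phi>: "?\<phi> \<in> borel_measurable borel"
    using borel_measurable_integrable[OF int[unfolded set_integrable_def]] by simp
  have "(\<lambda>m. h m * (\<Sum>k<Suc m. f (real k * h m))) \<longlonglongrightarrow> integral\<^sup>L lborel ?\<phi>"
  proof (rule step_sum_tendsto[OF h, where G = "\<lambda>t. c * indicator {0..1} t"])
    show "integrable lborel (\<lambda>t. c * indicator {0..1::real} t)" by simp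
    show "\<bar>f (real k * h m)\<bar> \<le> c * indicator {0..1} t"
      if k: "k < Suc m" and t: "real k * h m \<le> t" "t < (real k + 1) * h m" for m k t
    proof -
      have "real k * h m \<le> 1" "(real k + 1) * h m \<le> 1" "0 \<le> real k * h m" using k by (auto simp: h_def field_simps)
      then show ?thesis using c t by auto
    qed
    show "AE t in lborel. (\<lambda>m. if 0 \<le> t \<and> t < real (Suc m) * h m then f (real (nat \<lfloor>t / h m\<rfloor>) * h m) else 0) \<longlonglongrightarrow> ?\<phi> t"
      using AE_lborel_singleton[of "1::real"]
    proof eventually_elim
      case (elim t)
      have N: "real (Suc m) * h m = 1" for m by (simp add: h_def)
      show ?case
      proof (cases "0 \<le> t \<and> t < 1")
        case True
        have "(\<lambda>m. f (real (nat \<lfloor>t / h m\<rfloor>) * h m)) \<longlonglongrightarrow> f t"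
        proof (rule continuous_on_tendsto_compose[OF f floor_grid_tendsto[OF h h0]])
          show "\<forall>\<^sub>F m in sequentially. real (nat \<lfloor>t / h m\<rfloor>) * h m \<in> {0..1}"
          proof (rule always_eventually, rule allI)
            fix m
            have "0 \<le> t / h m" using h[of m] True by simp
            then have "real (nat \<lfloor>t / h m\<rfloor>) \<le> t / h m" by linarith
            then have "real (nat \<lfloor>t / h m\<rfloor>) * h m \<le> t" using h[of m] by (simp add: field_simps)
            then show "real (nat \<lfloor>t / h m\<rfloor>) * h m \<in> {0..1}" using True h[of m] by auto
          qed
        qed (use True in auto)
        then show ?thesis using True unfolding N by simp
      next
        case False
        then have "t \<notin> {0..1}" "(0 \<le> t \<and> t < 1) = False" using elim by auto
        then show ?thesis
          unfolding N by (simp only: if_False indicator_simps(2) mult_zero_left tendsto_const not_False_eq_True)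
      qed
    qed
  qed (use c0 m\<phi> in auto)
  also have "integral\<^sup>L lborel ?\<phi> = integral {0..1} f"
    using set_borel_integral_eq_integral(2)[OF int] by (simp add: set_lebesgue_integral_def)
  finally show ?thesis by (simp add: h_def)
qed

locale brownian =
  fixes M :: "'a measure" and B :: "real \<Rightarrow> 'a \<Rightarrow> real"
  assumes bm: "standard_brownian_motion M {0..1} B"

sublocale brownian \<subseteq> prob_space M
  using bm by (simp add: standard_brownian_motion_def)

context brownian
begin

abbreviation "X \<equiv> positive_part_area B"

definition riemann_area :: "nat \<Rightarrow> 'a \<Rightarrow> real" where
  "riemann_area n \<omega> = (\<Sum>k<n. max (B (real k / real n) \<omega>) 0) / real n"

definition \<psi> :: "real \<Rightarrow> real" where
  "\<psi> l = expectation (\<lambda>\<omega>. exp (- (l * X \<omega>)))"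

lemma B_measurable: "t \<in> {0..1} \<Longrightarrow> B t \<in> borel_measurable M"
  using bm by (simp add: standard_brownian_motion_def)

lemma riemann_area_measurable [measurable]: "riemann_area n \<in> borel_measurable M"
proof -
  have "B (real k / real n) \<in> borel_measurable M" if "k < n" for k
    by (rule B_measurable) (use that in \<open>auto simp: field_simps\<close>)
  then show ?thesis unfolding riemann_area_def by (intro borel_measurable_divide borel_measurable_sum borel_measurable_max) auto
qed

lemma riemann_area_nonneg: "riemann_area n \<omega> \<ge> 0"
  by (auto simp: riemann_area_def intro!: divide_nonneg_nonneg sum_nonneg)

lemma riemann_area_tendsto: "\<omega> \<in> space M \<Longrightarrow> (\<lambda>m. riemann_area (Suc m) \<omega>) \<longlonglongrightarrow> X \<omega>"
  unfolding riemann_area_def positive_part_area_def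
  using bm by (intro riemann_sum_tendsto continuous_intros) (auto simp: standard_brownian_motion_def)

lemma X_measurable [measurable]: "X \<in> borel_measurable M"
  by (rule borel_measurable_LIMSEQ_real[OF riemann_area_tendsto]) auto

lemma X_nonneg: "\<omega> \<in> space M \<Longrightarrow> X \<omega> \<ge> 0"
  by (rule LIMSEQ_le_const[OF riemann_area_tendsto]) (auto simp: riemann_area_nonneg)

text \<open>
  The increments of the path sampled at \<open>n\<close> equidistant times and rescaled to the time horizon
  \<open>n * h\<close>, so that each of them has variance \<open>h\<close>.
\<close>
definition brownian_step :: "nat \<Rightarrow> real \<Rightarrow> nat \<Rightarrow> 'a \<Rightarrow> real" where
  "brownian_step n h i \<omega> = sqrt (real n * h) * (B (real (Suc i) / real n) \<omega> - B (real i / real n) \<omega>)"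

lemma brownian_steps:
  assumes "n > 0" "h > 0"
  shows "gaussian_steps M (\<lambda>i \<omega>. brownian_step n h i \<omega>) n h"
  unfolding brownian_step_def
proof (intro gaussian_steps.intro gaussian_steps_axioms.intro)
  show "prob_space M" by unfold_locales
  show "h > 0" by fact
  have "\<forall>i\<le>n. real i / real n \<in> {0..1}" "strict_mono_on {..n} (\<lambda>i. real i / real n)"
    using assms by (auto simp: strict_mono_on_def divide_strict_right_mono)
  then have "indep_vars (\<lambda>_. borel) (\<lambda>i \<omega>. B (real (Suc i) / real n) \<omega> - B (real i / real n) \<omega>) {..<n}"
    using bm[unfolded standard_brownian_motion_def, THEN conjunct2, THEN conjunct2, THEN conjunct2, THEN conjunct2,
        THEN conjunct1, THEN spec, THEN spec, of n "\<lambda>i. real i / real n"] by blast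
  then show "indep_vars (\<lambda>_. borel) (\<lambda>i \<omega>. sqrt (real n * h) * (B (real (Suc i) / real n) \<omega> - B (real i / real n) \<omega>)) {..<n}"
    by (rule indep_vars_compose2) auto
  fix i assume i: "i < n"
  have "real i / real n \<in> {0..1}" "real (Suc i) / real n \<in> {0..1}" "real i / real n < real (Suc i) / real n"
    using i by (auto simp: divide_strict_right_mono)
  then have "distributed M lborel (\<lambda>\<omega>. B (real (Suc i) / real n) \<omega> - B (real i / real n) \<omega>) (normal_density 0 (sqrt (real (Suc i) / real n - real i / real n)))"
    using bm unfolding standard_brownian_motion_def by blast
  from normal_density_affine[OF this, of "sqrt (real n * h)" 0]
  have "distributed M lborel (\<lambda>\<omega>. sqrt (real n * h) * (B (real (Suc i) / real n) \<omega> - B (real i / real n) \<omega>))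
     (normal_density 0 (sqrt (real n * h) * sqrt (real (Suc i) / real n - real i / real n)))"
    using assms i by (simp add: divide_strict_right_mono)
  also have "sqrt (real n * h) * sqrt (real (Suc i) / real n - real i / real n) = sqrt h"
    using assms by (simp add: real_sqrt_mult[symmetric] field_simps)
  finally show "distributed M lborel (\<lambda>\<omega>. sqrt (real n * h) * (B (real (Suc i) / real n) \<omega> - B (real i / real n) \<omega>)) (normal_density 0 (sqrt h))" .
qed

lemma brownian_killing:
  assumes "k > 0" "h > 0" "\<omega> \<in> space M"
  shows "killing x h (\<lambda>i. brownian_step k h i \<omega>) k
    = exp (- (x * (real k * h))) * exp (- (real k * h * sqrt (real k * h) * riemann_area k \<omega>))"
proof -
  have B0: "B 0 \<omega> = 0" using bm assms(3) by (simp add: standard_brownian_motion_def)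
  have "walk (\<lambda>i. brownian_step k h i \<omega>) j = sqrt (real k * h) * B (real j / real k) \<omega>" for j
    unfolding walk_def brownian_step_def sum_distrib_left[symmetric] by (subst sum_lessThan_telescope) (simp add: B0)
  moreover have "max (sqrt (real k * h) * b) 0 = sqrt (real k * h) * max b 0" for b
    using assms by (auto simp: max_def mult_le_0_iff zero_le_mult_iff)
  ultimately have "(\<Sum>j<k. x + max (walk (\<lambda>i. brownian_step k h i \<omega>) j) 0)
      = (\<Sum>j<k. x + sqrt (real k * h) * max (B (real j / real k) \<omega>) 0)" by (simp only:)
  also have "\<dots> = real k * x + sqrt (real k * h) * (\<Sum>j<k. max (B (real j / real k) \<omega>) 0)"
    by (simp add: sum.distrib sum_distrib_left)
  finally have "h * (\<Sum>j<k. x + max (walk (\<lambda>i. brownian_step k h i \<omega>) j) 0)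
      = x * (real k * h) + real k * h * sqrt (real k * h) * riemann_area k \<omega>"
    using assms by (simp only: riemann_area_def) (simp add: field_simps)
  then show ?thesis unfolding killing_def by (simp only: minus_add_distrib exp_add)
qed

lemma expectation_killing_scaled:
  assumes "0 < k" "k \<le> n" "h > 0"
  shows "expectation (\<lambda>\<omega>. killing x h (\<lambda>i. brownian_step n h i \<omega>) k)
    = exp (- (x * (real k * h))) * expectation (\<lambda>\<omega>. exp (- (real k * h * sqrt (real k * h) * riemann_area k \<omega>)))"
proof -
  have "n > 0" using assms by simp
  interpret n: gaussian_steps M "\<lambda>i \<omega>. brownian_step n h i \<omega>" n h
    by (rule brownian_steps) fact+
  interpret k: gaussian_steps M "\<lambda>i \<omega>. brownian_step k h i \<omega>" k h
    by (rule brownian_steps) fact+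
  have "expectation (\<lambda>\<omega>. killing x h (\<lambda>i. brownian_step k h i \<omega>) k)
    = expectation (\<lambda>\<omega>. exp (- (x * (real k * h))) * exp (- (real k * h * sqrt (real k * h) * riemann_area k \<omega>)))"
    by (intro Bochner_Integration.integral_cong refl brownian_killing assms)
  then show ?thesis
    using n.expectation_killing[OF assms(1,2), of x] k.expectation_killing[OF assms(1) order_refl, of x] by simp
qed

lemma riemann_laplace_tendsto:
  assumes "filterlim k at_top sequentially" "l \<longlonglongrightarrow> L" "\<And>m. l m \<ge> (0::real)"
  shows "(\<lambda>m. expectation (\<lambda>\<omega>. exp (- (l m * riemann_area (Suc (k m)) \<omega>)))) \<longlonglongrightarrow> \<psi> L"
  unfolding \<psi>_def
proof (rule integral_dominated_convergence)
  show "AE \<omega> in M. (\<lambda>m. exp (- (l m * riemann_area (Suc (k m)) \<omega>))) \<longlonglongrightarrow> exp (- (L * X \<omega>))"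
  proof (rule AE_I2)
    fix \<omega> assume "\<omega> \<in> space M"
    from filterlim_compose[OF riemann_area_tendsto[OF this] assms(1)]
    show "(\<lambda>m. exp (- (l m * riemann_area (Suc (k m)) \<omega>))) \<longlonglongrightarrow> exp (- (L * X \<omega>))"
      by (intro tendsto_intros assms)
  qed
  show "AE \<omega> in M. norm (exp (- (l m * riemann_area (Suc (k m)) \<omega>))) \<le> 1" for m
    using assms(3) riemann_area_nonneg by (auto intro!: mult_nonneg_nonneg)
qed auto

lemma psi_nonneg: "\<psi> l \<ge> 0"
  unfolding \<psi>_def by (rule Bochner_Integration.integral_nonneg) auto

lemma psi_le_1: "l \<ge> 0 \<Longrightarrow> \<psi> l \<le> 1"
proof -
  assume l: "l \<ge> 0"
  have b: "exp (- (l * X \<omega>)) \<le> 1" if "\<omega> \<in> space M" for \<omega> using X_nonneg[OF that] l by auto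
  then have "\<psi> l \<le> expectation (\<lambda>_. 1)"
    unfolding \<psi>_def by (intro integral_mono integrable_const_bound[where B = 1]) auto
  then show ?thesis by (simp add: prob_space)
qed

lemma psi_measurable [measurable]: "\<psi> \<in> borel_measurable borel"
  unfolding \<psi>_def by measurable

text \<open>
  The mesh \<open>h = 1 / m ^ 4\<close> and the number \<open>m ^ 5\<close> of steps are chosen so that the horizon
  \<open>m\<close> tends to infinity while the accumulated error, of order
  \<open>m ^ 5 * h powr (3 / 2) = 1 / m\<close>, tends to \<open>0\<close>.  A single limit then yields the integral over the whole
  half line.
\<close>
lemma feynman_kac_resolvent:
  assumes "resolvent_solution x K w w1"
  shows "w 0 = (\<integral>t. indicator {0<..} t * (exp (- (x * t)) * \<psi> (t * sqrt t)) \<partial>lborel)"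
proof -
  interpret resolvent_solution x K w w1 by fact
  define h where "h m = 1 / real (Suc m) ^ 4" for m
  define N where "N m = Suc m ^ 5" for m
  have h: "h m > 0" for m by (simp add: h_def)
  have Nh: "real (N m) * h m = real (Suc m)" for m
  proof -
    have "a ^ 5 * (1 / a ^ 4) = a" if "a > 0" for a :: real
      using that by (simp add: field_simps eval_nat_numeral)
    then show ?thesis unfolding N_def h_def of_nat_power by simp
  qed
  have h0: "h \<longlonglongrightarrow> 0" unfolding h_def by real_asymp
  define \<xi> where "\<xi> m i \<omega> = brownian_step (N m) (h m) i \<omega>" for m i \<omega>
  define a where "a m k = expectation (\<lambda>\<omega>. killing x (h m) (\<lambda>i. \<xi> m i \<omega>) (Suc k))" for m k
  have a_eq: "a m k = exp (- (x * (real (Suc k) * h m))) *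
      expectation (\<lambda>\<omega>. exp (- (real (Suc k) * h m * sqrt (real (Suc k) * h m) * riemann_area (Suc k) \<omega>)))"
    if "k < N m" for m k
    unfolding a_def \<xi>_def using that by (intro expectation_killing_scaled h) auto
  let ?err = "\<lambda>m. real (N m) * (8 * K * sqrt (h m) ^ 3 + K * (h m)\<^sup>2 * (x + sqrt (real (N m) * h m))) + K * exp (- (x * (real (N m) * h m)))"
  have err: "\<bar>w 0 - h m * (\<Sum>k<N m. a m k)\<bar> \<le> ?err m" for m
  proof -
    interpret killed_walk M "\<xi> m" "N m" "h m" x K w w1
      unfolding \<xi>_def by (intro killed_walk.intro brownian_steps assms h) (simp add: N_def)
    show ?thesis unfolding a_def by (rule walk_resolvent_error)
  qed
  have "?err \<longlonglongrightarrow> 0"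
    unfolding Nh unfolding N_def h_def using x_pos by simp real_asymp
  then have "(\<lambda>m. w 0 - h m * (\<Sum>k<N m. a m k)) \<longlonglongrightarrow> 0"
    by (rule Lim_null_comparison[rotated]) (use err in auto)
  from tendsto_diff[OF tendsto_const[of "w 0"] this] have lim1: "(\<lambda>m. h m * (\<Sum>k<N m. a m k)) \<longlonglongrightarrow> w 0" by simp
  have lim2: "(\<lambda>m. h m * (\<Sum>k<N m. a m k)) \<longlonglongrightarrow> (\<integral>t. indicator {0<..} t * (exp (- (x * t)) * \<psi> (t * sqrt t)) \<partial>lborel)"
  proof (rule step_sum_tendsto[OF h, where G = "\<lambda>t. indicator {0..} t * exp (- (x * t))"])
    have "integrable lborel (\<lambda>t. indicator {0<..} t * (t powr (1 - 1) * exp (- (x * t powr 1))))"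
      using has_bochner_integral_Gamma_power[of 1 1 x] x_pos by (auto simp: has_bochner_integral_iff)
    then show "integrable lborel (\<lambda>t. indicator {0..} t * exp (- (x * t)))"
    proof (rule Bochner_Integration.integrable_cong_AE_imp)
      show "AE t in lborel. indicator {0<..} t * (t powr (1 - 1) * exp (- (x * t powr 1))) = indicator {0..} t * exp (- (x * t))"
        using AE_lborel_singleton[of "0::real"] by eventually_elim (auto simp: indicator_def)
    qed simp
    show "(\<lambda>t. indicator {0<..} t * (exp (- (x * t)) * \<psi> (t * sqrt t))) \<in> borel_measurable borel" by measurable
    fix m k t assume k: "k < N m" and t: "real k * h m \<le> t" "t < (real k + 1) * h m"
    have "expectation (\<lambda>\<omega>. exp (- (real (Suc k) * h m * sqrt (real (Suc k) * h m) * riemann_area (Suc k) \<omega>))) \<le> expectation (\<lambda>_. 1)"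
      by (intro integral_mono integrable_const_bound[where B = 1])
         (use h[of m] riemann_area_nonneg in \<open>auto intro!: mult_nonneg_nonneg add_nonneg_nonneg simp: less_imp_le\<close>)
    then have "\<bar>a m k\<bar> \<le> exp (- (x * (real (Suc k) * h m)))"
      unfolding a_eq[OF k] by (simp add: prob_space abs_mult abs_of_nonneg Bochner_Integration.integral_nonneg)
    also have "\<dots> \<le> exp (- (x * t))" using t x_pos by (simp add: add.commute)
    finally show "\<bar>a m k\<bar> \<le> indicator {0..} t * exp (- (x * t))"
      using t h[of m] order_trans[of 0 "real k * h m" t] by simp
  next
    show "AE t in lborel. (\<lambda>m. if 0 \<le> t \<and> t < real (N m) * h m then a m (nat \<lfloor>t / h m\<rfloor>) else 0)
        \<longlonglongrightarrow> indicator {0<..} t * (exp (- (x * t)) * \<psi> (t * sqrt t))"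
      using AE_lborel_singleton[of "0::real"]
    proof eventually_elim
      case (elim t)
      show ?case
      proof (cases "t > 0")
        case False
        with elim show ?thesis by auto
      next
        case True
        define k where "k m = nat \<lfloor>t / h m\<rfloor>" for m
        define T where "T m = real (Suc (k m)) * h m" for m
        have T: "T \<longlonglongrightarrow> t"
          using tendsto_add[OF floor_grid_tendsto[OF h h0, of t] h0] True by (simp add: T_def[abs_def] k_def algebra_simps)
        have T0: "T m \<ge> 0" for m using h[of m] by (simp add: T_def)
        have klim: "filterlim k at_top sequentially"
          unfolding k_def h_def using True by (simp; real_asymp)
        have "(\<lambda>m. exp (- (x * T m)) * expectation (\<lambda>\<omega>. exp (- (T m * sqrt (T m) * riemann_area (Suc (k m)) \<omega>))))
            \<longlonglongrightarrow> exp (- (x * t)) * \<psi> (t * sqrt t)"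
          by (intro tendsto_intros riemann_laplace_tendsto klim T) (simp add: T0)
        moreover have "\<forall>\<^sub>F m in sequentially. exp (- (x * T m)) * expectation (\<lambda>\<omega>. exp (- (T m * sqrt (T m) * riemann_area (Suc (k m)) \<omega>)))
            = (if 0 \<le> t \<and> t < real (N m) * h m then a m (nat \<lfloor>t / h m\<rfloor>) else 0)"
        proof -
          have "\<forall>\<^sub>F m in sequentially. t < real (Suc m)"
            using True by real_asymp
          then show ?thesis
          proof eventually_elim
            case (elim m)
            then have lt: "t < real (N m) * h m" by (simp add: Nh)
            then have "t / h m < real (N m)" using h[of m] by (simp add: field_simps)
            moreover have "0 \<le> t / h m" using True h[of m] by simp
            ultimately have "k m < N m" unfolding k_def by linarith
            from a_eq[OF this] show ?case using lt True by (simp add: T_def k_def)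
          qed
        qed
        ultimately show ?thesis using True by (auto dest: Lim_transform_eventually)
      qed
    qed
  qed auto
  show ?thesis by (rule LIMSEQ_unique[OF lim1 lim2])
qed

end

section \<open>The resolvent near zero in terms of Airy functions\<close>

lemma has_real_derivative_glue_at_0:
  fixes f g f' g' :: "real \<Rightarrow> real"
  assumes f: "\<And>y. (f has_real_derivative f' y) (at y)" and g: "\<And>y. (g has_real_derivative g' y) (at y)"
    and eq: "f 0 = g 0" "f' 0 = g' 0"
  shows "((\<lambda>y. if y \<ge> 0 then f y else g y) has_real_derivative (if y \<ge> 0 then f' y else g' y)) (at y)"
proof (cases y "0::real" rule: linorder_cases)
  case less
  then show ?thesis
    using has_field_derivative_transform_within_open[OF g, of "{..<0}" y] by auto
next
  case greater
  then show ?thesis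
    using has_field_derivative_transform_within_open[OF f, of "{0<..}" y] by auto
next
  case equal
  have "((\<lambda>u. ((if u \<ge> 0 then f u else g u) - f 0) / (u - 0)) \<longlongrightarrow> f' 0) (at 0)"
  proof (rule filterlim_split_at)
    have "((\<lambda>u. (g u - g 0) / (u - 0)) \<longlongrightarrow> g' 0) (at_left 0)"
      using g[of 0] by (auto simp: has_field_derivative_iff intro: tendsto_mono[OF at_le])
    then show "((\<lambda>u. ((if u \<ge> 0 then f u else g u) - f 0) / (u - 0)) \<longlongrightarrow> f' 0) (at_left 0)"
      unfolding eq by (rule Lim_transform_eventually) (auto simp: eventually_at_filter)
    have "((\<lambda>u. (f u - f 0) / (u - 0)) \<longlongrightarrow> f' 0) (at_right 0)"
      using f[of 0] by (auto simp: has_field_derivative_iff intro: tendsto_mono[OF at_le])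
    then show "((\<lambda>u. ((if u \<ge> 0 then f u else g u) - f 0) / (u - 0)) \<longlongrightarrow> f' 0) (at_right 0)"
      by (rule Lim_transform_eventually) (auto simp: eventually_at_filter)
  qed
  then show ?thesis using equal by (simp add: has_field_derivative_iff)
qed

definition cbrt2 :: real where "cbrt2 = 2 powr (1 / 3)"

lemma cbrt2: "cbrt2 \<ge> 1" "cbrt2 ^ 3 = 2"
  by (simp_all add: cbrt2_def powr_realpow[symmetric] powr_powr ge_one_powr_ge_zero)

context
  fixes x :: real
  assumes x: "x > 0"
    and den: "cbrt2 * Re (airy_rot 1 (cbrt2 * x)) \<noteq> sqrt 2 * sqrt x * Re (airy_rot 0 (cbrt2 * x))"
begin

private definition "a0 = Re (airy_rot 0 (cbrt2 * x))"
private definition "a1 = Re (airy_rot 1 (cbrt2 * x))"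
private definition "b0 = Im (airy_rot 0 (cbrt2 * x))"
private definition "b1 = Im (airy_rot 1 (cbrt2 * x))"
private definition "\<kappa> = sqrt 2 * sqrt x"
private definition "C = (\<kappa> * (cbrt2 * b0 - 1 / x) - cbrt2\<^sup>2 * b1) / (cbrt2 * a1 - \<kappa> * a0)"
private definition "A = cbrt2 * b0 + C * a0 - 1 / x"
private definition "wp k y = cbrt2 * Im (airy_rot k (cbrt2 * (x + y))) + C * Re (airy_rot k (cbrt2 * (x + y)))"
private definition "w y = (if y \<ge> 0 then wp 0 y else 1 / x + A * exp (\<kappa> * y))"
private definition "w1 y = (if y \<ge> 0 then cbrt2 * wp 1 y else A * \<kappa> * exp (\<kappa> * y))"

private lemma wp_deriv: "(wp k has_real_derivative cbrt2 * wp (Suc k) y) (at y)"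
proof -
  have c: "((\<lambda>y. cbrt2 * (x + y)) has_real_derivative cbrt2) (at y)"
    by (auto intro!: derivative_eq_intros)
  note DERIV_chain2[OF Re_Im_airy_rot_deriv(1) c] DERIV_chain2[OF Re_Im_airy_rot_deriv(2) c]
  from DERIV_add[OF DERIV_cmult[OF this(2)[of k], of cbrt2] DERIV_cmult[OF this(1)[of k], of C]]
  show ?thesis unfolding wp_def[abs_def] by (simp add: algebra_simps)
qed

private lemma wp_ode: "cbrt2 * (cbrt2 * wp 2 y) = 2 * ((x + y) * wp 0 y - 1)"
proof -
  have "wp 2 y = cbrt2 * ((x + y) * wp 0 y - 1)"
    unfolding wp_def airy_rot_ode by (simp add: algebra_simps)
  then have "cbrt2 * (cbrt2 * wp 2 y) = (cbrt2 * cbrt2 * cbrt2) * ((x + y) * wp 0 y - 1)"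
    by simp
  then show ?thesis using cbrt2(2) by (simp only: power3_eq_cube)
qed

private lemma match: "wp 0 0 = 1 / x + A" "cbrt2 * wp 1 0 = A * \<kappa>"
proof -
  show "wp 0 0 = 1 / x + A" by (simp add: wp_def A_def a0_def b0_def)
  have "cbrt2 * a1 - \<kappa> * a0 \<noteq> 0" using den by (simp add: a0_def a1_def \<kappa>_def)
  then have "C * (cbrt2 * a1 - \<kappa> * a0) = \<kappa> * (cbrt2 * b0 - 1 / x) - cbrt2\<^sup>2 * b1"
    by (simp add: C_def)
  then show "cbrt2 * wp 1 0 = A * \<kappa>"
    by (simp add: wp_def A_def a1_def[symmetric] b1_def[symmetric] power2_eq_square algebra_simps del: One_nat_def)
qed

private lemma \<kappa>: "\<kappa> > 0" "\<kappa> * \<kappa> = 2 * x"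
proof -
  have "\<kappa> * \<kappa> = (sqrt 2 * sqrt 2) * (sqrt x * sqrt x)" by (simp only: \<kappa>_def mult_ac)
  then show "\<kappa> * \<kappa> = 2 * x" using x by simp
qed (use x in \<open>simp add: \<kappa>_def\<close>)

text \<open>
  On the positive half line the bounded solutions are \<open>cbrt2 * Gi\<close> plus a multiple of \<open>Ai\<close>
  (both multiplied by \<open>pi\<close>), at the argument \<open>cbrt2 * (x + y)\<close>; on the negative half line they are
  \<open>1 / x\<close> plus a multiple of \<open>exp (sqrt (2 * x) * y)\<close>.  Continuity of the function and of its derivative
  at \<open>0\<close> determines the two multiples.  Continuity of the second derivative is then automatic, because
  the equation holds on both sides.
\<close>
lemma resolvent_solution_ex:
  "\<exists>K w w1. resolvent_solution x K w w1 \<and>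
    w 0 = (sqrt 2 * Re (airy_rot 0 (cbrt2 * x)) / sqrt x
            + cbrt2\<^sup>2 * (Re (airy_rot 0 (cbrt2 * x)) * Im (airy_rot 1 (cbrt2 * x)) - Im (airy_rot 0 (cbrt2 * x)) * Re (airy_rot 1 (cbrt2 * x))))
          / (sqrt 2 * sqrt x * Re (airy_rot 0 (cbrt2 * x)) - cbrt2 * Re (airy_rot 1 (cbrt2 * x)))"
proof -
  obtain K0 where K0: "\<And>k z. k \<in> {0, 1} \<Longrightarrow> z \<ge> 0 \<Longrightarrow> norm (airy_rot k z) \<le> K0"
    "\<And>k z. k \<in> {0, 1} \<Longrightarrow> z \<ge> 0 \<Longrightarrow> z * norm (airy_rot k z) \<le> K0"
    using airy_rot_bounded by blast
  have K00: "K0 \<ge> 0" using K0(2)[of 0 0] by simp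
  define E where "E = cbrt2 * K0 + \<bar>C\<bar> * K0"
  define F where "F = 1 / x + \<bar>A\<bar> + \<bar>A\<bar> * \<kappa>"
  define K where "K = cbrt2 * E + F + x * F"
  have pos: "cbrt2 \<ge> 1" "E \<ge> 0" "F \<ge> 0" "x * F \<ge> 0" "\<kappa> > 0" "1 / x > 0"
    using cbrt2(1) K00 x \<kappa> by (auto simp: E_def F_def)
  have E1: "E \<le> cbrt2 * E" using mult_right_mono[OF pos(1,2)] by simp
  have wpb: "\<bar>wp k y\<bar> \<le> E" "(x + y) * \<bar>wp k y\<bar> \<le> E" if k: "k \<in> {0,1}" and y: "y \<ge> 0" for k y
  proof -
    define z where "z = cbrt2 * (x + y)"
    have z: "z \<ge> 0" "x + y \<le> z"
      using cbrt2(1) x y mult_right_mono[OF pos(1), of "x + y"] by (auto simp: z_def)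
    have le: "\<bar>wp k y\<bar> \<le> (cbrt2 + \<bar>C\<bar>) * norm (airy_rot k z)"
    proof -
      have "\<bar>wp k y\<bar> \<le> \<bar>cbrt2 * Im (airy_rot k z)\<bar> + \<bar>C * Re (airy_rot k z)\<bar>" by (simp add: wp_def z_def)
      also have "\<dots> \<le> cbrt2 * norm (airy_rot k z) + \<bar>C\<bar> * norm (airy_rot k z)"
        using pos(1) by (auto simp: abs_mult intro!: add_mono mult_mono abs_Re_le_cmod abs_Im_le_cmod)
      finally show ?thesis by (simp add: algebra_simps)
    qed
    also have "\<dots> \<le> (cbrt2 + \<bar>C\<bar>) * K0" using pos(1) K0(1)[OF k z(1)] by (intro mult_left_mono) auto
    finally show "\<bar>wp k y\<bar> \<le> E" by (simp add: E_def algebra_simps)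
    have "(x + y) * \<bar>wp k y\<bar> \<le> z * ((cbrt2 + \<bar>C\<bar>) * norm (airy_rot k z))"
      using z le by (intro mult_mono) auto
    also have "\<dots> = (cbrt2 + \<bar>C\<bar>) * (z * norm (airy_rot k z))" by simp
    also have "\<dots> \<le> (cbrt2 + \<bar>C\<bar>) * K0" using pos(1) K0(2)[OF k z(1)] by (intro mult_left_mono) auto
    finally show "(x + y) * \<bar>wp k y\<bar> \<le> E" by (simp add: E_def algebra_simps)
  qed
  have neg: "\<bar>1 / x + A * exp (\<kappa> * y)\<bar> \<le> F" "\<bar>A * \<kappa> * exp (\<kappa> * y)\<bar> \<le> F" if "y < 0" for y
  proof -
    have e: "0 < exp (\<kappa> * y)" "exp (\<kappa> * y) \<le> 1" using that \<kappa> by (auto simp: mult_le_0_iff)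
    have "\<bar>A * exp (\<kappa> * y)\<bar> \<le> \<bar>A\<bar>" using e mult_left_mono[OF e(2), of "\<bar>A\<bar>"] by (simp add: abs_mult)
    moreover have "\<bar>A * \<kappa> * exp (\<kappa> * y)\<bar> \<le> \<bar>A\<bar> * \<kappa>"
      using e mult_left_mono[OF e(2), of "\<bar>A\<bar> * \<kappa>"] \<kappa> by (simp add: abs_mult)
    moreover have "\<bar>A\<bar> * \<kappa> \<ge> 0" using \<kappa> by simp
    ultimately show "\<bar>1 / x + A * exp (\<kappa> * y)\<bar> \<le> F" "\<bar>A * \<kappa> * exp (\<kappa> * y)\<bar> \<le> F"
      using pos(6) unfolding F_def by linarith+
  qed
  have K: "E \<le> K" "F \<le> K" "x * F \<le> K" "cbrt2 * E \<le> K"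
    using pos E1 unfolding K_def by linarith+
  have wb: "\<bar>w y\<bar> \<le> K" "(x + max y 0) * \<bar>w y\<bar> \<le> K" for y
  proof -
    have "\<bar>w y\<bar> \<le> K \<and> (x + max y 0) * \<bar>w y\<bar> \<le> K"
    proof (cases "y \<ge> 0")
      case True
      then show ?thesis using wpb[of 0 y] K(1) by (simp add: w_def)
    next
      case False
      then have "\<bar>w y\<bar> \<le> F" using neg(1)[of y] by (simp add: w_def)
      moreover from this have "x * \<bar>w y\<bar> \<le> x * F" using x by (intro mult_left_mono) auto
      moreover have "max y 0 = 0" using False by simp
      ultimately show ?thesis using K(2,3) by simp
    qed
    then show "\<bar>w y\<bar> \<le> K" "(x + max y 0) * \<bar>w y\<bar> \<le> K" by auto
  qed
  have w1b: "\<bar>w1 y\<bar> \<le> K" "(x + max y 0) * \<bar>w1 y\<bar> \<le> K" for y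
  proof -
    have "\<bar>w1 y\<bar> \<le> K \<and> (x + max y 0) * \<bar>w1 y\<bar> \<le> K"
    proof (cases "y \<ge> 0")
      case True
      then have "cbrt2 * \<bar>wp 1 y\<bar> \<le> cbrt2 * E" "cbrt2 * ((x + y) * \<bar>wp 1 y\<bar>) \<le> cbrt2 * E"
        using wpb[of 1 y] pos(1) by (auto intro!: mult_left_mono)
      moreover have "\<bar>w1 y\<bar> = cbrt2 * \<bar>wp 1 y\<bar>" "max y 0 = y"
        using True pos(1) by (auto simp: w1_def abs_mult)
      ultimately show ?thesis using K(4) by (simp add: mult.left_commute)
    next
      case False
      then have "\<bar>w1 y\<bar> \<le> F" using neg(2)[of y] by (simp add: w1_def)
      moreover from this have "x * \<bar>w1 y\<bar> \<le> x * F" using x by (intro mult_left_mono) auto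
      moreover have "max y 0 = 0" using False by simp
      ultimately show ?thesis using K(2,3) by simp
    qed
    then show "\<bar>w1 y\<bar> \<le> K" "(x + max y 0) * \<bar>w1 y\<bar> \<le> K" by auto
  qed
  have dw: "(w has_real_derivative w1 y) (at y)" for y
    unfolding w_def[abs_def] w1_def
  proof (rule has_real_derivative_glue_at_0)
    show "(wp 0 has_real_derivative cbrt2 * wp 1 y) (at y)" for y
      using wp_deriv[of 0 y] by simp
    show "((\<lambda>y. 1 / x + A * exp (\<kappa> * y)) has_real_derivative A * \<kappa> * exp (\<kappa> * y)) (at y)" for y
      by (auto intro!: derivative_eq_intros)
  qed (use match in auto)
  have dw1: "(w1 has_real_derivative 2 * ((x + max y 0) * w y - 1)) (at y)" for y
  proof -
    have "(w1 has_real_derivative (if y \<ge> 0 then cbrt2 * (cbrt2 * wp 2 y) else A * \<kappa> * \<kappa> * exp (\<kappa> * y))) (at y)"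
      unfolding w1_def[abs_def]
    proof (rule has_real_derivative_glue_at_0)
      show "((\<lambda>y. cbrt2 * wp 1 y) has_real_derivative cbrt2 * (cbrt2 * wp 2 y)) (at y)" for y
        using DERIV_cmult[OF wp_deriv[of 1], of cbrt2] by (simp add: numeral_2_eq_2)
      show "((\<lambda>y. A * \<kappa> * exp (\<kappa> * y)) has_real_derivative A * \<kappa> * \<kappa> * exp (\<kappa> * y)) (at y)" for y
        by (auto intro!: derivative_eq_intros)
      show "cbrt2 * wp 1 0 = A * \<kappa> * exp (\<kappa> * 0)" using match(2) by simp
      have "x * (1 / x + A) = 1 + x * A" using x by (simp add: field_simps)
      then show "cbrt2 * (cbrt2 * wp 2 0) = A * \<kappa> * \<kappa> * exp (\<kappa> * 0)"
        unfolding wp_ode using match(1) \<kappa>(2) by simp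
    qed
    moreover have "A * \<kappa> * \<kappa> * exp (\<kappa> * y) = 2 * (x * (1 / x + A * exp (\<kappa> * y)) - 1)"
    proof -
      have "A * \<kappa> * \<kappa> = A * (2 * x)" using \<kappa>(2) by simp
      then show ?thesis using x by (simp add: field_simps)
    qed
    ultimately show ?thesis unfolding wp_ode by (auto simp: w_def max_def split: if_splits)
  qed
  have "resolvent_solution x K w w1"
    by (rule resolvent_solution.intro) (fact x dw dw1 wb w1b)+
  moreover have "w 0 = (sqrt 2 * a0 / sqrt x + cbrt2\<^sup>2 * (a0 * b1 - b0 * a1)) / (sqrt 2 * sqrt x * a0 - cbrt2 * a1)"
  proof -
    have d: "cbrt2 * a1 - \<kappa> * a0 \<noteq> 0" using den by (simp add: a0_def a1_def \<kappa>_def)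
    have "C * (cbrt2 * a1 - \<kappa> * a0) = \<kappa> * (cbrt2 * b0 - 1 / x) - cbrt2\<^sup>2 * b1"
      using d by (simp add: C_def)
    then have eqC: "a0 * (C * (cbrt2 * a1 - \<kappa> * a0)) = a0 * (\<kappa> * (cbrt2 * b0 - 1 / x) - cbrt2\<^sup>2 * b1)"
      by (simp only:)
    have "w 0 * (cbrt2 * a1 - \<kappa> * a0) = cbrt2 * b0 * (cbrt2 * a1 - \<kappa> * a0) + a0 * (C * (cbrt2 * a1 - \<kappa> * a0))"
      by (simp add: w_def wp_def a0_def[symmetric] b0_def[symmetric] algebra_simps)
    then have "w 0 * (cbrt2 * a1 - \<kappa> * a0) = - (\<kappa> / x * a0 + cbrt2\<^sup>2 * (a0 * b1 - b0 * a1))"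
      unfolding eqC by (simp add: power2_eq_square algebra_simps)
    moreover have "\<kappa> / x = sqrt 2 / sqrt x"
      using x by (simp add: \<kappa>_def field_simps)
    ultimately have "w 0 * (\<kappa> * a0 - cbrt2 * a1) = sqrt 2 * a0 / sqrt x + cbrt2\<^sup>2 * (a0 * b1 - b0 * a1)"
      by (simp add: algebra_simps)
    then show ?thesis using d unfolding \<kappa>_def by (simp add: field_simps)
  qed
  ultimately show ?thesis
    unfolding a0_def a1_def b0_def b1_def by blast
qed

end

text \<open>
  The entire functions that agree with \<open>Re (airy_rot k x)\<close> and \<open>Im (airy_rot k x)\<close> for real \<open>x\<close>.  They
  are needed because real and imaginary parts are not holomorphic.
\<close>
definition airy_re :: "nat \<Rightarrow> complex \<Rightarrow> complex" where
  "airy_re k z = (cis (pi / 6) * \<omega>3 ^ k * airy_laplace k (\<omega>3 * z) + cnj (cis (pi / 6) * \<omega>3 ^ k) * airy_laplace k (cnj \<omega>3 * z)) / 2"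

definition airy_im :: "nat \<Rightarrow> complex \<Rightarrow> complex" where
  "airy_im k z = (cis (pi / 6) * \<omega>3 ^ k * airy_laplace k (\<omega>3 * z) - cnj (cis (pi / 6) * \<omega>3 ^ k) * airy_laplace k (cnj \<omega>3 * z)) / (2 * \<i>)"

lemma airy_laplace_cnj: "airy_laplace k (cnj u) = cnj (airy_laplace k u)"
proof -
  have "cnj (airy_laplace k u) = (\<integral>r. cnj (of_real (airy_weight k r) * exp (u * of_real r)) \<partial>lborel)"
    unfolding airy_laplace_def by (rule Bochner_Integration.integral_cnj[symmetric])
  then show ?thesis by (simp add: airy_laplace_def exp_cnj)
qed

lemma airy_re_im_of_real:
  "airy_re k (of_real x) = of_real (Re (airy_rot k x))" "airy_im k (of_real x) = of_real (Im (airy_rot k x))"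
proof -
  have *: "(z - cnj z) / (2 * \<i>) = of_real (Im z)" for z
  proof -
    show ?thesis by (simp add: complex_eq_iff Re_divide Im_divide power2_eq_square)
  qed
  have "cnj (cis (pi / 6) * \<omega>3 ^ k) * airy_laplace k (cnj \<omega>3 * of_real x) = cnj (airy_rot k x)"
    using airy_laplace_cnj[of k "\<omega>3 * of_real x"] by (simp add: airy_rot_def)
  then show "airy_re k (of_real x) = of_real (Re (airy_rot k x))" "airy_im k (of_real x) = of_real (Im (airy_rot k x))"
    using *[of "airy_rot k x"] by (simp_all add: airy_re_def airy_im_def airy_rot_def[symmetric] complex_add_cnj)
qed

lemma airy_re_im_holomorphic:
  assumes "f holomorphic_on S"
  shows "(\<lambda>z. airy_re k (f z)) holomorphic_on S" "(\<lambda>z. airy_im k (f z)) holomorphic_on S"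
proof -
  have "(\<lambda>z. airy_laplace k (a * f z)) holomorphic_on S" for a
  proof -
    have "(\<lambda>z. a * f z) holomorphic_on S" using assms by (intro holomorphic_intros)
    from holomorphic_on_compose[OF this airy_laplace_holomorphic] show ?thesis by (simp add: o_def)
  qed
  then show "(\<lambda>z. airy_re k (f z)) holomorphic_on S" "(\<lambda>z. airy_im k (f z)) holomorphic_on S"
    unfolding airy_re_def airy_im_def by (auto intro!: holomorphic_intros)
qed

context brownian
begin

definition resolvent :: "real \<Rightarrow> real" where
  "resolvent x = (\<integral>t. indicator {0<..} t * (exp (- (x * t)) * \<psi> (t * sqrt t)) \<partial>lborel)"

text \<open>
  The formula of \<open>resolvent_solution_ex\<close>, multiplied by \<open>q = sqrt x\<close>, is a quotient of functions that
  are entire in \<open>q\<close>.  Its denominator at \<open>q = 0\<close> is a nonzero multiple of \<open>Ai' 0\<close>.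
\<close>
lemma resolvent_near_0:
  obtains \<rho> h where "\<rho> > 0" "h holomorphic_on ball 0 \<rho>"
    "\<And>q. 0 < q \<Longrightarrow> q < \<rho> \<Longrightarrow> complex_of_real (q * resolvent (q\<^sup>2)) = h (of_real q)"
    "h 0 = complex_of_real (2 powr (1/6) * (3 powr (-1/3) * Gamma (1/3) / Gamma (2/3)))"
proof -
  define d where "d q = of_real (sqrt 2) * q * airy_re 0 (of_real cbrt2 * q\<^sup>2) - of_real cbrt2 * airy_re 1 (of_real cbrt2 * q\<^sup>2)" for q :: complex
  define n where "n q = of_real (sqrt 2) * airy_re 0 (of_real cbrt2 * q\<^sup>2)
      + q * of_real cbrt2 ^ 2 * (airy_re 0 (of_real cbrt2 * q\<^sup>2) * airy_im 1 (of_real cbrt2 * q\<^sup>2)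
         - airy_im 0 (of_real cbrt2 * q\<^sup>2) * airy_re 1 (of_real cbrt2 * q\<^sup>2))" for q :: complex
  have hol: "d holomorphic_on UNIV" "n holomorphic_on UNIV"
    unfolding d_def n_def by (auto intro!: holomorphic_intros airy_re_im_holomorphic)
  have v: "airy_re 0 0 = of_real (sqrt 3 / 2 * (3 powr (-2/3) * Gamma (1/3)))"
       "airy_re 1 0 = of_real (- (sqrt 3 / 2 * (3 powr (-1/3) * Gamma (2/3))))"
    using airy_re_im_of_real(1)[of 0 0] airy_re_im_of_real(1)[of 1 0] by (simp_all add: Re_airy_rot_at_0 del: One_nat_def)
  have G: "Gamma (2/3 :: real) \<noteq> 0" using Gamma_real_pos[of "2/3"] by force
  have d0: "d 0 \<noteq> 0" using G cbrt2(1) by (simp add: d_def v del: One_nat_def)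
  have "isCont d 0" using hol(1) by (meson UNIV_I continuous_on_eq_continuous_at holomorphic_on_imp_continuous_on open_UNIV)
  then obtain \<rho> where \<rho>: "\<rho> > 0" "\<And>q. dist q 0 < \<rho> \<Longrightarrow> d q \<noteq> 0"
    using continuous_at_avoid[of 0 d 0] d0 by (auto simp: dist_commute)
  show ?thesis
  proof (rule that[of \<rho> "\<lambda>q. n q / d q"])
    show "(\<lambda>q. n q / d q) holomorphic_on ball 0 \<rho>"
      using hol \<rho>(2) by (auto intro!: holomorphic_intros intro: holomorphic_on_subset simp: dist_commute)
    show "complex_of_real (q * resolvent (q\<^sup>2)) = n (of_real q) / d (of_real q)" if q: "0 < q" "q < \<rho>" for q
    proof -
      have arg: "of_real cbrt2 * (of_real q)\<^sup>2 = (of_real (cbrt2 * q\<^sup>2) :: complex)" by simp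
      define p r s t where "p = Re (airy_rot 0 (cbrt2 * q\<^sup>2))" and "r = Re (airy_rot 1 (cbrt2 * q\<^sup>2))"
        and "s = Im (airy_rot 0 (cbrt2 * q\<^sup>2))" and "t = Im (airy_rot 1 (cbrt2 * q\<^sup>2))"
      have dq: "d (of_real q) = of_real (sqrt 2 * q * p - cbrt2 * r)"
        unfolding d_def arg airy_re_im_of_real p_def r_def by simp
      have nq: "n (of_real q) = of_real (sqrt 2 * p + q * cbrt2\<^sup>2 * (p * t - s * r))"
        unfolding n_def arg airy_re_im_of_real p_def r_def s_def t_def by simp
      have "d (of_real q) \<noteq> 0" using \<rho>(2)[of "of_real q"] q by simp
      then have ne: "sqrt 2 * q * p - cbrt2 * r \<noteq> 0" unfolding dq of_real_eq_0_iff .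
      have sq: "sqrt (q\<^sup>2) = q" "q\<^sup>2 > 0" using q by auto
      have "cbrt2 * r \<noteq> sqrt 2 * sqrt (q\<^sup>2) * p"
        using ne unfolding sq(1) right_minus_eq by (rule not_sym)
      then obtain K w w1 where "resolvent_solution (q\<^sup>2) K w w1"
         "w 0 = (sqrt 2 * p / q + cbrt2\<^sup>2 * (p * t - s * r)) / (sqrt 2 * q * p - cbrt2 * r)"
        using resolvent_solution_ex[OF sq(2)] unfolding p_def r_def s_def t_def sq(1) by blast
      with feynman_kac_resolvent have "resolvent (q\<^sup>2) = (sqrt 2 * p / q + cbrt2\<^sup>2 * (p * t - s * r)) / (sqrt 2 * q * p - cbrt2 * r)"
        unfolding resolvent_def by metis
      then have "q * resolvent (q\<^sup>2) = (q * (sqrt 2 * p / q + cbrt2\<^sup>2 * (p * t - s * r))) / (sqrt 2 * q * p - cbrt2 * r)"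
        by simp
      also have "q * (sqrt 2 * p / q + cbrt2\<^sup>2 * (p * t - s * r)) = sqrt 2 * p + q * cbrt2\<^sup>2 * (p * t - s * r)"
        using q by (simp add: field_simps)
      finally show ?thesis unfolding dq nq by simp
    qed
    have "n 0 / d 0 = of_real ((sqrt 2 * (sqrt 3 / 2 * (3 powr (-2/3) * Gamma (1/3)))) / (cbrt2 * (sqrt 3 / 2 * (3 powr (-1/3) * Gamma (2/3)))))"
      by (simp add: n_def d_def v del: One_nat_def)
    also have "(sqrt 2 * (sqrt 3 / 2 * (3 powr (-2/3) * Gamma (1/3)))) / (cbrt2 * (sqrt 3 / 2 * (3 powr (-1/3) * Gamma (2/3))))
        = (sqrt 2 / cbrt2) * ((3 powr (-2/3) / 3 powr (-1/3)) * Gamma (1/3) / Gamma (2/3))"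
      by simp
    also have "sqrt 2 / cbrt2 = 2 powr (1/6)"
      unfolding cbrt2_def powr_half_sqrt[symmetric, of 2, simplified] by (simp flip: powr_diff)
    also have "3 powr (-2/3) / 3 powr (-1/3) = (3::real) powr (-1/3)" by (simp flip: powr_diff)
    finally show "n 0 / d 0 = complex_of_real (2 powr (1/6) * (3 powr (-1/3) * Gamma (1/3) / Gamma (2/3)))" .
  qed (fact \<rho>(1))
qed

end

section \<open>Positive moments of the area and bounds for the resolvent\<close>

lemma nn_integral_powr_near_0:
  fixes a c :: real
  assumes "a > - 1" "c > 0"
  shows "(\<integral>\<^sup>+x. ennreal (x powr a) * indicator {0<..c} x \<partial>lborel) = ennreal (c powr (a + 1) / (a + 1))"
proof -
  have "((\<lambda>x. x powr a) has_integral (c powr (a + 1) / (a + 1))) {0..c}"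
    by (rule has_integral_powr_from_0) (use assms in auto)
  from nn_integral_has_integral_lebesgue'[OF _ this]
  have "(\<integral>\<^sup>+x. ennreal (x powr a) * indicator {0..c} x \<partial>lborel) = ennreal (c powr (a + 1) / (a + 1))" by simp
  moreover have "(\<integral>\<^sup>+x. ennreal (x powr a) * indicator {0..c} x \<partial>lborel) = (\<integral>\<^sup>+x. ennreal (x powr a) * indicator {0<..c} x \<partial>lborel)"
    by (rule nn_integral_cong_AE) (use AE_lborel_singleton[of "0::real"] in \<open>eventually_elim, auto simp: indicator_def\<close>)
  ultimately show ?thesis by simp
qed

lemma nn_integral_powr_to_inf:
  fixes a c :: real
  assumes "a < - 1" "c > 0"
  shows "(\<integral>\<^sup>+x. ennreal (x powr a) * indicator {c<..} x \<partial>lborel) = ennreal (- (c powr (a + 1) / (a + 1)))"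
proof -
  have "((\<lambda>x. x powr a) has_integral (- (c powr (a + 1)) / (a + 1))) {c..}"
    by (rule has_integral_powr_to_inf) (use assms in auto)
  from nn_integral_has_integral_lebesgue'[OF _ this]
  have "(\<integral>\<^sup>+x. ennreal (x powr a) * indicator {c..} x \<partial>lborel) = ennreal (- (c powr (a + 1) / (a + 1)))" by simp
  moreover have "(\<integral>\<^sup>+x. ennreal (x powr a) * indicator {c..} x \<partial>lborel) = (\<integral>\<^sup>+x. ennreal (x powr a) * indicator {c<..} x \<partial>lborel)"
    by (rule nn_integral_cong_AE) (use AE_lborel_singleton[of c] in \<open>eventually_elim, auto simp: indicator_def\<close>)
  ultimately show ?thesis by simp
qed

lemma nn_integral_inverse_near_0:
  fixes c :: real
  assumes "c > 0"
  shows "(\<integral>\<^sup>+x. ennreal (x powr - 1) * indicator {0<..c} x \<partial>lborel) = top"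
proof (rule ccontr)
  define d where "d = min c 1"
  have d: "d > 0" "d \<le> 1" "d \<le> c" using assms by (auto simp: d_def)
  assume "\<not> ?thesis"
  then obtain r where r: "r \<ge> 0" "(\<integral>\<^sup>+x. ennreal (x powr - 1) * indicator {0<..c} x \<partial>lborel) = ennreal r"
    by (metis ennreal_cases)
  have le: "d powr e / e \<le> r" if e: "e > 0" for e
  proof -
    have "ennreal (d powr (e - 1 + 1) / (e - 1 + 1)) = (\<integral>\<^sup>+x. ennreal (x powr (e - 1)) * indicator {0<..d} x \<partial>lborel)"
      by (rule nn_integral_powr_near_0[symmetric]) (use e d in auto)
    also have "\<dots> \<le> (\<integral>\<^sup>+x. ennreal (x powr - 1) * indicator {0<..c} x \<partial>lborel)"
    proof (rule nn_integral_mono)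
      fix x :: real
      show "ennreal (x powr (e - 1)) * indicator {0<..d} x \<le> ennreal (x powr - 1) * indicator {0<..c} x"
        using d e powr_mono'[of "- 1" "e - 1" x] by (auto simp: indicator_def intro!: ennreal_leI)
    qed
    finally show ?thesis using r e by (simp add: ennreal_le_iff)
  qed
  have "filterlim (\<lambda>e. d powr e / e) at_top (at_right 0)"
    using d by real_asymp
  then have "\<forall>\<^sub>F e in at_right 0. r + 1 \<le> d powr e / e" by (simp add: filterlim_at_top)
  moreover have "\<forall>\<^sub>F e in at_right (0::real). e > 0" by (simp add: eventually_at_right_less)
  ultimately have "\<forall>\<^sub>F e in at_right (0::real). False"
    by eventually_elim (use le in force)
  then show False by simp
qed

context brownian
begin

lemma even_moment_le:
  assumes t: "t \<in> {0..1}"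
  shows "(\<integral>\<^sup>+\<omega>. ennreal (B t \<omega> ^ (2 * m)) \<partial>M) \<le> ennreal (fact (2 * m))"
proof (cases "t = 0")
  case True
  have "(\<integral>\<^sup>+\<omega>. ennreal (B t \<omega> ^ (2 * m)) \<partial>M) = (\<integral>\<^sup>+\<omega>. ennreal (0 ^ (2 * m)) \<partial>M)"
    using bm True by (intro nn_integral_cong) (auto simp: standard_brownian_motion_def)
  also have "\<dots> \<le> ennreal 1"
    by (cases "m = 0") (auto simp: emeasure_space_1 zero_power)
  also have "\<dots> \<le> ennreal (fact (2 * m))" by (intro ennreal_leI) auto
  finally show ?thesis .
next
  case False
  then have t0: "t > 0" "t \<le> 1" using t by auto
  have "0 \<in> {0..1::real}" "t \<in> {0..1}" "0 < t" using t0 by auto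
  then have "distributed M lborel (\<lambda>\<omega>. B t \<omega> - B 0 \<omega>) (normal_density 0 (sqrt (t - 0)))"
    using bm unfolding standard_brownian_motion_def by blast
  note D = this[unfolded diff_zero]
  have sq: "sqrt t > 0" using t0 by simp
  note hb = normal_moment_even[OF sq, of 0 m]
  have I: "integrable M (\<lambda>\<omega>. (B t \<omega> - B 0 \<omega>) ^ (2 * m))"
    "expectation (\<lambda>\<omega>. (B t \<omega> - B 0 \<omega>) ^ (2 * m)) = fact (2 * m) / ((2 / (sqrt t)\<^sup>2) ^ m * fact m)"
    using hb distributed_integral[OF D, of "\<lambda>x. x ^ (2 * m)"] distributed_integrable[OF D, of "\<lambda>x. x ^ (2 * m)"]
    by (auto simp: has_bochner_integral_iff)
  have "(\<integral>\<^sup>+\<omega>. ennreal (B t \<omega> ^ (2 * m)) \<partial>M) = (\<integral>\<^sup>+\<omega>. ennreal ((B t \<omega> - B 0 \<omega>) ^ (2 * m)) \<partial>M)"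
    using bm by (intro nn_integral_cong) (auto simp: standard_brownian_motion_def)
  also have "\<dots> = ennreal (fact (2 * m) / ((2 / t) ^ m * fact m))"
    using nn_integral_eq_integral[OF I(1)] I(2) t0 by simp
  also have "\<dots> \<le> ennreal (fact (2 * m))"
  proof (intro ennreal_leI)
    have "1 \<le> 2 / t" using t0 by simp
    then have "1 * 1 \<le> (2 / t) ^ m * fact m" using t0 by (intro mult_mono one_le_power) auto
    then show "fact (2 * m) / ((2 / t) ^ m * fact m) \<le> fact (2 * m)"
      using t0 by (simp add: divide_le_eq mult_le_cancel_left1)
  qed
  finally show ?thesis .
qed

text \<open>
  Convexity of the even powers bounds the moments of the Riemann sums by Gaussian moments, and Fatou's
  lemma passes to the limit.
\<close>
lemma X_even_moment_le: "(\<integral>\<^sup>+\<omega>. ennreal (X \<omega> ^ (2 * m)) \<partial>M) \<le> ennreal (fact (2 * m))"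
proof -
  have R: "(\<integral>\<^sup>+\<omega>. ennreal (riemann_area (Suc n) \<omega> ^ (2 * m)) \<partial>M) \<le> ennreal (fact (2 * m))" for n
  proof -
    let ?b = "\<lambda>k. B (real k / real (Suc n))"
    have bmeas: "(\<lambda>\<omega>. ennreal (?b k \<omega> ^ (2 * m))) \<in> borel_measurable M" if "k \<in> {..<Suc n}" for k
    proof -
      have "?b k \<in> borel_measurable M"
        by (rule B_measurable) (use that in \<open>auto simp: field_simps\<close>)
      then show ?thesis by measurable
    qed
    have pt: "riemann_area (Suc n) \<omega> ^ (2 * m) \<le> (\<Sum>k<Suc n. 1 / real (Suc n) * ?b k \<omega> ^ (2 * m))" for \<omega>
    proof -
      have e: "riemann_area (Suc n) \<omega> = (\<Sum>k<Suc n. (1 / real (Suc n)) *\<^sub>R max (?b k \<omega>) 0)"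
        by (simp add: riemann_area_def sum_divide_distrib del: sum.lessThan_Suc)
      have "(\<Sum>k<Suc n. (1 / real (Suc n)) *\<^sub>R max (?b k \<omega>) 0) ^ (2 * m) \<le> (\<Sum>k<Suc n. 1 / real (Suc n) * max (?b k \<omega>) 0 ^ (2 * m))"
        by (rule convex_on_sum[where C = UNIV and f = "\<lambda>x. x ^ (2 * m)"])
           (auto intro: convex_power_even simp del: sum.lessThan_Suc)
      also have "(\<Sum>k<Suc n. 1 / real (Suc n) * max (?b k \<omega>) 0 ^ (2 * m)) \<le> (\<Sum>k<Suc n. 1 / real (Suc n) * ?b k \<omega> ^ (2 * m))"
        by (intro sum_mono mult_left_mono) (auto simp: max_def power_0_left)
      finally show ?thesis unfolding e .
    qed
    have "(\<integral>\<^sup>+\<omega>. ennreal (riemann_area (Suc n) \<omega> ^ (2 * m)) \<partial>M) \<le> (\<integral>\<^sup>+\<omega>. (\<Sum>k<Suc n. ennreal (1 / real (Suc n)) * ennreal (?b k \<omega> ^ (2 * m))) \<partial>M)"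
    proof (intro nn_integral_mono)
      fix \<omega>
      have "ennreal (riemann_area (Suc n) \<omega> ^ (2 * m)) \<le> ennreal (\<Sum>k<Suc n. 1 / real (Suc n) * ?b k \<omega> ^ (2 * m))"
        by (rule ennreal_leI[OF pt])
      also have "\<dots> = (\<Sum>k<Suc n. ennreal (1 / real (Suc n) * ?b k \<omega> ^ (2 * m)))"
        by (rule sum_ennreal[symmetric]) auto
      also have "\<dots> = (\<Sum>k<Suc n. ennreal (1 / real (Suc n)) * ennreal (?b k \<omega> ^ (2 * m)))"
        by (intro sum.cong refl ennreal_mult) auto
      finally show "ennreal (riemann_area (Suc n) \<omega> ^ (2 * m)) \<le> \<dots>" .
    qed
    also have "\<dots> = (\<Sum>k<Suc n. ennreal (1 / real (Suc n)) * (\<integral>\<^sup>+\<omega>. ennreal (?b k \<omega> ^ (2 * m)) \<partial>M))"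
      using bmeas by (subst nn_integral_sum)
        (auto intro!: sum.cong nn_integral_cmult borel_measurable_times_ennreal simp del: sum.lessThan_Suc of_nat_Suc)
    also have "\<dots> \<le> (\<Sum>k<Suc n. ennreal (1 / real (Suc n)) * ennreal (fact (2 * m)))"
      by (intro sum_mono mult_left_mono even_moment_le) (auto simp: field_simps)
    also have "\<dots> = (\<Sum>k<Suc n. ennreal (1 / real (Suc n) * fact (2 * m)))"
      by (intro sum.cong refl ennreal_mult[symmetric]) auto
    also have "\<dots> = ennreal (\<Sum>k<Suc n. 1 / real (Suc n) * fact (2 * m))"
      by (rule sum_ennreal) auto
    also have "(\<Sum>k<Suc n. 1 / real (Suc n) * fact (2 * m)) = fact (2 * m)"
      by (simp del: sum.lessThan_Suc of_nat_Suc)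
    finally show ?thesis .
  qed
  have "(\<integral>\<^sup>+\<omega>. ennreal (X \<omega> ^ (2 * m)) \<partial>M) = (\<integral>\<^sup>+\<omega>. liminf (\<lambda>n. ennreal (riemann_area (Suc n) \<omega> ^ (2 * m))) \<partial>M)"
  proof (rule nn_integral_cong)
    fix \<omega> assume "\<omega> \<in> space M"
    from riemann_area_tendsto[OF this]
    have "(\<lambda>n. ennreal (riemann_area (Suc n) \<omega> ^ (2 * m))) \<longlonglongrightarrow> ennreal (X \<omega> ^ (2 * m))"
      by (intro tendsto_ennrealI tendsto_intros)
    from lim_imp_Liminf[OF _ this] show "ennreal (X \<omega> ^ (2 * m)) = liminf (\<lambda>n. ennreal (riemann_area (Suc n) \<omega> ^ (2 * m)))"
      by simp
  qed
  also have "\<dots> \<le> liminf (\<lambda>n. \<integral>\<^sup>+\<omega>. ennreal (riemann_area (Suc n) \<omega> ^ (2 * m)) \<partial>M)"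
    by (rule nn_integral_liminf) measurable
  also have "\<dots> \<le> ennreal (fact (2 * m))"
    by (rule Liminf_le) (auto simp: R)
  finally show ?thesis .
qed

lemma integrable_X_powr_nonneg:
  assumes "p \<ge> 0"
  shows "integrable M (\<lambda>\<omega>. X \<omega> powr p)"
proof -
  define m where "m = nat \<lceil>p\<rceil>"
  have m: "p \<le> real (2 * m)" using assms unfolding m_def by linarith
  have "integrable M (\<lambda>\<omega>. X \<omega> ^ (2 * m))"
    by (rule integrableI_nonneg) (use X_even_moment_le[of m] X_nonneg in \<open>auto intro: le_less_trans\<close>)
  then have "integrable M (\<lambda>\<omega>. 1 + X \<omega> ^ (2 * m))" by auto
  then show ?thesis
  proof (rule Bochner_Integration.integrable_bound)
    show "AE \<omega> in M. norm (X \<omega> powr p) \<le> norm (1 + X \<omega> ^ (2 * m))"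
    proof (rule AE_I2)
      fix \<omega> assume w: "\<omega> \<in> space M"
      have "X \<omega> powr p \<le> 1 + X \<omega> ^ (2 * m)"
      proof (cases "X \<omega> \<le> 1")
        case True
        have "X \<omega> powr p \<le> 1" using powr_le1[OF assms, of "X \<omega>"] X_nonneg[OF w] True by simp
        then show ?thesis using X_nonneg[OF w] by (simp add: add_increasing2)
      next
        case False
        then have "X \<omega> powr p \<le> X \<omega> powr real (2 * m)" using m by (intro powr_mono) auto
        also have "\<dots> = X \<omega> ^ (2 * m)" using False by (subst powr_realpow) auto
        finally show ?thesis by simp
      qed
      moreover have "1 + X \<omega> ^ (2 * m) \<ge> 0" using X_nonneg[OF w] by simp
      ultimately show "norm (X \<omega> powr p) \<le> norm (1 + X \<omega> ^ (2 * m))" by simp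
    qed
  qed simp
qed

lemma integrable_resolvent:
  assumes "x > 0"
  shows "integrable lborel (\<lambda>t. indicator {0<..} t * (exp (- (x * t)) * \<psi> (t * sqrt t)))"
proof (rule Bochner_Integration.integrable_bound)
  show "integrable lborel (\<lambda>t. indicator {0<..} t * (t powr (1 - 1) * exp (- (x * t powr 1))))"
    using has_bochner_integral_Gamma_power[of 1 1 x] assms by (auto simp: has_bochner_integral_iff)
  show "AE t in lborel. norm (indicator {0<..} t * (exp (- (x * t)) * \<psi> (t * sqrt t))) \<le> norm (indicator {0<..} t * (t powr (1 - 1) * exp (- (x * t powr 1))))"
  proof (rule AE_I2)
    fix t :: real
    show "norm (indicator {0<..} t * (exp (- (x * t)) * \<psi> (t * sqrt t))) \<le> norm (indicator {0<..} t * (t powr (1 - 1) * exp (- (x * t powr 1))))"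
      using psi_nonneg[of "t * sqrt t"] psi_le_1[of "t * sqrt t"] by (auto simp: indicator_def intro: mult_left_le)
  qed
qed measurable

lemma resolvent_nonneg: "resolvent x \<ge> 0"
  unfolding resolvent_def by (rule Bochner_Integration.integral_nonneg) (auto simp: psi_nonneg)

lemma resolvent_le: "x > 0 \<Longrightarrow> resolvent x \<le> 1 / x"
proof -
  assume x: "x > 0"
  note g = has_bochner_integral_Gamma_power[of 1 1 x]
  have "resolvent x \<le> (\<integral>t. indicator {0<..} t * (t powr (1 - 1) * exp (- (x * t powr 1))) \<partial>lborel)"
    unfolding resolvent_def
  proof (rule integral_mono[OF integrable_resolvent[OF x]])
    show "integrable lborel (\<lambda>t. indicator {0<..} t * (t powr (1 - 1) * exp (- (x * t powr 1))))"
      using g x by (auto simp: has_bochner_integral_iff)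
    show "indicator {0<..} t * (exp (- (x * t)) * \<psi> (t * sqrt t)) \<le> indicator {0<..} t * (t powr (1 - 1) * exp (- (x * t powr 1)))" for t :: real
      using psi_le_1[of "t * sqrt t"] by (auto simp: indicator_def intro: mult_left_le)
  qed
  also have "\<dots> = 1 / x"
    using has_bochner_integral_integral_eq[OF g] x by (simp add: powr_minus divide_inverse)
  finally show ?thesis .
qed

lemma resolvent_measurable [measurable]: "resolvent \<in> borel_measurable borel"
  unfolding resolvent_def by measurable

end

section \<open>The Mellin transform of the resolvent\<close>

lemma inverse_ennreal_antimono:
  assumes "0 \<le> a" "a \<le> b"
  shows "inverse (ennreal b) \<le> inverse (ennreal a)"
proof (cases "a = 0")
  case False
  with assms show ?thesis by (simp add: inverse_ennreal ennreal_leI le_imp_inverse_le)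
qed simp

context brownian
begin

lemma nn_integral_powr_top:
  fixes z :: real
  assumes "z > 0"
  shows "(\<integral>\<^sup>+t. ennreal (t powr (z - 1)) * indicator {0<..} t \<partial>lborel) = top"
proof (rule ccontr)
  define G where "G = Gamma z"
  have G: "G > 0" using assms by (simp add: G_def Gamma_real_pos)
  assume "\<not> ?thesis"
  then obtain r where r: "r \<ge> 0" "(\<integral>\<^sup>+t. ennreal (t powr (z - 1)) * indicator {0<..} t \<partial>lborel) = ennreal r"
    by (metis ennreal_cases)
  define c where "c = (G / (r + 1)) powr (1 / z)"
  have c: "c > 0" using G r by (simp add: c_def)
  have "c powr (- z) = (r + 1) / G"
    using G r assms by (simp add: c_def powr_powr powr_minus)
  then have "G * c powr (- z) = r + 1" using G by simp
  then have "ennreal (r + 1) = (\<integral>\<^sup>+t. ennreal (t powr (z - 1) * exp (- (c * t powr 1))) * indicator {0<..} t \<partial>lborel)"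
    using nn_integral_Gamma_power[of z 1 c] assms c by (simp add: G_def)
  also have "\<dots> \<le> (\<integral>\<^sup>+t. ennreal (t powr (z - 1)) * indicator {0<..} t \<partial>lborel)"
  proof (intro nn_integral_mono mult_right_mono ennreal_leI)
    fix t :: real
    have "0 \<le> c * t powr 1" using c by simp
    then show "t powr (z - 1) * exp (- (c * t powr 1)) \<le> t powr (z - 1)"
      by (intro mult_left_le) auto
  qed auto
  finally show False using r by (simp add: ennreal_le_iff)
qed

lemma ennreal_psi: "l \<ge> 0 \<Longrightarrow> ennreal (\<psi> l) = (\<integral>\<^sup>+\<omega>. ennreal (exp (- (l * X \<omega>))) \<partial>M)"
proof -
  assume l: "l \<ge> 0"
  have "integrable M (\<lambda>\<omega>. exp (- (l * X \<omega>)))"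
    by (rule integrable_const_bound[where B = 1]) (use l X_nonneg in \<open>auto intro!: AE_I2\<close>)
  then show ?thesis unfolding \<psi>_def by (subst nn_integral_eq_integral) auto
qed

lemma ennreal_resolvent:
  "x > 0 \<Longrightarrow> ennreal (resolvent x) = (\<integral>\<^sup>+t. ennreal (exp (- (x * t))) * ennreal (\<psi> (t * sqrt t)) * indicator {0<..} t \<partial>lborel)"
proof -
  assume x: "x > 0"
  have "ennreal (resolvent x) = (\<integral>\<^sup>+t. ennreal (indicator {0<..} t * (exp (- (x * t)) * \<psi> (t * sqrt t))) \<partial>lborel)"
    unfolding resolvent_def
    by (subst nn_integral_eq_integral[OF integrable_resolvent[OF x]]) (auto simp: psi_nonneg)
  also have "\<dots> = (\<integral>\<^sup>+t. ennreal (exp (- (x * t))) * ennreal (\<psi> (t * sqrt t)) * indicator {0<..} t \<partial>lborel)"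
    by (intro nn_integral_cong) (auto simp: indicator_def ennreal_mult psi_nonneg)
  finally show ?thesis .
qed

text \<open>
  Also valid where the area vanishes: both sides are then infinite.
\<close>
lemma nn_integral_powr_exp_X:
  assumes z: "z > 0" and w: "\<omega> \<in> space M"
  shows "(\<integral>\<^sup>+t. ennreal (t powr (z - 1)) * ennreal (exp (- (t * sqrt t * X \<omega>))) * indicator {0<..} t \<partial>lborel)
    = ennreal (2 / 3 * Gamma (2 * z / 3)) * inverse (ennreal (X \<omega> powr (2 * z / 3)))"
proof -
  have G: "Gamma (2 * z / 3) > 0" using z by (simp add: Gamma_real_pos)
  show ?thesis
  proof (cases "X \<omega> = 0")
    case True
    have "(\<integral>\<^sup>+t. ennreal (t powr (z - 1)) * ennreal (exp (- (t * sqrt t * X \<omega>))) * indicator {0<..} t \<partial>lborel) = top"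
      using nn_integral_powr_top[OF z] True by simp
    then show ?thesis using True G by (simp add: ennreal_mult_top)
  next
    case False
    then have X: "X \<omega> > 0" using X_nonneg[OF w] by simp
    have "(\<integral>\<^sup>+t. ennreal (t powr (z - 1)) * ennreal (exp (- (t * sqrt t * X \<omega>))) * indicator {0<..} t \<partial>lborel)
       = (\<integral>\<^sup>+t. ennreal (t powr (z - 1) * exp (- (X \<omega> * t powr (3/2)))) * indicator {0<..} t \<partial>lborel)"
    proof (rule nn_integral_cong)
      fix t :: real
      have "t powr (3/2) = t * sqrt t" if "t > 0"
        using powr_add[of t 1 "1/2"] that by (simp add: powr_half_sqrt)
      then show "ennreal (t powr (z - 1)) * ennreal (exp (- (t * sqrt t * X \<omega>))) * indicator {0<..} t
        = ennreal (t powr (z - 1) * exp (- (X \<omega> * t powr (3/2)))) * indicator {0<..} t"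
        by (auto simp: indicator_def ennreal_mult mult_ac)
    qed
    also have "\<dots> = ennreal (Gamma (z / (3/2)) / (3/2) * X \<omega> powr (- (z / (3/2))))"
      by (rule nn_integral_Gamma_power) (use z X in auto)
    also have "\<dots> = ennreal (2 / 3 * Gamma (2 * z / 3)) * ennreal (inverse (X \<omega> powr (2 * z / 3)))"
      using G by (subst ennreal_mult[symmetric]) (auto simp: powr_minus mult_ac)
    also have "ennreal (inverse (X \<omega> powr (2 * z / 3))) = inverse (ennreal (X \<omega> powr (2 * z / 3)))"
      using X by (subst inverse_ennreal) auto
    finally show ?thesis .
  qed
qed

text \<open>
  All integrands are nonnegative, so Tonelli's theorem applies without integrability assumptions, and
  finiteness of one side can be read off from the other.
\<close>
lemma mellin_resolvent:
  assumes z: "0 < z" "z < 1"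
  shows "(\<integral>\<^sup>+x. ennreal (x powr (- z)) * ennreal (resolvent x) * indicator {0<..} x \<partial>lborel)
    = ennreal (Gamma (1 - z) * (2 / 3 * Gamma (2 * z / 3))) * negative_moment M X (2 * z / 3)"
proof -
  let ?K = "\<lambda>x t. ennreal (x powr (- z)) * indicator {0<..} x * (ennreal (exp (- (x * t))) * ennreal (\<psi> (t * sqrt t)) * indicator {0<..} t)"
  have sfM: "sigma_finite_measure M" by unfold_locales
  interpret P: pair_sigma_finite lborel M
    by (intro pair_sigma_finite.intro sfM sigma_finite_lborel)
  have G: "Gamma (1 - z) > 0" "Gamma (2 * z / 3) > 0" using z by (simp_all add: Gamma_real_pos)
  have "(\<integral>\<^sup>+x. ennreal (x powr (- z)) * ennreal (resolvent x) * indicator {0<..} x \<partial>lborel)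
      = (\<integral>\<^sup>+x. (\<integral>\<^sup>+t. ?K x t \<partial>lborel) \<partial>lborel)"
  proof (rule nn_integral_cong)
    fix x :: real
    show "ennreal (x powr (- z)) * ennreal (resolvent x) * indicator {0<..} x
      = (\<integral>\<^sup>+t. ?K x t \<partial>lborel)"
    proof (cases "x > 0")
      case True
      then show ?thesis by (subst nn_integral_cmult) (auto simp: ennreal_resolvent)
    qed auto
  qed
  also have "\<dots> = (\<integral>\<^sup>+t. (\<integral>\<^sup>+x. ?K x t \<partial>lborel) \<partial>lborel)"
    by (rule lborel_pair.Fubini') measurable
  also have "\<dots> = (\<integral>\<^sup>+t. ennreal (Gamma (1 - z)) * (ennreal (t powr (z - 1)) * ennreal (\<psi> (t * sqrt t)) * indicator {0<..} t) \<partial>lborel)"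
  proof (rule nn_integral_cong)
    fix t :: real
    show "(\<integral>\<^sup>+x. ?K x t \<partial>lborel)
        = ennreal (Gamma (1 - z)) * (ennreal (t powr (z - 1)) * ennreal (\<psi> (t * sqrt t)) * indicator {0<..} t)"
    proof (cases "t > 0")
      case True
      have "(\<integral>\<^sup>+x. ?K x t \<partial>lborel)
        = (\<integral>\<^sup>+x. ennreal (\<psi> (t * sqrt t)) * (ennreal (x powr ((1 - z) - 1) * exp (- (t * x powr 1))) * indicator {0<..} x) \<partial>lborel)"
        using True by (intro nn_integral_cong) (auto simp: indicator_def ennreal_mult mult_ac)
      also have "\<dots> = ennreal (\<psi> (t * sqrt t)) * (\<integral>\<^sup>+x. ennreal (x powr ((1 - z) - 1) * exp (- (t * x powr 1))) * indicator {0<..} x \<partial>lborel)"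
        by (rule nn_integral_cmult) measurable
      also have "(\<integral>\<^sup>+x. ennreal (x powr ((1 - z) - 1) * exp (- (t * x powr 1))) * indicator {0<..} x \<partial>lborel) = ennreal (Gamma ((1 - z) / 1) / 1 * t powr (- ((1 - z) / 1)))"
        by (rule nn_integral_Gamma_power) (use z True in auto)
      also have "\<dots> = ennreal (Gamma (1 - z)) * ennreal (t powr (z - 1))"
        using G by (simp add: ennreal_mult)
      finally show ?thesis using True by (simp add: mult_ac)
    qed auto
  qed
  also have "\<dots> = ennreal (Gamma (1 - z)) * (\<integral>\<^sup>+t. ennreal (t powr (z - 1)) * ennreal (\<psi> (t * sqrt t)) * indicator {0<..} t \<partial>lborel)"
    by (rule nn_integral_cmult) measurable
  also have "(\<integral>\<^sup>+t. ennreal (t powr (z - 1)) * ennreal (\<psi> (t * sqrt t)) * indicator {0<..} t \<partial>lborel)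
      = (\<integral>\<^sup>+t. (\<integral>\<^sup>+\<omega>. ennreal (t powr (z - 1)) * indicator {0<..} t * ennreal (exp (- (t * sqrt t * X \<omega>))) \<partial>M) \<partial>lborel)"
  proof (rule nn_integral_cong)
    fix t :: real
    show "ennreal (t powr (z - 1)) * ennreal (\<psi> (t * sqrt t)) * indicator {0<..} t
      = (\<integral>\<^sup>+\<omega>. ennreal (t powr (z - 1)) * indicator {0<..} t * ennreal (exp (- (t * sqrt t * X \<omega>))) \<partial>M)"
    proof (cases "t > 0")
      case True
      then show ?thesis by (subst nn_integral_cmult) (auto simp: ennreal_psi)
    qed auto
  qed
  also have "\<dots> = (\<integral>\<^sup>+\<omega>. (\<integral>\<^sup>+t. ennreal (t powr (z - 1)) * indicator {0<..} t * ennreal (exp (- (t * sqrt t * X \<omega>))) \<partial>lborel) \<partial>M)"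
    by (rule P.Fubini'[symmetric]) measurable
  also have "\<dots> = (\<integral>\<^sup>+\<omega>. ennreal (2 / 3 * Gamma (2 * z / 3)) * inverse (ennreal (X \<omega> powr (2 * z / 3))) \<partial>M)"
    by (rule nn_integral_cong, subst nn_integral_powr_exp_X[OF z(1), symmetric]) (auto simp: mult_ac)
  also have "\<dots> = ennreal (2 / 3 * Gamma (2 * z / 3)) * negative_moment M X (2 * z / 3)"
    unfolding negative_moment_def by (rule nn_integral_cmult) measurable
  also have "ennreal (Gamma (1 - z)) * (ennreal (2 / 3 * Gamma (2 * z / 3)) * negative_moment M X (2 * z / 3))
      = ennreal (Gamma (1 - z) * (2 / 3 * Gamma (2 * z / 3))) * negative_moment M X (2 * z / 3)"
    using G by (subst ennreal_mult) (auto simp: mult.assoc)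
  finally show ?thesis .
qed

lemma resolvent_bounds_near_0:
  obtains \<delta> c1 c2 where "\<delta> > 0" "c1 > 0"
    "\<And>x. 0 < x \<Longrightarrow> x \<le> \<delta> \<Longrightarrow> c1 * x powr (- 1 / 2) \<le> resolvent x"
    "\<And>x. 0 < x \<Longrightarrow> x \<le> \<delta> \<Longrightarrow> resolvent x \<le> c2 * x powr (- 1 / 2)"
proof -
  obtain \<rho> h where \<rho>: "\<rho> > 0" and h: "h holomorphic_on ball 0 \<rho>"
    and hg: "\<And>q. 0 < q \<Longrightarrow> q < \<rho> \<Longrightarrow> complex_of_real (q * resolvent (q\<^sup>2)) = h (of_real q)"
    and h0: "h 0 = complex_of_real (2 powr (1/6) * (3 powr (-1/3) * Gamma (1/3) / Gamma (2/3)))"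
    using resolvent_near_0 by blast
  define r where "r = 2 powr (1/6) * (3 powr (-1/3) * Gamma (1/3) / Gamma (2/3 :: real))"
  have r: "r > 0" "Re (h 0) = r" by (simp_all add: r_def h0 Gamma_real_pos)
  have "isCont h 0" using h \<rho> by (metis centre_in_ball continuous_on_eq_continuous_at holomorphic_on_imp_continuous_on open_ball)
  then obtain d where d: "d > 0" "\<And>q. dist q 0 < d \<Longrightarrow> dist (h q) (h 0) < r / 2"
    unfolding continuous_at_eps_delta using r by (meson half_gt_zero)
  define e where "e = min d \<rho> / 2"
  have e: "e > 0" "e < d" "e < \<rho>" using d \<rho> by (auto simp: e_def)
  have key: "r / 2 * x powr (- 1 / 2) \<le> resolvent x \<and> resolvent x \<le> 3 * r / 2 * x powr (- 1 / 2)" if x: "0 < x" "x \<le> e\<^sup>2" for x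
  proof -
    define q where "q = sqrt x"
    have q: "q > 0" "q \<le> e" "q\<^sup>2 = x" using x e by (auto simp: q_def real_le_lsqrt)
    have "h (of_real q) = of_real (q * resolvent x)" using hg[of q] q e by simp
    moreover have "dist (h (of_real q)) (h 0) < r / 2" using q e by (intro d) auto
    ultimately have "\<bar>Re (of_real (q * resolvent x) - h 0)\<bar> < r / 2"
      using abs_Re_le_cmod[of "of_real (q * resolvent x) - h 0"] by (simp add: dist_norm)
    moreover have "Re (of_real (q * resolvent x) - h 0) = q * resolvent x - r" by (simp add: r)
    ultimately have "\<bar>q * resolvent x - r\<bar> < r / 2" by (simp only:)
    then have "r / 2 \<le> q * resolvent x" "q * resolvent x \<le> 3 * r / 2" by linarith+
    then have "r / 2 / q \<le> resolvent x" "resolvent x \<le> 3 * r / 2 / q" using q by (auto simp: field_simps)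
    moreover have "x powr (- 1 / 2) = 1 / q"
    proof -
      have "x powr (- 1 / 2) = inverse (x powr (1 / 2))" using powr_minus[of x "1/2"] by simp
      also have "x powr (1 / 2) = q" using x by (simp add: q_def powr_half_sqrt)
      finally show ?thesis by (simp only: inverse_eq_divide)
    qed
    ultimately show ?thesis by simp
  qed
  show ?thesis
    by (rule that[of "e\<^sup>2" "r / 2" "3 * r / 2"]) (use key e r in auto)
qed

lemma negative_moment_finite_lt:
  assumes s: "0 < s" "s < 1 / 3"
  shows "negative_moment M X s < \<infinity>"
proof -
  define z where "z = 3 * s / 2"
  have z: "0 < z" "z < 1 / 2" "2 * z / 3 = s" using s by (auto simp: z_def)
  obtain \<delta> c1 c2 where \<delta>: "\<delta> > 0" and up: "\<And>x. 0 < x \<Longrightarrow> x \<le> \<delta> \<Longrightarrow> resolvent x \<le> c2 * x powr (- 1 / 2)"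
    using resolvent_bounds_near_0 by metis
  have "c2 * \<delta> powr (- 1 / 2) \<ge> 0" using up[of \<delta>] \<delta> resolvent_nonneg[of \<delta>] by linarith
  then have c2: "c2 \<ge> 0" using \<delta> by (simp add: zero_le_mult_iff)
  have "(\<integral>\<^sup>+x. ennreal (x powr (- z)) * ennreal (resolvent x) * indicator {0<..} x \<partial>lborel)
      \<le> (\<integral>\<^sup>+x. ennreal c2 * (ennreal (x powr (- z - 1 / 2)) * indicator {0<..\<delta>} x) + ennreal (x powr (- z - 1)) * indicator {\<delta><..} x \<partial>lborel)"
  proof (rule nn_integral_mono)
    fix x :: real
    consider "x \<le> 0" | "0 < x" "x \<le> \<delta>" | "\<delta> < x" by linarith
    then show "ennreal (x powr (- z)) * ennreal (resolvent x) * indicator {0<..} x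
      \<le> ennreal c2 * (ennreal (x powr (- z - 1 / 2)) * indicator {0<..\<delta>} x) + ennreal (x powr (- z - 1)) * indicator {\<delta><..} x"
    proof cases
      case 2
      have "x powr (- z) * resolvent x \<le> x powr (- z) * (c2 * x powr (- 1 / 2))" using up[OF 2] by (intro mult_left_mono) auto
      also have "\<dots> = c2 * x powr (- z - 1 / 2)" 
        using powr_add[of x "- z" "- 1 / 2"] by simp
      finally show ?thesis using 2 c2 by (simp add: ennreal_mult[symmetric] resolvent_nonneg ennreal_leI)
    next
      case 3
      then have "x powr (- z) * resolvent x \<le> x powr (- z) * (1 / x)" using resolvent_le[of x] \<delta> by (intro mult_left_mono) auto
      also have "\<dots> = x powr (- z - 1)" using 3 \<delta> by (simp add: powr_diff)
      finally show ?thesis using 3 \<delta> by (simp add: ennreal_mult[symmetric] resolvent_nonneg ennreal_leI)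
    qed auto
  qed
  also have "\<dots> = ennreal c2 * ennreal (\<delta> powr (- z - 1 / 2 + 1) / (- z - 1 / 2 + 1)) + ennreal (- (\<delta> powr (- z - 1 + 1) / (- z - 1 + 1)))"
    using z \<delta> by (simp add: nn_integral_add nn_integral_cmult nn_integral_powr_near_0 nn_integral_powr_to_inf)
  also have "\<dots> < \<infinity>" by (simp add: ennreal_mult_less_top)
  finally have "ennreal (Gamma (1 - z) * (2 / 3 * Gamma (2 * z / 3))) * negative_moment M X s < \<infinity>"
    using mellin_resolvent[of z] z by simp
  moreover have "Gamma (1 - z) * (2 / 3 * Gamma (2 * z / 3)) > 0" using z by (simp add: Gamma_real_pos)
  ultimately show ?thesis by (auto simp: ennreal_mult_less_top)
qed

text \<open>
  The lower bound \<open>c1 / sqrt x\<close> for the resolvent makes the Mellin integral at \<open>z = 1 / 2\<close> diverge like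
  the integral of \<open>1 / x\<close>.
\<close>
lemma negative_moment_third: "negative_moment M X (1 / 3) = top"
proof (rule ccontr)
  assume fin: "negative_moment M X (1 / 3) \<noteq> top"
  obtain \<delta> c1 where \<delta>: "\<delta> > 0" "c1 > 0" and low: "\<And>x. 0 < x \<Longrightarrow> x \<le> \<delta> \<Longrightarrow> c1 * x powr (- 1 / 2) \<le> resolvent x"
    using resolvent_bounds_near_0 by metis
  have "top = ennreal c1 * (\<integral>\<^sup>+x. ennreal (x powr - 1) * indicator {0<..\<delta>} x \<partial>lborel)"
    unfolding nn_integral_inverse_near_0[OF \<delta>(1)] using \<delta>(2) by (simp add: ennreal_mult_top)
  also have "\<dots> = (\<integral>\<^sup>+x. ennreal c1 * (ennreal (x powr - 1) * indicator {0<..\<delta>} x) \<partial>lborel)"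
    by (rule nn_integral_cmult[symmetric]) measurable
  also have "\<dots> \<le> (\<integral>\<^sup>+x. ennreal (x powr (- (1/2))) * ennreal (resolvent x) * indicator {0<..} x \<partial>lborel)"
  proof (rule nn_integral_mono)
    fix x :: real
    show "ennreal c1 * (ennreal (x powr - 1) * indicator {0<..\<delta>} x) \<le> ennreal (x powr (- (1/2))) * ennreal (resolvent x) * indicator {0<..} x"
    proof (cases "0 < x \<and> x \<le> \<delta>")
      case True
      have "c1 * x powr - 1 = x powr (- (1/2)) * (c1 * x powr (- 1 / 2))" using powr_add[of x "-(1/2)" "-1/2"] by simp
      also have "\<dots> \<le> x powr (- (1/2)) * resolvent x" using low[of x] True by (intro mult_left_mono) auto
      finally show ?thesis using True \<delta> by (simp add: ennreal_mult[symmetric] resolvent_nonneg ennreal_leI)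
    qed (auto simp: indicator_def)
  qed
  also have "\<dots> = ennreal (Gamma (1 - 1/2) * (2 / 3 * Gamma (2 * (1/2) / 3))) * negative_moment M X (2 * (1/2) / 3)"
    by (rule mellin_resolvent) auto
  also have "\<dots> < top" using fin by (simp add: ennreal_mult_less_top top.not_eq_extremum)
  finally show False by simp
qed

lemma negative_moment_finite_iff:
  assumes "s > 0"
  shows "negative_moment M X s < \<infinity> \<longleftrightarrow> s < 1 / 3"
proof
  assume fin: "negative_moment M X s < \<infinity>"
  show "s < 1 / 3"
  proof (rule ccontr)
    assume "\<not> s < 1 / 3"
    then have s: "s \<ge> 1 / 3" by simp
    have "negative_moment M X (1 / 3) \<le> (\<integral>\<^sup>+\<omega>. 1 + inverse (ennreal (X \<omega> powr s)) \<partial>M)"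
      unfolding negative_moment_def
    proof (rule nn_integral_mono)
      fix \<omega> assume w: "\<omega> \<in> space M"
      show "inverse (ennreal (X \<omega> powr (1 / 3))) \<le> 1 + inverse (ennreal (X \<omega> powr s))"
      proof (cases "X \<omega> \<le> 1")
        case True
        have "X \<omega> powr s \<le> X \<omega> powr (1 / 3)"
          using True X_nonneg[OF w] s by (intro powr_mono') auto
        then have "inverse (ennreal (X \<omega> powr (1 / 3))) \<le> inverse (ennreal (X \<omega> powr s))"
          by (intro inverse_ennreal_antimono) auto
        then show ?thesis by (simp add: add_increasing)
      next
        case False
        then have "1 \<le> X \<omega> powr (1 / 3)" by (intro ge_one_powr_ge_zero) auto
        then have "inverse (ennreal (X \<omega> powr (1 / 3))) \<le> inverse (ennreal 1)"
          by (intro inverse_ennreal_antimono) auto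
        then show ?thesis by (simp add: add_increasing2)
      qed
    qed
    also have "\<dots> = 1 + negative_moment M X s"
      unfolding negative_moment_def by (subst nn_integral_add) (auto simp: emeasure_space_1)
    also have "\<dots> < top" using fin by simp
    finally show False using negative_moment_third by simp
  qed
qed (use negative_moment_finite_lt assms in auto)

end

section \<open>Series of simple poles\<close>

lemma pole_term_bound:
  fixes s :: complex and k N :: nat
  assumes "Re s > - real N / 3" "k \<ge> N"
  shows "norm (3 * s + of_nat k + 1) \<ge> 1"
proof -
  have "1 \<le> Re (3 * s + of_nat k + 1)" using assms by simp
  also have "\<dots> \<le> norm (3 * s + of_nat k + 1)" by (rule complex_Re_le_cmod)
  finally show ?thesis .
qed

lemma pole_series_summable:
  fixes c :: "nat \<Rightarrow> complex"
  assumes "summable (\<lambda>k. norm (c k))"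
  shows "summable (\<lambda>k. c k / (3 * s + of_nat k + 1))"
proof -
  obtain N :: nat where N: "- 3 * Re s < real N" using reals_Archimedean2 by blast
  have "norm (c (k + N) / (3 * s + of_nat (k + N) + 1)) \<le> norm (c (k + N))" for k
    using pole_term_bound[of N s "k + N"] N unfolding norm_divide
    by (intro divide_le_eq_1_pos[THEN iffD2] mult_imp_div_pos_le) (auto simp: mult_le_cancel_left1 intro: less_le_trans[OF zero_less_one])
  then have "summable (\<lambda>k. c (k + N) / (3 * s + of_nat (k + N) + 1))"
    by (rule summable_comparison_test'[OF assms[THEN summable_ignore_initial_segment, of N], of 0])
  then show ?thesis by (subst (asm) summable_iff_shift)
qed

text \<open>
  Only finitely many terms have their pole to the right of a given vertical line.  Split off these
  terms; to the right of the line the remaining series converges uniformly by the Weierstrass test.  The hypothesis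
  allows the term with its pole at \<open>s0\<close> to be present with coefficient \<open>0\<close>.
\<close>
lemma pole_series_analytic:
  fixes c :: "nat \<Rightarrow> complex"
  assumes sum: "summable (\<lambda>k. norm (c k))"
    and ne: "\<And>k. c k = 0 \<or> 3 * s0 + of_nat k + 1 \<noteq> 0"
  shows "(\<lambda>s. \<Sum>k. c k / (3 * s + of_nat k + 1)) analytic_on {s0}"
proof -
  obtain N :: nat where N: "- 3 * Re s0 < real N" using reals_Archimedean2 by blast
  define U where "U = {s. Re s > - real N / 3}"
  have U: "open U" "s0 \<in> U" using N unfolding U_def by (auto simp: open_halfspace_Re_gt)
  define tail where "tail s = (\<Sum>k. c (k + N) / (3 * s + of_nat (k + N) + 1))" for s
  have bound: "norm (c (k + N) / (3 * s + of_nat (k + N) + 1)) \<le> norm (c (k + N))" if "s \<in> U" for s k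
  proof -
    have "norm (3 * s + of_nat (k + N) + 1) \<ge> 1" using that by (intro pole_term_bound[of N]) (auto simp: U_def)
    then have "norm (c (k + N)) / norm (3 * s + of_nat (k + N) + 1) \<le> norm (c (k + N)) / 1"
      by (intro divide_left_mono) auto
    then show ?thesis by (simp add: norm_divide)
  qed
  have tail_hol: "tail holomorphic_on U"
  proof (rule holomorphic_uniform_sequence[OF U(1)])
    show "(\<lambda>s. \<Sum>k<n. c (k + N) / (3 * s + of_nat (k + N) + 1)) holomorphic_on U" for n
    proof (intro holomorphic_intros)
      fix s k assume "s \<in> U"
      then have "norm (3 * s + of_nat (k + N) + 1) \<ge> 1" by (intro pole_term_bound[of N]) (auto simp: U_def)
      then show "3 * s + of_nat (k + N) + 1 \<noteq> 0" by auto
    qed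
    fix x assume "x \<in> U"
    then obtain d where d: "d > 0" "cball x d \<subseteq> U" using U(1) open_contains_cball by blast
    have "uniform_limit (cball x d) (\<lambda>n s. \<Sum>k<n. c (k + N) / (3 * s + of_nat (k + N) + 1)) tail sequentially"
      unfolding tail_def
    proof (rule Weierstrass_m_test)
      show "summable (\<lambda>k. norm (c (k + N)))" using sum by (rule summable_ignore_initial_segment)
      show "norm (c (k + N) / (3 * s + of_nat (k + N) + 1)) \<le> norm (c (k + N))" if "s \<in> cball x d" for k s
        using bound d that by blast
    qed
    with d show "\<exists>d>0. cball x d \<subseteq> U \<and> uniform_limit (cball x d) (\<lambda>n s. \<Sum>k<n. c (k + N) / (3 * s + of_nat (k + N) + 1)) tail sequentially"
      by blast
  qed
  have "(\<lambda>s. tail s + (\<Sum>k<N. c k / (3 * s + of_nat k + 1))) analytic_on {s0}"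
  proof (rule analytic_on_add)
    show "tail analytic_on {s0}" using tail_hol U by (simp add: analytic_at) blast
    show "(\<lambda>s. \<Sum>k<N. c k / (3 * s + of_nat k + 1)) analytic_on {s0}"
    proof (rule analytic_on_sum)
      fix k
      show "(\<lambda>s. c k / (3 * s + of_nat k + 1)) analytic_on {s0}"
      proof (cases "c k = 0")
        case False
        with ne[of k] show ?thesis by (intro analytic_intros) auto
      qed simp
    qed
  qed
  moreover have "\<forall>\<^sub>F s in nhds s0. (\<Sum>k. c k / (3 * s + of_nat k + 1)) = tail s + (\<Sum>k<N. c k / (3 * s + of_nat k + 1))"
    unfolding tail_def
    by (rule always_eventually, rule allI, rule suminf_split_initial_segment, rule pole_series_summable[OF sum])
  ultimately show ?thesis by (subst analytic_at_cong[OF _ refl]) auto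
qed

lemma pole_series_split:
  fixes c :: "nat \<Rightarrow> complex"
  assumes "summable (\<lambda>k. norm (c k))"
  shows "(\<Sum>k. c k / (3 * s + of_nat k + 1)) = c j / (3 * s + of_nat j + 1) + (\<Sum>k. (c(j := 0)) k / (3 * s + of_nat k + 1))"
proof -
  have s': "summable (\<lambda>k. norm ((c(j := 0)) k))"
    by (rule summable_comparison_test'[OF assms, of 0]) auto
  have "(\<lambda>k. if k = j then c k / (3 * s + of_nat k + 1) else 0) sums (c j / (3 * s + of_nat j + 1))"
    by (rule sums_single)
  from sums_add[OF this summable_sums[OF pole_series_summable[OF s', of s]]]
  have "(\<lambda>k. (if k = j then c k / (3 * s + of_nat k + 1) else 0) + (c(j := 0)) k / (3 * s + of_nat k + 1)) sums
     (c j / (3 * s + of_nat j + 1) + (\<Sum>k. (c(j := 0)) k / (3 * s + of_nat k + 1)))" .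
  moreover have "(\<lambda>k. (if k = j then c k / (3 * s + of_nat k + 1) else 0) + (c(j := 0)) k / (3 * s + of_nat k + 1)) = (\<lambda>k. c k / (3 * s + of_nat k + 1))"
    by (auto simp: fun_eq_iff)
  ultimately show ?thesis by (simp add: sums_iff)
qed

text \<open>
  The coefficient \<open>u z\<close> may vanish.  Then the singularity is removable, which is why a pole of \<open>f\<close>
  forces \<open>u z \<noteq> 0\<close>.
\<close>
lemma simple_pole_form:
  fixes f u v :: "complex \<Rightarrow> complex"
  assumes u: "u analytic_on {z}" and v: "v analytic_on {z}"
    and eq: "\<forall>\<^sub>F w in at z. f w = u w / (w - z) + v w"
  shows "f meromorphic_on {z}" "residue f z = u z" "is_pole f z \<Longrightarrow> zorder f z = - 1 \<and> u z \<noteq> 0"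
proof -
  have "(\<lambda>w. u w / (w - z) + v w) meromorphic_on {z}"
    using u v by (intro meromorphic_intros analytic_on_imp_meromorphic_on) (auto intro!: analytic_intros)
  then show "f meromorphic_on {z}"
    by (subst meromorphic_on_cong[of "{z}" f "\<lambda>w. u w / (w - z) + v w"]) (use eq in auto)
  define g where "g w = u w + (w - z) * v w" for w
  have "g analytic_on {z}" unfolding g_def using u v by (intro analytic_intros)
  then obtain S where S: "open S" "z \<in> S" "g holomorphic_on S" by (auto simp: analytic_at)
  have eqg: "\<forall>\<^sub>F w in at z. f w = g w / (w - z)"
    using eq eventually_neq_at_within[of z z UNIV]
    by eventually_elim (auto simp: g_def field_simps)
  show "residue f z = u z"
    using residue_cong[OF eqg refl] residue_simple[OF S] by (simp add: g_def)
  assume pole: "is_pole f z"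
  have uz: "u z \<noteq> 0"
  proof
    assume "u z = 0"
    then have "g z = 0" by (simp add: g_def)
    moreover have "(g has_field_derivative deriv g z) (at z)" using S by (intro holomorphic_derivI)
    ultimately have "((\<lambda>w. g w / (w - z)) \<longlongrightarrow> deriv g z) (at z)"
      by (simp add: has_field_derivative_iff)
    then have "(f \<longlongrightarrow> deriv g z) (at z)"
      by (rule Lim_transform_eventually) (use eqg in \<open>eventually_elim, simp\<close>)
    then show False using pole unfolding is_pole_def by (metis at_neq_bot not_tendsto_and_filterlim_at_infinity)
  qed
  obtain A where A: "open A" "z \<in> A" "\<And>w. w \<in> A \<Longrightarrow> w \<noteq> z \<Longrightarrow> f w = g w / (w - z)"
    using eqg unfolding eventually_at_topological by blast
  have "zorder f z = - 1"
  proof (rule zorder_eqI[of "S \<inter> A" z g])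
    show "g z \<noteq> 0" using uz by (simp add: g_def)
  qed (use S A in \<open>auto intro: holomorphic_on_subset simp: power_int_minus divide_inverse\<close>)
  with uz show "zorder f z = - 1 \<and> u z \<noteq> 0" by simp
qed

section \<open>The moments as a function of a complex exponent\<close>

context brownian
begin

lemma negative_moment_eq:
  assumes "- 1 / 3 < \<sigma>" "\<sigma> < 0"
  shows "AE \<omega> in M. X \<omega> > 0" "integrable M (\<lambda>\<omega>. X \<omega> powr \<sigma>)"
    "negative_moment M X (- \<sigma>) = ennreal (expectation (\<lambda>\<omega>. X \<omega> powr \<sigma>))"
proof -
  have fin: "(\<integral>\<^sup>+\<omega>. inverse (ennreal (X \<omega> powr (- \<sigma>))) \<partial>M) < \<infinity>"
    using negative_moment_finite_lt[of "- \<sigma>"] assms by (simp add: negative_moment_def)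
  have "AE \<omega> in M. inverse (ennreal (X \<omega> powr (- \<sigma>))) \<noteq> \<infinity>"
    by (rule nn_integral_PInf_AE) (use fin in auto)
  then show pos: "AE \<omega> in M. X \<omega> > 0"
  proof (rule AE_mp[OF _ AE_I2], intro impI)
    fix \<omega> assume "\<omega> \<in> space M" "inverse (ennreal (X \<omega> powr (- \<sigma>))) \<noteq> \<infinity>"
    then show "X \<omega> > 0" using X_nonneg[of \<omega>] by (cases "X \<omega> = 0") auto
  qed
  have eq: "(\<integral>\<^sup>+\<omega>. inverse (ennreal (X \<omega> powr (- \<sigma>))) \<partial>M) = (\<integral>\<^sup>+\<omega>. ennreal (X \<omega> powr \<sigma>) \<partial>M)"
  proof (rule nn_integral_cong_AE)
    show "AE \<omega> in M. inverse (ennreal (X \<omega> powr (- \<sigma>))) = ennreal (X \<omega> powr \<sigma>)"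
      using pos
    proof eventually_elim
      case (elim \<omega>)
      then have "X \<omega> powr (- \<sigma>) > 0" by simp
      then show ?case by (simp only: inverse_ennreal powr_minus inverse_inverse_eq)
    qed
  qed
  show int: "integrable M (\<lambda>\<omega>. X \<omega> powr \<sigma>)"
    by (rule integrableI_nonneg) (use fin eq in auto)
  show "negative_moment M X (- \<sigma>) = ennreal (expectation (\<lambda>\<omega>. X \<omega> powr \<sigma>))"
    unfolding negative_moment_def eq by (rule nn_integral_eq_integral[OF int]) auto
qed

lemma integrable_X_powr:
  assumes "- 1 / 3 < \<sigma>"
  shows "integrable M (\<lambda>\<omega>. X \<omega> powr \<sigma>)"
proof (cases "\<sigma> \<ge> 0")
  case True
  then show ?thesis by (rule integrable_X_powr_nonneg)
next
  case False
  then show ?thesis using assms by (intro negative_moment_eq(2)) auto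
qed

lemma X_powr_as_exp:
  assumes "\<omega> \<in> space M"
  shows "complex_of_real (X \<omega>) powr s = of_real (indicator {0<..} (X \<omega>)) * exp (s * of_real (ln (X \<omega>)))"
    "X \<omega> powr \<sigma> = indicator {0<..} (X \<omega>) * exp (\<sigma> * ln (X \<omega>))"
proof -
  have "complex_of_real (X \<omega>) powr s = of_real (indicator {0<..} (X \<omega>)) * exp (s * of_real (ln (X \<omega>))) \<and>
     X \<omega> powr \<sigma> = indicator {0<..} (X \<omega>) * exp (\<sigma> * ln (X \<omega>))"
  proof (cases "X \<omega> = 0")
    case False
    then have "X \<omega> > 0" using X_nonneg[OF assms] by simp
    then show ?thesis by (simp add: powr_def Ln_of_real)
  qed simp
  then show "complex_of_real (X \<omega>) powr s = of_real (indicator {0<..} (X \<omega>)) * exp (s * of_real (ln (X \<omega>)))"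
    "X \<omega> powr \<sigma> = indicator {0<..} (X \<omega>) * exp (\<sigma> * ln (X \<omega>))" by blast+
qed

lemma integrable_X_exp:
  assumes "- 1 / 3 < \<sigma>"
  shows "integrable M (\<lambda>\<omega>. indicator {0<..} (X \<omega>) * exp (\<sigma> * ln (X \<omega>)))"
proof -
  have "integrable M (\<lambda>\<omega>. X \<omega> powr \<sigma>) = integrable M (\<lambda>\<omega>. indicator {0<..} (X \<omega>) * exp (\<sigma> * ln (X \<omega>)))"
    by (rule Bochner_Integration.integrable_cong[OF refl]) (rule X_powr_as_exp(2))
  then show ?thesis using integrable_X_powr[OF assms] by blast
qed

lemma integrable_X_cpowr:
  assumes "Re s > - 1 / 3"
  shows "integrable M (\<lambda>\<omega>. complex_of_real (X \<omega>) powr s)"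
proof -
  have "integrable M (\<lambda>\<omega>. of_real (indicator {0<..} (X \<omega>)) * exp (s * of_real (ln (X \<omega>))) :: complex)"
    by (rule integrable_laplace[where a = "- 1 / 3" and b = "Re s + 1"]) (use assms integrable_X_exp in auto)
  moreover have "integrable M (\<lambda>\<omega>. complex_of_real (X \<omega>) powr s) = integrable M (\<lambda>\<omega>. of_real (indicator {0<..} (X \<omega>)) * exp (s * of_real (ln (X \<omega>))) :: complex)"
    by (rule Bochner_Integration.integrable_cong[OF refl]) (rule X_powr_as_exp(1))
  ultimately show ?thesis by blast
qed

lemma complex_moment_eq:
  "complex_moment M X s = (\<integral>\<omega>. of_real (indicator {0<..} (X \<omega>)) * exp (s * of_real (ln (X \<omega>))) \<partial>M)"
  unfolding complex_moment_def by (rule Bochner_Integration.integral_cong[OF refl]) (rule X_powr_as_exp(1))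

lemma complex_moment_holomorphic: "complex_moment M X holomorphic_on {s. Re s > - 1 / 3}"
proof (rule holomorphic_onI)
  fix s :: complex assume "s \<in> {s. Re s > - 1 / 3}"
  then have s: "Re s > - 1 / 3" by simp
  have "((\<lambda>s. \<integral>\<omega>. of_real (indicator {0<..} (X \<omega>)) * exp (s * of_real (ln (X \<omega>))) \<partial>M) has_field_derivative
      (\<integral>\<omega>. of_real (indicator {0<..} (X \<omega>) * ln (X \<omega>)) * exp (s * of_real (ln (X \<omega>))) \<partial>M :: complex)) (at s)"
    by (rule laplace_has_field_derivative[where a = "- 1 / 3" and b = "Re s + 1"]) (use s integrable_X_exp in auto)
  then show "complex_moment M X field_differentiable at s within {s. Re s > - 1 / 3}"
    unfolding complex_moment_eq[abs_def] field_differentiable_def by (blast intro: has_field_derivative_at_within)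
qed

lemma complex_moment_of_real: "complex_moment M X (of_real \<sigma>) = of_real (expectation (\<lambda>\<omega>. X \<omega> powr \<sigma>))"
proof -
  have "complex_moment M X (of_real \<sigma>) = (\<integral>\<omega>. of_real (X \<omega> powr \<sigma>) \<partial>M)"
    unfolding complex_moment_def
    by (rule Bochner_Integration.integral_cong[OF refl]) (simp add: powr_of_real X_nonneg)
  then show ?thesis by simp
qed

text \<open>
  The part of the Mellin integral beyond \<open>\<delta>\<^sup>2\<close>, with \<open>x powr (3 * s / 2)\<close> written as an exponential.
\<close>
definition tail_mellin :: "real \<Rightarrow> complex \<Rightarrow> complex" where
  "tail_mellin \<delta> s = (\<integral>x. of_real (indicator {\<delta>\<^sup>2<..} x * resolvent x) * exp (s * of_real (3 / 2 * ln x)) \<partial>lborel)"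

lemma integrable_tail:
  assumes "\<delta> > 0" "\<sigma> < 0"
  shows "integrable lborel (\<lambda>x. indicator {\<delta>\<^sup>2<..} x * resolvent x * exp (\<sigma> * (3 / 2 * ln x)))"
proof (rule integrableI_nonneg)
  have "(\<integral>\<^sup>+x. ennreal (indicator {\<delta>\<^sup>2<..} x * resolvent x * exp (\<sigma> * (3 / 2 * ln x))) \<partial>lborel)
      \<le> (\<integral>\<^sup>+x. ennreal (x powr (3 * \<sigma> / 2 - 1)) * indicator {\<delta>\<^sup>2<..} x \<partial>lborel)"
  proof (rule nn_integral_mono)
    fix x :: real
    show "ennreal (indicator {\<delta>\<^sup>2<..} x * resolvent x * exp (\<sigma> * (3 / 2 * ln x))) \<le> ennreal (x powr (3 * \<sigma> / 2 - 1)) * indicator {\<delta>\<^sup>2<..} x"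
    proof (cases "x > \<delta>\<^sup>2")
      case True
      then have x: "x > 0" using assms by (meson less_trans zero_less_power)
      have "resolvent x * exp (\<sigma> * (3 / 2 * ln x)) \<le> 1 / x * exp (\<sigma> * (3 / 2 * ln x))"
        using resolvent_le[OF x] by (intro mult_right_mono) auto
      also have "\<dots> = x powr (3 * \<sigma> / 2 - 1)"
        using x by (simp add: powr_def left_diff_distrib exp_diff)
      finally show ?thesis using True by (simp add: ennreal_leI)
    qed auto
  qed
  also have "\<dots> < \<infinity>" using assms by (subst nn_integral_powr_to_inf) auto
  finally show "(\<integral>\<^sup>+x. ennreal (indicator {\<delta>\<^sup>2<..} x * resolvent x * exp (\<sigma> * (3 / 2 * ln x))) \<partial>lborel) < \<infinity>" .
qed (auto simp: resolvent_nonneg)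

lemma tail_mellin_holomorphic:
  assumes "\<delta> > 0"
  shows "tail_mellin \<delta> holomorphic_on {s. Re s < 0}"
proof (rule holomorphic_onI)
  fix s :: complex assume "s \<in> {s. Re s < 0}"
  then have s: "Re s < 0" by simp
  have "((\<lambda>s. \<integral>x. of_real (indicator {\<delta>\<^sup>2<..} x * resolvent x) * exp (s * of_real (3 / 2 * ln x)) \<partial>lborel) has_field_derivative
      (\<integral>x. of_real (indicator {\<delta>\<^sup>2<..} x * resolvent x * (3 / 2 * ln x)) * exp (s * of_real (3 / 2 * ln x)) \<partial>lborel :: complex)) (at s)"
    by (rule laplace_has_field_derivative[where a = "Re s - 1" and b = 0]) (use s integrable_tail[OF assms] in auto)
  then show "tail_mellin \<delta> field_differentiable at s within {s. Re s < 0}"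
    unfolding tail_mellin_def[abs_def] field_differentiable_def by (blast intro: has_field_derivative_at_within)
qed

text \<open>
  Termwise integration of the power series of \<open>h\<close>: the term \<open>q ^ k\<close> with \<open>q = sqrt x\<close> contributes
  \<open>\<integral> x powr ((3 * \<sigma> + k - 1) / 2) dx\<close> over the interval up to \<open>\<delta>\<^sup>2\<close>, which is
  \<open>2 * \<delta> powr (3 * \<sigma> + k + 1) / (3 * \<sigma> + k + 1)\<close>.  The radius \<open>\<delta>\<close> is strictly inside the disc of
  convergence, so the coefficients are absolutely summable.
\<close>
lemma head_mellin:
  fixes h :: "complex \<Rightarrow> complex"
  assumes \<rho>: "0 < \<delta>" "\<delta> < \<rho>" and h: "h holomorphic_on ball 0 \<rho>"
    and hg: "\<And>q. 0 < q \<Longrightarrow> q < \<rho> \<Longrightarrow> complex_of_real (q * resolvent (q\<^sup>2)) = h (of_real q)"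
    and \<sigma>: "- 1 / 3 < \<sigma>"
  defines "c \<equiv> (\<lambda>k. (deriv ^^ k) h 0 / fact k * of_real (\<delta> ^ Suc k))"
  shows "summable (\<lambda>k. norm (c k))"
    "(\<integral>x. of_real (indicator {0<..\<delta>\<^sup>2} x * (x powr (3 * \<sigma> / 2) * resolvent x)) \<partial>lborel)
      = of_real (2 * \<delta> powr (3 * \<sigma>)) * (\<Sum>k. c k / (3 * of_real \<sigma> + of_nat k + 1))"
proof -
  define a where "a k = (deriv ^^ k) h 0 / fact k" for k
  have pw: "(\<lambda>k. a k * q ^ k) sums h q" if "q \<in> ball 0 \<rho>" for q
    using holomorphic_power_series[OF h that] by (simp add: a_def)
  have abs_sum: "summable (\<lambda>k. norm (a k * of_real q ^ k))" if "0 \<le> q" "q \<le> \<delta>" for q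
  proof (rule powser_insidea)
    show "summable (\<lambda>k. a k * (of_real ((\<delta> + \<rho>) / 2)) ^ k)"
      using \<rho> by (intro sums_summable[OF pw]) (simp add: norm_of_real del: of_real_add of_real_divide)
    show "norm (complex_of_real q) < norm (complex_of_real ((\<delta> + \<rho>) / 2))"
      using that \<rho> by (simp only: norm_of_real) auto
  qed
  have c_eq: "c k = a k * of_real \<delta> ^ k * of_real \<delta>" for k by (simp add: c_def a_def)
  show sc: "summable (\<lambda>k. norm (c k))"
    unfolding c_eq norm_mult[of _ "of_real \<delta>"] using abs_sum[of \<delta>] \<rho> by (intro summable_mult2) auto
  define e where "e k = (3 * \<sigma> + real k - 1) / 2" for k
  have e: "e k > - 1" "e k + 1 > 0" for k
  proof -
    have "- 1 < 3 * \<sigma> + real k" using \<sigma> of_nat_0_le_iff[of k, where ?'a = real] by linarith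
    then show "e k > - 1" "e k + 1 > 0" by (simp_all add: e_def field_simps)
  qed
  define b where "b k = 2 * \<delta> powr (3 * \<sigma>) * \<delta> ^ Suc k / (3 * \<sigma> + real k + 1)" for k
  have b: "(\<delta>\<^sup>2) powr (e k + 1) / (e k + 1) = b k" for k
  proof -
    have "(\<delta>\<^sup>2) powr (e k + 1) = \<delta> powr (2 * (e k + 1))"
      using powr_powr[of \<delta> 2 "e k + 1"] \<rho> by simp
    also have "2 * (e k + 1) = 3 * \<sigma> + real (Suc k)" by (simp add: e_def field_simps)
    also have "\<delta> powr \<dots> = \<delta> powr (3 * \<sigma>) * \<delta> ^ Suc k"
      using \<rho> by (simp only: powr_add powr_realpow)
    finally show ?thesis by (simp add: b_def e_def field_simps)
  qed
  let ?g = "\<lambda>k x. indicator {0<..\<delta>\<^sup>2} x * x powr e k :: real"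
  have hb: "has_bochner_integral lborel (?g k) (b k)" for k
  proof (rule has_bochner_integral_nn_integral)
    have "(\<integral>\<^sup>+x. ennreal (?g k x) \<partial>lborel) = (\<integral>\<^sup>+x. ennreal (x powr e k) * indicator {0<..\<delta>\<^sup>2} x \<partial>lborel)"
      by (intro nn_integral_cong) (auto simp: indicator_def)
    also have "\<dots> = ennreal (b k)" using \<rho> e(1)[of k] by (simp add: nn_integral_powr_near_0 b)
    finally show "(\<integral>\<^sup>+x. ennreal (?g k x) \<partial>lborel) = ennreal (b k)" .
    show "0 \<le> b k" unfolding b[symmetric] using e(2)[of k] by simp
  qed auto
  let ?f = "\<lambda>k x. a k * of_real (?g k x)"
  have intf: "integrable lborel (?f k)" for k
  proof -
    have "integrable lborel (?g k)" using hb[of k] by (simp add: has_bochner_integral_iff)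
    then show ?thesis by (intro integrable_mult_right integrable_of_real)
  qed
  have pt: "?f k x = of_real (x powr (3 * \<sigma> / 2 - 1 / 2)) * (a k * of_real (sqrt x) ^ k)" if "0 < x" "x \<le> \<delta>\<^sup>2" for k x
  proof -
    have "e k = (3 * \<sigma> / 2 - 1 / 2) + real k / 2" by (simp add: e_def field_simps)
    then have "x powr e k = x powr (3 * \<sigma> / 2 - 1 / 2) * x powr (real k / 2)"
      by (simp only: powr_add)
    also have "x powr (real k / 2) = sqrt x ^ k"
    proof -
      have "x powr (real k / 2) = (x powr (1 / 2)) powr real k" by (simp add: powr_powr)
      also have "\<dots> = (x powr (1 / 2)) ^ k" using that by (intro powr_realpow) simp
      finally show ?thesis using that by (simp add: powr_half_sqrt)
    qed
    finally show ?thesis using that by simp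
  qed
  have sq: "0 \<le> sqrt x" "sqrt x \<le> \<delta>" "0 < sqrt x" if "0 < x" "x \<le> \<delta>\<^sup>2" for x
    using that \<rho> by (auto simp: real_le_lsqrt)
  have "(\<lambda>k. integral\<^sup>L lborel (?f k)) sums (\<integral>x. (\<Sum>k. ?f k x) \<partial>lborel)"
  proof (rule sums_integral[OF intf])
    show "AE x in lborel. summable (\<lambda>k. norm (?f k x))"
    proof (rule AE_I2)
      fix x :: real
      show "summable (\<lambda>k. norm (?f k x))"
      proof (cases "0 < x \<and> x \<le> \<delta>\<^sup>2")
        case True
        then show ?thesis
          unfolding pt[OF True[THEN conjunct1] True[THEN conjunct2]] norm_mult[of "of_real _"]
          using abs_sum[OF sq(1,2)] by (intro summable_mult) auto
      qed auto
    qed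
    have "(\<integral>x. norm (?f k x) \<partial>lborel) = norm (a k) * b k" for k
    proof -
      have "(\<integral>x. norm (?f k x) \<partial>lborel) = (\<integral>x. norm (a k) * ?g k x \<partial>lborel)"
        by (intro Bochner_Integration.integral_cong) (auto simp: norm_mult)
      also have "\<dots> = norm (a k) * b k"
        using has_bochner_integral_integral_eq[OF hb[of k]] by simp
      finally show ?thesis .
    qed
    moreover have "summable (\<lambda>k. norm (a k) * b k)"
    proof (rule summable_comparison_test')
      show "summable (\<lambda>k. norm (c k) * (2 * \<delta> powr (3 * \<sigma>) / (3 * \<sigma> + 1)))"
        using sc by (rule summable_mult2)
      show "norm (norm (a k) * b k) \<le> norm (c k) * (2 * \<delta> powr (3 * \<sigma>) / (3 * \<sigma> + 1))" for k
      proof -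
        have "norm (a k) * b k = norm (c k) * (2 * \<delta> powr (3 * \<sigma>) / (3 * \<sigma> + real k + 1))"
          using \<rho> by (simp add: b_def c_eq norm_mult norm_power)
        also have "\<dots> \<le> norm (c k) * (2 * \<delta> powr (3 * \<sigma>) / (3 * \<sigma> + 1))"
          using \<sigma> by (intro mult_left_mono divide_left_mono mult_pos_pos) auto
        finally have "norm (a k) * b k \<le> norm (c k) * (2 * \<delta> powr (3 * \<sigma>) / (3 * \<sigma> + 1))" .
        moreover have "b k \<ge> 0" using b[of k] e(2)[of k] by (metis divide_nonneg_pos powr_ge_zero)
        ultimately show ?thesis by simp
      qed
    qed
    ultimately show "summable (\<lambda>k. \<integral>x. norm (?f k x) \<partial>lborel)" by simp
  qed
  moreover have "(\<Sum>k. ?f k x) = of_real (indicator {0<..\<delta>\<^sup>2} x * (x powr (3 * \<sigma> / 2) * resolvent x))" for x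
  proof (cases "0 < x \<and> x \<le> \<delta>\<^sup>2")
    case True
    note x = True[THEN conjunct1] True[THEN conjunct2]
    have "(\<lambda>k. a k * of_real (sqrt x) ^ k) sums h (of_real (sqrt x))"
      using sq[OF x] \<rho> by (intro pw) auto
    then have "(\<Sum>k. ?f k x) = of_real (x powr (3 * \<sigma> / 2 - 1 / 2)) * h (of_real (sqrt x))"
      unfolding pt[OF x] by (intro sums_unique[symmetric] sums_mult)
    also have "h (of_real (sqrt x)) = of_real (sqrt x * resolvent x)"
      using hg[of "sqrt x"] sq[OF x] \<rho> x by simp
    also have "of_real (x powr (3 * \<sigma> / 2 - 1 / 2)) * of_real (sqrt x * resolvent x) = complex_of_real ((x powr (3 * \<sigma> / 2 - 1 / 2) * x powr (1 / 2)) * resolvent x)"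
      using x by (simp add: powr_half_sqrt)
    also have "x powr (3 * \<sigma> / 2 - 1 / 2) * x powr (1 / 2) = x powr (3 * \<sigma> / 2)"
      by (simp flip: powr_add)
    finally show ?thesis using True by simp
  qed auto
  moreover have "integral\<^sup>L lborel (?f k) = of_real (2 * \<delta> powr (3 * \<sigma>)) * (c k / (3 * of_real \<sigma> + of_nat k + 1))" for k
  proof -
    have "integral\<^sup>L lborel (?f k) = a k * (\<integral>x. of_real (?g k x) \<partial>lborel)"
      by (rule integral_mult_right_zero)
    also have "(\<integral>x. of_real (?g k x) \<partial>lborel) = complex_of_real (b k)"
      by (simp only: integral_complex_of_real has_bochner_integral_integral_eq[OF hb[of k]])
    finally have "integral\<^sup>L lborel (?f k) = a k * of_real (b k)" .
    also have "\<dots> = of_real (2 * \<delta> powr (3 * \<sigma>)) * (c k / (3 * of_real \<sigma> + of_nat k + 1))"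
      by (simp add: b_def c_eq)
    finally show ?thesis .
  qed
  ultimately have "(\<lambda>k. of_real (2 * \<delta> powr (3 * \<sigma>)) * (c k / (3 * of_real \<sigma> + of_nat k + 1))) sums
      (\<integral>x. of_real (indicator {0<..\<delta>\<^sup>2} x * (x powr (3 * \<sigma> / 2) * resolvent x)) \<partial>lborel)"
    by simp
  moreover have "(\<lambda>k. of_real (2 * \<delta> powr (3 * \<sigma>)) * (c k / (3 * of_real \<sigma> + of_nat k + 1))) sums
     (of_real (2 * \<delta> powr (3 * \<sigma>)) * (\<Sum>k. c k / (3 * of_real \<sigma> + of_nat k + 1)))"
    by (intro sums_mult summable_sums pole_series_summable sc)
  ultimately show "(\<integral>x. of_real (indicator {0<..\<delta>\<^sup>2} x * (x powr (3 * \<sigma> / 2) * resolvent x)) \<partial>lborel)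
      = of_real (2 * \<delta> powr (3 * \<sigma>)) * (\<Sum>k. c k / (3 * of_real \<sigma> + of_nat k + 1))"
    by (rule sums_unique2)
qed

lemma real_moment_identity:
  assumes \<sigma>: "- 1 / 3 < \<sigma>" "\<sigma> < 0" and \<delta>: "\<delta> > 0"
  shows "complex_of_real (Gamma (1 + 3 * \<sigma> / 2) * (2 / 3 * Gamma (- \<sigma>)) * expectation (\<lambda>\<omega>. X \<omega> powr \<sigma>))
    = (\<integral>x. of_real (indicator {0<..\<delta>\<^sup>2} x * (x powr (3 * \<sigma> / 2) * resolvent x)) \<partial>lborel) + tail_mellin \<delta> (of_real \<sigma>)"
proof -
  define K where "K = Gamma (1 + 3 * \<sigma> / 2) * (2 / 3 * Gamma (- \<sigma>))"
  have K: "K > 0" using \<sigma> by (auto simp: K_def intro!: mult_pos_pos Gamma_real_pos)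
  define u where "u x = indicator {0<..} x * (x powr (3 * \<sigma> / 2) * resolvent x)" for x
  define z where "z = - (3 * \<sigma> / 2)"
  have z: "0 < z" "z < 1" "1 - z = 1 + 3 * \<sigma> / 2" "2 * z / 3 = - \<sigma>" "- z = 3 * \<sigma> / 2"
    using \<sigma> by (auto simp: z_def)
  have u0: "u x \<ge> 0" for x by (auto simp: u_def resolvent_nonneg)
  have [measurable]: "u \<in> borel_measurable borel" unfolding u_def by measurable
  have nn: "(\<integral>\<^sup>+x. ennreal (u x) \<partial>lborel) = ennreal (K * expectation (\<lambda>\<omega>. X \<omega> powr \<sigma>))"
  proof -
    have "(\<integral>\<^sup>+x. ennreal (u x) \<partial>lborel) = (\<integral>\<^sup>+x. ennreal (x powr (- z)) * ennreal (resolvent x) * indicator {0<..} x \<partial>lborel)"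
      by (intro nn_integral_cong) (auto simp: u_def z indicator_def ennreal_mult resolvent_nonneg)
    also have "\<dots> = ennreal K * ennreal (expectation (\<lambda>\<omega>. X \<omega> powr \<sigma>))"
      using mellin_resolvent[OF z(1,2)] negative_moment_eq(3)[OF \<sigma>] by (simp add: z K_def)
    also have "\<dots> = ennreal (K * expectation (\<lambda>\<omega>. X \<omega> powr \<sigma>))"
      using K by (intro ennreal_mult[symmetric] Bochner_Integration.integral_nonneg) auto
    finally show ?thesis .
  qed
  have intu: "integrable lborel u"
    by (rule integrableI_nonneg) (use nn u0 in auto)
  have "ennreal (integral\<^sup>L lborel u) = ennreal (K * expectation (\<lambda>\<omega>. X \<omega> powr \<sigma>))"
    using nn_integral_eq_integral[OF intu] u0 nn by simp
  then have eqK: "integral\<^sup>L lborel u = K * expectation (\<lambda>\<omega>. X \<omega> powr \<sigma>)"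
    using K u0 by (subst (asm) ennreal_inj) (auto intro!: Bochner_Integration.integral_nonneg mult_nonneg_nonneg)
  let ?h = "\<lambda>x. indicator {0<..\<delta>\<^sup>2} x * (x powr (3 * \<sigma> / 2) * resolvent x)"
  let ?t = "\<lambda>x. indicator {\<delta>\<^sup>2<..} x * resolvent x * exp (\<sigma> * (3 / 2 * ln x))"
  have th: "?t x = indicator {\<delta>\<^sup>2<..} x * u x" for x
  proof (cases "x > \<delta>\<^sup>2")
    case True
    then have "x > 0" using \<delta> by (meson less_trans zero_less_power)
    then show ?thesis by (simp add: u_def powr_def mult_ac)
  qed auto
  have hh: "?h x = indicator {0<..\<delta>\<^sup>2} x * u x" for x by (auto simp: u_def indicator_def)
  have d2: "\<delta>\<^sup>2 > 0" using \<delta> by simp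
  have ut: "u x = ?h x + ?t x" for x
    unfolding th hh using d2 by (cases "0 < x"; cases "x \<le> \<delta>\<^sup>2") (auto simp: u_def)
  have inth: "integrable lborel ?h"
    unfolding hh using integrable_real_mult_indicator[OF _ intu, of "{0<..\<delta>\<^sup>2}"] by (simp add: mult.commute)
  have intt: "integrable lborel ?t" by (rule integrable_tail[OF \<delta> \<sigma>(2)])
  have "integral\<^sup>L lborel u = integral\<^sup>L lborel ?h + integral\<^sup>L lborel ?t"
    unfolding ut[abs_def] by (rule Bochner_Integration.integral_add[OF inth intt])
  moreover have "tail_mellin \<delta> (of_real \<sigma>) = of_real (integral\<^sup>L lborel ?t)"
  proof -
    have "tail_mellin \<delta> (of_real \<sigma>) = (\<integral>x. of_real (?t x) \<partial>lborel)"
      unfolding tail_mellin_def by (intro Bochner_Integration.integral_cong refl) (simp flip: exp_of_real)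
    then show ?thesis by (simp only: integral_complex_of_real)
  qed
  moreover have "(\<integral>x. of_real (?h x) \<partial>lborel) = complex_of_real (integral\<^sup>L lborel ?h)"
    by (rule integral_complex_of_real)
  ultimately show ?thesis using eqK unfolding K_def by simp
qed

text \<open>
  The continuation is the moment itself where that converges and the explicit function \<open>G\<close> elsewhere.
  The two agree on the strip \<open>- 1 / 3 < Re s < 0\<close> by the identity theorem, since they agree on its real
  points.
\<close>
lemma meromorphic_continuation:
  obtains F where "F nicely_meromorphic_on UNIV"
    "\<And>s. Re s > - 1 / 3 \<Longrightarrow> F s = complex_moment M X s"
    "\<And>z. is_pole F z \<Longrightarrow> zorder F z = - 1 \<and> z \<in> {- (2 * of_nat k + 1) / 3 | k::nat. True}"
    "residue F (- 1 / 3) = complex_of_real (2 powr (1 / 6) / (Gamma (1 / 2) * Gamma (1 / 3)) * (3 powr (-1/3) * Gamma (1/3) / Gamma (2/3)))"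
proof -
  obtain \<rho> h where \<rho>: "\<rho> > 0" and h: "h holomorphic_on ball 0 \<rho>"
    and hg: "\<And>q. 0 < q \<Longrightarrow> q < \<rho> \<Longrightarrow> complex_of_real (q * resolvent (q\<^sup>2)) = h (of_real q)"
    and h0: "h 0 = complex_of_real (2 powr (1/6) * (3 powr (-1/3) * Gamma (1/3) / Gamma (2/3)))"
    using resolvent_near_0 by blast
  define \<delta> where "\<delta> = \<rho> / 2"
  have \<delta>: "0 < \<delta>" "\<delta> < \<rho>" using \<rho> by (auto simp: \<delta>_def)
  define c where "c k = (deriv ^^ k) h 0 / fact k * of_real (\<delta> ^ Suc k)" for k
  have sc: "summable (\<lambda>k. norm (c k))"
    unfolding c_def by (rule head_mellin(1)[OF \<delta> h hg, of 0]) auto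
  define P where "P s = 3 / 2 * (rGamma (- s) * rGamma (1 + 3 * s / 2))" for s :: complex
  define Q where "Q s = P s * (2 * exp (3 * s * of_real (ln \<delta>)))" for s :: complex
  define E where "E s = (\<Sum>k. c k / (3 * s + of_nat k + 1))" for s :: complex
  define T where "T = tail_mellin \<delta>"
  define G where "G s = Q s * E s + P s * T s" for s
  have P_an: "P analytic_on A" for A
    unfolding P_def by (intro analytic_intros) auto
  have Q_an: "Q analytic_on A" for A
    unfolding Q_def by (intro analytic_intros P_an)
  have T_an: "T analytic_on {s}" if "Re s < 0" for s
    using tail_mellin_holomorphic[OF \<delta>(1)] that open_halfspace_Re_lt[of 0] unfolding T_def analytic_at by blast
  have G_an: "G analytic_on {s}" if "Re s < 0" "\<And>k. c k = 0 \<or> 3 * s + of_nat k + 1 \<noteq> 0" for s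
    unfolding G_def E_def using that by (intro analytic_intros P_an Q_an T_an pole_series_analytic sc) auto
  have ne_strip: "3 * s + of_nat k + 1 \<noteq> 0" if "Re s > - 1 / 3" for s and k :: nat
  proof
    assume "3 * s + of_nat k + 1 = 0"
    then have "Re (3 * s + of_nat k + 1) = 0" by simp
    with that of_nat_0_le_iff[of k, where ?'a = real] show False by simp
  qed
  have eq_real: "complex_moment M X (of_real \<sigma>) = G (of_real \<sigma>)" if \<sigma>: "- 1 / 3 < \<sigma>" "\<sigma> < 0" for \<sigma>
  proof -
    define g1 g2 where "g1 = Gamma (1 + 3 * \<sigma> / 2)" and "g2 = Gamma (- \<sigma>)"
    have g: "g1 > 0" "g2 > 0" using \<sigma> by (auto simp: g1_def g2_def intro!: Gamma_real_pos)
    have r: "rGamma (- complex_of_real \<sigma>) = of_real (inverse g2)" "rGamma (1 + 3 * complex_of_real \<sigma> / 2) = of_real (inverse g1)"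
    proof -
      have i: "rGamma (- \<sigma>) = inverse g2" "rGamma (1 + 3 * \<sigma> / 2) = inverse g1"
        by (simp_all add: g1_def g2_def rGamma_inverse_Gamma)
      show "rGamma (- complex_of_real \<sigma>) = of_real (inverse g2)"
        using rGamma_complex_of_real[of "- \<sigma>"] unfolding i by simp
      show "rGamma (1 + 3 * complex_of_real \<sigma> / 2) = of_real (inverse g1)"
        using rGamma_complex_of_real[of "1 + 3 * \<sigma> / 2"] unfolding i by simp
    qed
    have ex: "2 * exp (3 * complex_of_real \<sigma> * of_real (ln \<delta>)) = of_real (2 * \<delta> powr (3 * \<sigma>))"
      using \<delta> by (simp add: powr_def flip: exp_of_real)
    have "complex_of_real (g1 * (2 / 3 * g2) * expectation (\<lambda>\<omega>. X \<omega> powr \<sigma>)) = of_real (2 * \<delta> powr (3 * \<sigma>)) * E (of_real \<sigma>) + T (of_real \<sigma>)"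
      unfolding g1_def g2_def real_moment_identity[OF \<sigma> \<delta>(1)] E_def T_def c_def
      by (subst head_mellin(2)[OF \<delta> h hg \<sigma>(1)]) auto
    then have "complex_of_real (3 / 2 * (inverse g2 * inverse g1)) * complex_of_real (g1 * (2 / 3 * g2) * expectation (\<lambda>\<omega>. X \<omega> powr \<sigma>))
        = G (of_real \<sigma>)"
      unfolding G_def Q_def ex P_def r by (simp add: algebra_simps)
    moreover have "3 / 2 * (inverse g2 * inverse g1) * (g1 * (2 / 3 * g2) * expectation (\<lambda>\<omega>. X \<omega> powr \<sigma>)) = expectation (\<lambda>\<omega>. X \<omega> powr \<sigma>)"
      using g by (simp add: field_simps)
    ultimately show ?thesis unfolding complex_moment_of_real by (metis of_real_mult)
  qed
  define S where "S = {s. - 1 / 3 < Re s} \<inter> {s. Re s < 0}"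
  have S: "open S" "connected S"
    unfolding S_def
    by (intro open_Int open_halfspace_Re_gt open_halfspace_Re_lt convex_connected convex_Int convex_halfspace_Re_gt convex_halfspace_Re_lt)+
  have eq_strip: "complex_moment M X s = G s" if "s \<in> S" for s
  proof -
    have "complex_moment M X s - G s = 0"
    proof (rule analytic_continuation[where f = "\<lambda>s. complex_moment M X s - G s" and S = S and U = "of_real ` {- 1 / 3 <..< 0}" and \<xi> = "of_real (- 1 / 6)"])
      have "G analytic_on S"
        using G_an ne_strip by (subst analytic_on_analytic_at) (auto simp: S_def)
      then show "(\<lambda>s. complex_moment M X s - G s) holomorphic_on S"
        by (intro holomorphic_intros analytic_imp_holomorphic holomorphic_on_subset[OF complex_moment_holomorphic]) (auto simp: S_def)
      show "complex_of_real (- 1 / 6) islimpt of_real ` {- 1 / 3 <..< 0}"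
        unfolding islimpt_approachable
      proof (intro allI impI)
        fix e :: real assume e: "e > 0"
        define d where "d = min e (1 / 6) / 2"
        have d: "d > 0" "d < e" "d < 1 / 6" using e by (auto simp: d_def min_def)
        show "\<exists>x'\<in>complex_of_real ` {- 1 / 3<..<0}. x' \<noteq> of_real (- 1 / 6) \<and> dist x' (of_real (- 1 / 6)) < e"
        proof (intro bexI conjI)
          show "complex_of_real (- 1 / 6 + d) \<noteq> of_real (- 1 / 6)" unfolding of_real_eq_iff using d by simp
          show "dist (complex_of_real (- 1 / 6 + d)) (of_real (- 1 / 6)) < e" unfolding dist_of_real using d by (simp add: dist_real_def)
          show "complex_of_real (- 1 / 6 + d) \<in> of_real ` {- 1 / 3<..<0}" using d by (intro imageI) auto
        qed
      qed
      show "complex_moment M X z - G z = 0" if "z \<in> of_real ` {- 1 / 3 <..< 0}" for z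
        using that eq_real by auto
    qed (use S that in \<open>auto simp: S_def\<close>)
    then show ?thesis by simp
  qed
  define F0 where "F0 s = (if Re s > - 1 / 3 then complex_moment M X s else G s)" for s
  have F0_right: "F0 analytic_on {s}" if "Re s > - 1 / 3" for s
  proof -
    have "complex_moment M X analytic_on {s}"
      using complex_moment_holomorphic that open_halfspace_Re_gt[of "- 1 / 3"] unfolding analytic_at by blast
    moreover have "\<forall>\<^sub>F w in nhds s. F0 w = complex_moment M X w"
      using eventually_nhds_in_open[OF open_halfspace_Re_gt[of "- 1 / 3"], of s] that
      by (auto simp: F0_def elim!: eventually_mono)
    ultimately show ?thesis by (subst analytic_at_cong[OF _ refl])
  qed
  have F0_left: "\<forall>\<^sub>F w in nhds s. F0 w = G w" if "Re s < 0" for s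
    using eventually_nhds_in_open[OF open_halfspace_Re_lt[of 0], of s] that eq_strip
    by (auto simp: F0_def S_def elim!: eventually_mono)
  have pole: "F0 meromorphic_on {s}" "residue F0 s = Q s * c j / 3" "is_pole F0 s \<Longrightarrow> zorder F0 s = - 1 \<and> Q s * c j / 3 \<noteq> 0"
    if s: "s = - (of_nat j + 1) / 3" for s and j :: nat
  proof -
    have Re_s: "Re s < 0" unfolding s by simp
    define v where "v w = Q w * (\<Sum>k. (c(j := 0)) k / (3 * w + of_nat k + 1)) + P w * T w" for w
    have ne: "(c(j := 0)) k = 0 \<or> 3 * s + of_nat k + 1 \<noteq> 0" for k
    proof (cases "k = j")
      case False
      have "3 * s + of_nat k + 1 = of_nat k - of_nat j" by (simp add: s field_simps)
      moreover have "of_nat k - of_nat j \<noteq> (0::complex)" using False by simp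
      ultimately have "3 * s + of_nat k + 1 \<noteq> 0" by (simp only: not_False_eq_True)
      then show ?thesis by blast
    qed simp
    have sc': "summable (\<lambda>k. norm ((c(j := 0)) k))"
      by (rule summable_comparison_test'[OF sc, of 0]) auto
    have v_an: "v analytic_on {s}"
      unfolding v_def using Re_s by (intro analytic_intros P_an Q_an T_an pole_series_analytic sc' ne)
    have u_an: "(\<lambda>w. Q w * c j / 3) analytic_on {s}"
      by (intro analytic_intros Q_an) auto
    have "G w = (Q w * c j / 3) / (w - s) + v w" for w
    proof -
      have "3 * w + of_nat j + 1 = 3 * (w - s)" by (simp add: s field_simps)
      then show ?thesis
        unfolding G_def E_def v_def pole_series_split[OF sc, of w j] by (simp add: algebra_simps)
    qed
    moreover have "\<forall>\<^sub>F w in at s. F0 w = G w"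
      using F0_left[OF Re_s] by (simp add: eventually_at_filter eventually_mono)
    ultimately have "\<forall>\<^sub>F w in at s. F0 w = (Q w * c j / 3) / (w - s) + v w" by simp
    from simple_pole_form[OF u_an v_an this]
    show "F0 meromorphic_on {s}" "residue F0 s = Q s * c j / 3" "is_pole F0 s \<Longrightarrow> zorder F0 s = - 1 \<and> Q s * c j / 3 \<noteq> 0" by auto
  qed
  have analytic_or_candidate: "F0 analytic_on {s} \<or> (\<exists>j::nat. s = - (of_nat j + 1) / 3)" for s
  proof (cases "Re s > - 1 / 3 \<or> (\<exists>j::nat. s = - (of_nat j + 1) / 3)")
    case False
    then have Re_s: "Re s < 0" by auto
    have "3 * s + of_nat k + 1 \<noteq> 0" for k
    proof
      assume "3 * s + of_nat k + 1 = 0"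
      then have "3 * s = - (of_nat k + 1)" by (simp add: eq_neg_iff_add_eq_0 algebra_simps)
      then have "s = - (of_nat k + 1) / 3" by (simp add: field_simps)
      with False show False by blast
    qed
    then have "G analytic_on {s}" using Re_s by (intro G_an) auto
    then show ?thesis by (subst analytic_at_cong[OF F0_left[OF Re_s] refl]) auto
  qed (use F0_right in auto)
  have mero: "F0 meromorphic_on UNIV"
  proof (subst meromorphic_on_meromorphic_at, rule ballI)
    fix s
    show "F0 meromorphic_on {s}"
      using analytic_or_candidate[of s] pole(1) by (auto intro: analytic_on_imp_meromorphic_on)
  qed
  have iso: "isolated_singularity_at F0 s" for s
    using meromorphic_on_isolated_singularity[OF meromorphic_on_subset[OF mero, of "{s}"]] by simp
  show ?thesis
  proof (rule that[of "remove_sings F0"])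
    show "remove_sings F0 nicely_meromorphic_on UNIV" by (rule remove_sings_nicely_meromorphic[OF mero])
    show "remove_sings F0 s = complex_moment M X s" if "Re s > - 1 / 3" for s
      using F0_right[OF that] that by (simp add: F0_def)
    show "zorder (remove_sings F0) z = - 1 \<and> z \<in> {- (2 * of_nat k + 1) / 3 | k::nat. True}" if "is_pole (remove_sings F0) z" for z
    proof -
      note ev = eventually_remove_sings_eq_at[OF iso[of z]]
      have p: "is_pole F0 z" using that is_pole_cong[OF ev refl] by simp
      have "\<not> F0 analytic_on {z}" using p by (meson analytic_at not_is_pole_holomorphic)
      then obtain j :: nat where j: "z = - (of_nat j + 1) / 3" using analytic_or_candidate by blast
      have zo: "zorder F0 z = - 1" "Q z \<noteq> 0" using pole(3)[OF j p] by auto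
      have "even j"
      proof (rule ccontr)
        assume "odd j"
        then obtain m where m: "j = 2 * m + 1" by (elim oddE)
        \<comment> \<open>The reciprocal Gamma factor cancels the candidate poles at the negative integer multiples of \<open>2 / 3\<close>.\<close>
        have "1 + 3 * z / 2 = - of_nat m" by (simp add: j m field_simps)
        then have "rGamma (1 + 3 * z / 2) = 0" by (simp add: rGamma_eq_zero_iff)
        then have "Q z = 0" by (simp add: Q_def P_def)
        with zo(2) show False by simp
      qed
      then obtain m where "j = 2 * m" by (elim evenE)
      then have "z = - (2 * of_nat m + 1) / 3" by (simp add: j)
      moreover have "zorder (remove_sings F0) z = zorder F0 z"
        by (rule zorder_cong[OF ev refl])
      ultimately show ?thesis using zo by auto
    qed
    have "residue (remove_sings F0) (- 1 / 3) = residue F0 (- 1 / 3)"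
      by (rule residue_remove_sings[OF iso])
    also have "\<dots> = Q (- 1 / 3) * c 0 / 3" using pole(2)[of "- 1 / 3" 0] by simp
    also have "\<dots> = rGamma (1 / 3) * rGamma (1 / 2) * h 0"
    proof -
      have "exp (- complex_of_real (ln \<delta>)) * of_real \<delta> = 1"
        using \<delta> by (simp add: exp_minus exp_of_real)
      moreover have "Q (- 1 / 3) * c 0 / 3 = rGamma (1 / 3) * rGamma (1 / 2) * h 0 * (exp (- complex_of_real (ln \<delta>)) * of_real \<delta>)"
        by (simp add: Q_def P_def c_def)
      ultimately show ?thesis by simp
    qed
    also have "\<dots> = complex_of_real (2 powr (1 / 6) / (Gamma (1 / 2) * Gamma (1 / 3)) * (3 powr (-1/3) * Gamma (1/3) / Gamma (2/3)))"
    proof -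
      have i: "rGamma (1 / 3 :: real) = inverse (Gamma (1 / 3))" "rGamma (1 / 2 :: real) = inverse (Gamma (1 / 2))"
        by (simp_all only: rGamma_inverse_Gamma)
      have "rGamma (1 / 3 :: complex) = of_real (inverse (Gamma (1 / 3)))" "rGamma (1 / 2 :: complex) = of_real (inverse (Gamma (1 / 2)))"
        using rGamma_complex_of_real[of "1/3"] rGamma_complex_of_real[of "1/2"] unfolding i by simp_all
      then show ?thesis
        unfolding h0 by (simp only: of_real_mult[symmetric] divide_inverse inverse_mult_distrib mult_ac)
    qed
    finally show "residue (remove_sings F0) (- 1 / 3) = complex_of_real (2 powr (1 / 6) / (Gamma (1 / 2) * Gamma (1 / 3)) * (3 powr (-1/3) * Gamma (1/3) / Gamma (2/3)))" .
  qed
qed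

end

lemma residue_constant_forms:
  "2 powr (1 / 6) / (Gamma (1 / 2) * Gamma (1 / 3)) * (airy_Ai 0 / (- deriv airy_Ai 0))
     = 2 powr (1 / 6) * 3 powr (- 1 / 3) / (sqrt pi * Gamma (2 / 3))"
  "2 powr (1 / 6) * 3 powr (- 1 / 3) / (sqrt pi * Gamma (2 / 3))
     = 2 powr (- 5 / 6) * 3 powr (1 / 6) * pi powr (- 3 / 2) * Gamma (1 / 3 :: real)"
proof -
  have G: "Gamma (1/3 :: real) > 0" "Gamma (2/3 :: real) > 0" by (simp_all add: Gamma_real_pos)
  have "a / (sqrt pi * g1) * (b * g1 / g2) = a * b / (sqrt pi * g2)" if "g1 > 0" for a b g1 g2 :: real
    using that by simp
  from this[OF G(1)]
  show "2 powr (1 / 6) / (Gamma (1 / 2) * Gamma (1 / 3)) * (airy_Ai 0 / (- deriv airy_Ai 0))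
     = 2 powr (1 / 6) * 3 powr (- 1 / 3) / (sqrt pi * Gamma (2 / 3))"
    unfolding airy_Ai_ratio Gamma_one_half_real .
  have "complex_of_real (Gamma (1/3) * Gamma (2/3)) = of_real (pi / sin (pi / 3))"
    using Gamma_reflection_complex[of "1/3"] Gamma_complex_of_real[of "1/3"] Gamma_complex_of_real[of "2/3"] sin_of_real[of "pi/3", where ?'a = complex]
    by simp
  then have refl: "Gamma (1/3) * Gamma (2/3) = pi / sin (pi / 3)" by (simp only: of_real_eq_iff)
  then have key: "Gamma (1/3) * Gamma (2/3) * sqrt 3 = 2 * pi"
    by (simp add: sin_60)
  have g2: "1 / Gamma (2/3) = Gamma (1/3) * sqrt 3 / (2 * pi)"
  proof -
    have "1 / b = a * r / (a * b * r)" if "a \<noteq> 0" "r \<noteq> 0" for a b r :: real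
      using that by simp
    from this[OF less_imp_neq[OF G(1), symmetric], of "sqrt 3"] show ?thesis
      unfolding key[symmetric] by simp
  qed
  have "pi powr (3 / 2) = pi * sqrt pi"
    using powr_add[of pi 1 "1/2"] by (simp add: powr_half_sqrt)
  then have p: "pi powr (- 3 / 2) = 1 / (pi * sqrt pi)"
    using powr_minus_divide[of pi "3/2"] by simp
  have three: "3 powr (1/6) = 3 powr (- 1/3) * sqrt (3::real)"
    using powr_add[of "3::real" "- 1/3" "1/2"] by (simp add: powr_half_sqrt)
  have two: "2 powr (- 5/6) = 2 powr (1/6) / (2::real)"
    using powr_diff[of "2::real" "1/6" 1] by simp
  have "2 powr (1 / 6) * 3 powr (- 1 / 3) / (sqrt pi * Gamma (2 / 3)) = 2 powr (1 / 6) * 3 powr (- 1 / 3) / sqrt pi * (1 / Gamma (2/3))"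
    by simp
  also have "\<dots> = 2 powr (- 5 / 6) * 3 powr (1 / 6) * pi powr (- 3 / 2) * Gamma (1 / 3 :: real)"
    unfolding g2 p three two by (simp add: mult_ac)
  finally show "2 powr (1 / 6) * 3 powr (- 1 / 3) / (sqrt pi * Gamma (2 / 3))
     = 2 powr (- 5 / 6) * 3 powr (1 / 6) * pi powr (- 3 / 2) * Gamma (1 / 3 :: real)" .
qed

theorem mainTheorem3:
  fixes M :: "'a measure" and B :: "real \<Rightarrow> 'a \<Rightarrow> real"
  assumes "standard_brownian_motion M {0..1} B"
  shows "(\<forall>s::real. s > 0 \<longrightarrow>
           (negative_moment M (positive_part_area B) s < \<infinity> \<longleftrightarrow> s < 1 / 3)) \<and>
         (\<forall>s::complex. Re s > - 1 / 3 \<longrightarrow>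
           integrable M (\<lambda>\<omega>. complex_of_real (positive_part_area B \<omega>) powr s)) \<and>
         complex_moment M (positive_part_area B) analytic_on {s. Re s > - 1 / 3} \<and>
         (\<exists>F. F nicely_meromorphic_on UNIV \<and>
              (\<forall>s. Re s > - 1 / 3 \<longrightarrow> F s = complex_moment M (positive_part_area B) s) \<and>
              (\<forall>z. is_pole F z \<longrightarrow>
                 zorder F z = - 1 \<and> z \<in> {- (2 * of_nat k + 1) / 3 | k::nat. True}) \<and>
              residue F (- 1 / 3) =
                complex_of_real (2 powr (1 / 6) / (Gamma (1 / 2) * Gamma (1 / 3))
                  * (airy_Ai 0 / (- deriv airy_Ai 0)))) \<and>
         2 powr (1 / 6) / (Gamma (1 / 2) * Gamma (1 / 3)) * (airy_Ai 0 / (- deriv airy_Ai 0))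
           = 2 powr (1 / 6) * 3 powr (- 1 / 3) / (sqrt pi * Gamma (2 / 3)) \<and>
         2 powr (1 / 6) * 3 powr (- 1 / 3) / (sqrt pi * Gamma (2 / 3))
           = 2 powr (- 5 / 6) * 3 powr (1 / 6) * pi powr (- 3 / 2) * Gamma (1 / 3 :: real)"
proof -
  interpret brownian M B by (rule brownian.intro[OF assms])
  obtain F where F: "F nicely_meromorphic_on UNIV"
    "\<And>s. Re s > - 1 / 3 \<Longrightarrow> F s = complex_moment M (positive_part_area B) s"
    "\<And>z. is_pole F z \<Longrightarrow> zorder F z = - 1 \<and> z \<in> {- (2 * of_nat k + 1) / 3 | k::nat. True}"
    "residue F (- 1 / 3) = complex_of_real (2 powr (1 / 6) / (Gamma (1 / 2) * Gamma (1 / 3)) * (3 powr (-1/3) * Gamma (1/3) / Gamma (2/3)))"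
    using meromorphic_continuation by blast
  have an: "complex_moment M (positive_part_area B) analytic_on {s. Re s > - 1 / 3}"
    using complex_moment_holomorphic by (subst analytic_on_open) (auto simp: open_halfspace_Re_gt)
  show ?thesis
  proof (intro conjI allI impI)
    show "negative_moment M (positive_part_area B) s < \<infinity> \<longleftrightarrow> s < 1 / 3" if "s > 0" for s
      by (rule negative_moment_finite_iff[OF that])
    show "integrable M (\<lambda>\<omega>. complex_of_real (positive_part_area B \<omega>) powr s)" if "Re s > - 1 / 3" for s
      by (rule integrable_X_cpowr[OF that])
    show "\<exists>F. F nicely_meromorphic_on UNIV \<and>
              (\<forall>s. Re s > - 1 / 3 \<longrightarrow> F s = complex_moment M (positive_part_area B) s) \<and>
              (\<forall>z. is_pole F z \<longrightarrow>
                 zorder F z = - 1 \<and> z \<in> {- (2 * of_nat k + 1) / 3 | k::nat. True}) \<and>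
              residue F (- 1 / 3) =
                complex_of_real (2 powr (1 / 6) / (Gamma (1 / 2) * Gamma (1 / 3))
                  * (airy_Ai 0 / (- deriv airy_Ai 0)))"
      unfolding airy_Ai_ratio using F by blast
  qed (fact an residue_constant_forms)+
qed

end
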